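(* There exists $\epsilon>0$ such that \[ \|\Psi_\lambda-\Psi_\lambda^\infty\|_{\hat{\mathcal H}}=O(e^{-\epsilon\,m(\lambda)})\quad\text{as } m(\lambda)\to\infty, \] where $m(\lambda)=\min_{\alpha\in\boldsymbol{R}^+}\langle\lambda,\alpha^\vee\rangle$ and $\Psi_\lambda^\infty(\xi)=\hat\Delta^{1/2}(\xi)\sum_{w\in W}(-1)^w\hat{\mathcal{C}}(w\xi)e^{i\langle\rho+\lambda,w\xi\rangle}$ (equivalently $\Psi^\infty_\lambda=\sum_{w}(-1)^w\hat S_w^{1/2}(\xi)e^{i\langle\rho+\lambda,w\xi\rangle}$ with $\hat S_w^{1/2}(\xi)=\hat{\mathcal C}(w\xi)/|\hat{\mathcal C}(w\xi)|$, a square root of $\hat S_w(\xi)=\hat{\mathcal{C}}(w\xi)/\hat{\mathcal{C}}(-w\xi)$).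
   Context: Let $\mathbf{E}$ be a real $N$-dimensional Euclidean space with inner product $\langle\cdot,\cdot\rangle$ and $\boldsymbol{R}\subset\mathbf{E}$ an irreducible crystallographic root system (possibly nonreduced) spanning $\mathbf{E}$, with positive roots $\boldsymbol{R}^+$, Weyl group $W$, $(-1)^w=\det w$, coroots $\alpha^\vee=2\alpha/\langle\alpha,\alpha\rangle$, dominant weights $\mathcal{P}^+=\{\lambda\mid\langle\lambda,\alpha^\vee\rangle\in\mathbb{N}\ \forall\alpha\in\boldsymbol{R}^+\}$ (weights $\mathcal P$ defined with $\alpha\in\boldsymbol R$), $\boldsymbol{R}_0=\{\alpha\mid2\alpha\notin\boldsymbol{R}\}$, $\boldsymbol{R}_1=\{\alpha\mid\alpha/2\notin\boldsymbol{R}\}$, $\boldsymbol R_i^+=\boldsymbol R_i\cap\boldsymbol R^+$, $\rho=\frac12\sum_{\alpha\in\boldsymbol{R}_0^+}\alpha$. $\mathbf{A}=\{\xi\mid0<\langle\xi,\alpha\rangle<2\pi\ \forall\alpha\in\boldsymbol{R}^+\}$; $m_\lambda(\xi)=|W_\lambda|^{-1}\sum_{w}e^{i\langle\lambda,w\xi\rangle}$; $\delta(\xi)=\prod_{\alpha\in\boldsymbol{R}_0^+}(e^{i\langle\alpha,\xi\rangle/2}-e^{-i\langle\alpha,\xi\rangle/2})$. For $\alpha\in\boldsymbol{R}_1^+$, $\hat c_{|\alpha|}(z)$ depends only on the $W$-orbit of $\alpha$, is analytic and zero-free on the closed disc $|z|\le\varrho$ for some $\varrho>1$, $\hat c_{|\alpha|}(0)=1$,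 real for real $z$; $\hat{\mathcal{C}}(\xi)=\prod_{\alpha\in\boldsymbol{R}_1^+}\hat c_{|\alpha|}(e^{-i\langle\alpha,\xi\rangle})$, $\hat\Delta(\xi)=1/(\hat{\mathcal{C}}(\xi)\hat{\mathcal{C}}(-\xi))$, $(f,g)_{\hat\Delta}=(|W|\mathrm{Vol}(\mathbf{A}))^{-1}\int_{\mathbf{A}}f\bar g\hat\Delta|\delta|^2d\xi$. $P_\lambda=\sum_{\mu\preceq\lambda}a_{\lambda\mu}m_\mu$ ($a_{\lambda\lambda}>0$) are obtained by Gram–Schmidt w.r.t. $(\cdot,\cdot)_{\hat\Delta}$ and a partial order $\succeq$ on $\mathcal P^+$ refining the dominance order ($\lambda\geqslant\mu\iff\lambda-\mu\in\mathrm{Span}_{\mathbb N}\boldsymbol R^+$) with finite lower sets, assumed fine enough that the $P_\lambda$ are orthonormal. $\hat{\mathcal H}=L^2(\mathbf{A},d\xi)$ with norm $\|\hat f\|_{\hat{\mathcal H}}^2=(|W|\mathrm{Vol}(\mathbf{A}))^{-1}\int_{\mathbf{A}}|\hat f|^2d\xi$, and $\Psi_\lambda=\hat\Delta^{1/2}\delta P_\lambda$. *)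

theory Defs
  imports "HOL-Analysis.Analysis"
begin

definition coroot :: "real^'n \<Rightarrow> real^'n" where
  "coroot \<alpha> = (2 / (\<alpha> \<bullet> \<alpha>)) *\<^sub>R \<alpha>"

definition rrefl :: "real^'n \<Rightarrow> real^'n \<Rightarrow> real^'n" where
  "rrefl \<alpha> x = x - (x \<bullet> coroot \<alpha>) *\<^sub>R \<alpha>"

definition crystallographic_root_system :: "(real^'n) set \<Rightarrow> bool" where
  "crystallographic_root_system R \<longleftrightarrow>
     finite R \<and> 0 \<notin> R \<and> span R = UNIV \<and>
     (\<forall>\<alpha>\<in>R. rrefl \<alpha> ` R \<subseteq> R) \<and>
     (\<forall>\<alpha>\<in>R. \<forall>\<beta>\<in>R. \<beta> \<bullet> coroot \<alpha> \<in> \<int>)"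

definition irreducible_root_system :: "(real^'n) set \<Rightarrow> bool" where
  "irreducible_root_system R \<longleftrightarrow>
     \<not> (\<exists>R1 R2. R1 \<noteq> {} \<and> R2 \<noteq> {} \<and> R1 \<union> R2 = R \<and> R1 \<inter> R2 = {} \<and>
              (\<forall>\<alpha>\<in>R1. \<forall>\<beta>\<in>R2. \<alpha> \<bullet> \<beta> = 0))"

definition positive_system :: "(real^'n) set \<Rightarrow> (real^'n) set \<Rightarrow> bool" where
  "positive_system R Rp \<longleftrightarrow>
     (\<exists>v. (\<forall>\<alpha>\<in>R. \<alpha> \<bullet> v \<noteq> 0) \<and> Rp = {\<alpha>\<in>R. \<alpha> \<bullet> v > 0})"

inductive_set weyl_group :: "(real^'n) set \<Rightarrow> (real^'n \<Rightarrow> real^'n) set" for R where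
  wg_id: "id \<in> weyl_group R"
| wg_step: "w \<in> weyl_group R \<Longrightarrow> \<alpha> \<in> R \<Longrightarrow> rrefl \<alpha> \<circ> w \<in> weyl_group R"

definition wsign :: "(real^'n \<Rightarrow> real^'n) \<Rightarrow> real" where
  "wsign w = det (matrix w)"

definition dominant_weights :: "(real^'n) set \<Rightarrow> (real^'n) set" where
  "dominant_weights Rp = {lam. \<forall>\<alpha>\<in>Rp. lam \<bullet> coroot \<alpha> \<in> \<nat>}"

definition dominance :: "(real^'n) set \<Rightarrow> real^'n \<Rightarrow> real^'n \<Rightarrow> bool" where
  "dominance Rp lam \<mu> \<longleftrightarrow> (\<exists>n :: real^'n \<Rightarrow> nat. lam - \<mu> = (\<Sum>\<alpha>\<in>Rp. real (n \<alpha>) *\<^sub>R \<alpha>))"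

definition roots0 :: "(real^'n) set \<Rightarrow> (real^'n) set" where
  "roots0 R = {\<alpha>\<in>R. 2 *\<^sub>R \<alpha> \<notin> R}"

definition roots1 :: "(real^'n) set \<Rightarrow> (real^'n) set" where
  "roots1 R = {\<alpha>\<in>R. (1/2) *\<^sub>R \<alpha> \<notin> R}"

definition rho :: "(real^'n) set \<Rightarrow> (real^'n) set \<Rightarrow> real^'n" where
  "rho R Rp = (1/2) *\<^sub>R (\<Sum>\<alpha>\<in>roots0 R \<inter> Rp. \<alpha>)"

definition alcove :: "(real^'n) set \<Rightarrow> (real^'n) set" where
  "alcove Rp = {\<xi>. \<forall>\<alpha>\<in>Rp. 0 < \<xi> \<bullet> \<alpha> \<and> \<xi> \<bullet> \<alpha> < 2 * pi}"

definition stabilizer :: "(real^'n) set \<Rightarrow> real^'n \<Rightarrow> (real^'n \<Rightarrow> real^'n) set" where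
  "stabilizer R lam = {w \<in> weyl_group R. w lam = lam}"

definition msym :: "(real^'n) set \<Rightarrow> real^'n \<Rightarrow> real^'n \<Rightarrow> complex" where
  "msym R lam \<xi> = (1 / of_nat (card (stabilizer R lam))) *
      (\<Sum>w\<in>weyl_group R. exp (\<i> * complex_of_real (lam \<bullet> w \<xi>)))"

definition delta :: "(real^'n) set \<Rightarrow> (real^'n) set \<Rightarrow> real^'n \<Rightarrow> complex" where
  "delta R Rp \<xi> = (\<Prod>\<alpha>\<in>roots0 R \<inter> Rp.
      exp (\<i> * complex_of_real (\<alpha> \<bullet> \<xi>) / 2) - exp (- \<i> * complex_of_real (\<alpha> \<bullet> \<xi>) / 2))"

text \<open>c maps a root alpha to the function hat c_{|alpha|}.\<close>
definition Chat :: "(real^'n) set \<Rightarrow> (real^'n) set \<Rightarrow> (real^'n \<Rightarrow> complex \<Rightarrow> complex)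
                     \<Rightarrow> real^'n \<Rightarrow> complex" where
  "Chat R Rp c \<xi> = (\<Prod>\<alpha>\<in>roots1 R \<inter> Rp. c \<alpha> (exp (- \<i> * complex_of_real (\<alpha> \<bullet> \<xi>))))"

definition Deltahat :: "(real^'n) set \<Rightarrow> (real^'n) set \<Rightarrow> (real^'n \<Rightarrow> complex \<Rightarrow> complex)
                     \<Rightarrow> real^'n \<Rightarrow> complex" where
  "Deltahat R Rp c \<xi> = 1 / (Chat R Rp c \<xi> * Chat R Rp c (- \<xi>))"

definition ip_Delta :: "(real^'n) set \<Rightarrow> (real^'n) set \<Rightarrow> (real^'n \<Rightarrow> complex \<Rightarrow> complex)
      \<Rightarrow> (real^'n \<Rightarrow> complex) \<Rightarrow> (real^'n \<Rightarrow> complex) \<Rightarrow> complex" where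
  "ip_Delta R Rp c f g =
     complex_of_real (1 / (real (card (weyl_group R)) * measure lebesgue (alcove Rp))) *
     (LINT \<xi>:alcove Rp|lebesgue. f \<xi> * cnj (g \<xi>) * Deltahat R Rp c \<xi> *
                                  complex_of_real ((cmod (delta R Rp \<xi>))\<^sup>2))"

definition Hnorm :: "(real^'n) set \<Rightarrow> (real^'n) set \<Rightarrow> (real^'n \<Rightarrow> complex) \<Rightarrow> real" where
  "Hnorm R Rp f = sqrt ((1 / (real (card (weyl_group R)) * measure lebesgue (alcove Rp))) *
      (LINT \<xi>:alcove Rp|lebesgue. (cmod (f \<xi>))\<^sup>2))"

definition mmin :: "(real^'n) set \<Rightarrow> real^'n \<Rightarrow> real" where
  "mmin Rp lam = Min ((\<lambda>\<alpha>. lam \<bullet> coroot \<alpha>) ` Rp)"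

definition Psi :: "(real^'n) set \<Rightarrow> (real^'n) set \<Rightarrow> (real^'n \<Rightarrow> complex \<Rightarrow> complex)
      \<Rightarrow> (real^'n \<Rightarrow> complex) \<Rightarrow> real^'n \<Rightarrow> complex" where
  "Psi R Rp c Plam \<xi> = csqrt (Deltahat R Rp c \<xi>) * delta R Rp \<xi> * Plam \<xi>"

definition Psi_inf :: "(real^'n) set \<Rightarrow> (real^'n) set \<Rightarrow> (real^'n \<Rightarrow> complex \<Rightarrow> complex)
      \<Rightarrow> real^'n \<Rightarrow> real^'n \<Rightarrow> complex" where
  "Psi_inf R Rp c lam \<xi> = csqrt (Deltahat R Rp c \<xi>) *
     (\<Sum>w\<in>weyl_group R. complex_of_real (wsign w) * Chat R Rp c (w \<xi>) *
        exp (\<i> * complex_of_real ((rho R Rp + lam) \<bullet> w \<xi>)))"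

end

theory Submission
  imports Defs "HOL-Complex_Analysis.Complex_Analysis"
begin

text \<open>
  Write \<open>p = \<delta> P\<close>, let \<open>j\<close> be the alternating sum \<open>\<Sum>\<^sub>w (-1)\<^sup>w C(w\<xi>) e(\<rho>+\<lambda>, w\<xi>)\<close>, and pair functions
  by \<open>(F, G) = (|W| Vol A)\<^sup>-\<^sup>1 \<integral>\<^sub>A F G\<^sup>* \<Delta>\<close>; nothing is ever divided by \<open>\<delta>\<close>. Since \<open>C(w\<xi>)\<^sup>* \<Delta>(\<xi>) = 1 / C(w\<xi>)\<close>
  has only exponents in the negative root cone, \<open>(\<delta> m\<^sub>\<mu>, j)\<close> unfolds to a Fourier coefficient that vanishes
  unless \<open>\<mu> \<ge> \<lambda>\<close> and is 1 for \<open>\<mu> = \<lambda>\<close>; hence \<open>(p, j)\<close> is the leading coefficient \<open>a\<close> of \<open>P\<close>. Truncating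
  the power series of \<open>C\<close> at an order proportional to \<open>m(\<lambda>)\<close> changes \<open>j\<close> by an exponentially small \<open>e\<close> and
  leaves \<open>q = \<delta> (m\<^sub>\<lambda> + lower terms)\<close>, because all exponents that occur stay dominant and Weyl characters
  are triangular in the \<open>m\<^sub>\<mu>\<close>. Then \<open>(q, j) = 1\<close> and \<open>(q, p) = 1 / a\<close>, so \<open>a - 1 / a\<close> and
  \<open>\<parallel>p - j\<parallel>\<^sup>2 = 2 (1 - a) + (e, j)\<close> are exponentially small.
\<close>

section \<open>Root systems and the Weyl group\<close>

text \<open>The weight enters as a budget. Keeping the powers below \<open>N\<close> in every factor
  of \<open>C\<close> lowers exponents by at most \<open>N * Dbound\<close> in each coroot
  direction. As long as this is at most \<open>mmin\<close>, every exponent of the truncated sum is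
  \<rho> plus a dominant weight, and no reflection has to fold it back. So \<open>N\<close> can grow
  linearly with \<open>mmin\<close>, and an error \<open>s ^ N\<close> becomes exponential in it.
  The order that defines \<open>P\<close> may be finer than dominance, so \<open>P\<close> can
  contain monomials whose weights dominance does not compare with \<lambda>. The pairing with
  \<open>j\<close> still ignores them: it is governed by dominance alone, and antisymmetry of the
  order forbids a lower weight to dominate \<lambda>. Conversely the terms of \<open>q\<close> below
  \<lambda> in dominance are lower in the order, hence orthogonal to \<open>p\<close>. The function
  \<open>p\<close> is known only through its norm, whereas \<open>e\<close> and \<open>j\<close>
  have uniform bounds; hence \<open>(e, p)\<close> takes a Cauchy-Schwarz argument and
  \<open>(e, j)\<close> a pointwise bound. Finally \<open>|a - 1 / a| = |a - 1| (a + 1) / a\<close>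
  is at least \<open>|a - 1|\<close> for \<open>a > 0\<close>, so a small left side forces
  \<open>a\<close> close to 1.\<close>

lemma coroot_inner_self:
  assumes "a \<noteq> 0" shows "a \<bullet> coroot a = 2"
  using assms by (simp add: coroot_def)

lemma coroot_scaleR: "coroot (c *\<^sub>R a) = (1 / c) *\<^sub>R coroot a"
  by (cases "c = 0") (simp_all add: coroot_def field_simps)

lemma coroot_minus [simp]: "coroot (- a) = - coroot a"
  by (simp add: coroot_def)

lemma coroot_orthogonal:
  assumes "orthogonal_transformation f" shows "coroot (f a) = f (coroot a)"
  using assms by (simp add: coroot_def orthogonal_transformation_def linear_cmul)

lemma rrefl_inner_sym: "(x \<bullet> coroot a) * (a \<bullet> y) = (y \<bullet> coroot a) * (a \<bullet> x)"
  by (simp add: coroot_def inner_commute)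

lemma rrefl_self:
  assumes "a \<noteq> 0" shows "rrefl a a = - a"
  using assms by (simp add: rrefl_def coroot_inner_self scaleR_2)

lemma linear_rrefl: "linear (rrefl a)"
  by (rule linearI) (simp_all add: rrefl_def inner_add_left algebra_simps)

lemma rrefl_rrefl [simp]: "rrefl a (rrefl a x) = x"
proof (cases "a = 0")
  case True then show ?thesis by (simp add: rrefl_def)
next
  case False
  have "rrefl a (rrefl a x) = x - (x \<bullet> coroot a) *\<^sub>R a - ((x \<bullet> coroot a) - (x \<bullet> coroot a) * (a \<bullet> coroot a)) *\<^sub>R a"
    by (simp add: rrefl_def inner_diff_left)
  then show ?thesis using False by (simp add: coroot_inner_self algebra_simps)
qed

lemma inner_rrefl_swap: "rrefl a x \<bullet> y = x \<bullet> rrefl a y"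
  using rrefl_inner_sym[of x a y] by (simp add: rrefl_def inner_diff inner_commute)

lemma orthogonal_rrefl: "orthogonal_transformation (rrefl a)"
  by (simp add: orthogonal_transformation_def linear_rrefl inner_rrefl_swap)

lemma rrefl_scaleR:
  assumes "c \<noteq> 0" shows "rrefl (c *\<^sub>R a) = rrefl a"
  using assms by (simp add: rrefl_def coroot_scaleR fun_eq_iff)

lemma rrefl_minus [simp]: "rrefl (- a) = rrefl a"
  by (simp add: rrefl_def fun_eq_iff)

lemma rrefl_orthogonal:
  assumes "orthogonal_transformation f" shows "rrefl (f a) (f x) = f (rrefl a x)"
  using assms by (simp add: rrefl_def coroot_orthogonal orthogonal_transformation_def linear_cmul linear_diff)

text \<open>Conjugating by an orthogonal map that sends a multiple of a coordinate vector to
  \<open>a\<close> preserves the determinant and turns the reflection into a diagonal matrix with a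
  single entry -1.\<close>

lemma wsign_rrefl:
  fixes a :: "real^'n"
  assumes "a \<noteq> 0" shows "wsign (rrefl a) = - 1"
proof -
  obtain k :: 'n where True by simp
  obtain f where f: "orthogonal_transformation f" "f (axis k (norm a)) = a"
    by (rule orthogonal_transformation_exists[of "axis k (norm a)" a]) (simp add: norm_eq_sqrt_inner inner_axis_axis)
  define b where "b = (axis k (norm a) :: real^'n)"
  define g where "g = rrefl b"
  have g: "g = inv f \<circ> rrefl a \<circ> f"
    using rrefl_orthogonal[OF f(1), of b] f(2) orthogonal_transformation_inj[OF f(1)]
    by (simp add: g_def b_def fun_eq_iff)
  have lin: "linear f" "linear (rrefl a)" "linear (inv f)"
    using f(1) orthogonal_transformation_linear orthogonal_transformation_inv linear_rrefl by blast+
  have "matrix g = matrix (inv f) ** matrix (rrefl a) ** matrix f"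
    unfolding g using lin by (simp add: matrix_compose linear_compose)
  then have "det (matrix g) = det (matrix (inv f)) * det (matrix f) * det (matrix (rrefl a))"
    by (simp add: det_mul mult_ac)
  also have "det (matrix (inv f)) * det (matrix f) = det (matrix (inv f \<circ> f))"
    using lin by (simp add: matrix_compose det_mul)
  also have "inv f \<circ> f = id"
    using orthogonal_transformation_inj[OF f(1)] by (simp add: inv_o_cancel)
  finally have 1: "det (matrix g) = det (matrix (rrefl a))"
    by (metis matrix_id mult_1)
  have co: "coroot b = axis k (2 / norm a)"
    using assms unfolding coroot_def b_def inner_axis_axis by (simp add: vec_eq_iff axis_def)
  have gx: "g x $ i = (if i = k then - x $ i else x $ i)" for x i
    using assms by (simp add: g_def rrefl_def co inner_axis) (simp add: b_def axis_def)
  have "matrix g $ i $ j = (if i = j then (if i = k then -1 else 1) else 0)" for i j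
    by (simp add: matrix_def gx) (simp add: axis_def)
  then have "det (matrix g) = (\<Prod>i\<in>UNIV. (if i = k then -1 else 1))"
    by (subst det_diagonal) auto
  also have "\<dots> = -1"
    by (simp add: prod.If_cases)
  finally show ?thesis using 1 by (simp add: wsign_def)
qed

definition poscone :: "(real^'n) set \<Rightarrow> (real^'n) set" where
  "poscone P = {x. \<exists>n :: real^'n \<Rightarrow> nat. x = (\<Sum>\<alpha>\<in>P. real (n \<alpha>) *\<^sub>R \<alpha>)}"

lemma dominance_iff: "dominance P l m \<longleftrightarrow> l - m \<in> poscone P"
  by (simp add: dominance_def poscone_def)

lemma poscone_0 [simp]: "0 \<in> poscone P"
  unfolding poscone_def by (rule CollectI, rule exI[of _ "\<lambda>_. 0"]) simp

lemma poscone_add: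
  assumes "x \<in> poscone P" "y \<in> poscone P" shows "x + y \<in> poscone P"
proof -
  obtain n m :: "real^'a \<Rightarrow> nat" where "x = (\<Sum>\<alpha>\<in>P. real (n \<alpha>) *\<^sub>R \<alpha>)" "y = (\<Sum>\<alpha>\<in>P. real (m \<alpha>) *\<^sub>R \<alpha>)"
    using assms by (auto simp: poscone_def)
  then have "x + y = (\<Sum>\<alpha>\<in>P. real (n \<alpha> + m \<alpha>) *\<^sub>R \<alpha>)"
    by (simp add: sum.distrib scaleR_left_distrib)
  then show ?thesis unfolding poscone_def by (intro CollectI exI[of _ "\<lambda>\<alpha>. n \<alpha> + m \<alpha>"])
qed

lemma poscone_base:
  assumes "finite P" "a \<in> P" shows "a \<in> poscone P"
proof -
  have "a = (\<Sum>\<alpha>\<in>P. real (if \<alpha> = a then 1 else 0) *\<^sub>R \<alpha>)"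
    using assms by (subst sum.remove[of P a]) (auto intro!: sum.neutral)
  then show ?thesis unfolding poscone_def by (intro CollectI exI[of _ "\<lambda>\<alpha>. if \<alpha> = a then 1 else 0"])
qed

lemma poscone_scale_nat:
  assumes "x \<in> poscone P" shows "real k *\<^sub>R x \<in> poscone P"
  using assms by (induction k) (auto simp: scaleR_left_distrib poscone_add)

lemma poscone_Nats:
  assumes "x \<in> poscone P" "k \<in> \<nat>" shows "k *\<^sub>R x \<in> poscone P"
  using assms by (auto elim!: Nats_cases intro: poscone_scale_nat)

lemma poscone_sum:
  assumes "\<And>i. i \<in> I \<Longrightarrow> f i \<in> poscone P" shows "sum f I \<in> poscone P"
  using assms by (induction I rule: infinite_finite_induct) (auto intro: poscone_add)

text \<open>The regular vector \<open>v\<close> cutting out \<open>Rp\<close> stays a parameter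
  because pairing with it serves as a height. Strictly positive on \<open>Rp\<close>, it drives the
  inductions on positive roots, antisymmetry of dominance and the choice of a dominant orbit
  point.\<close>

locale root_system =
  fixes R Rp :: "(real^'n) set" and v :: "real^'n"
  assumes crystallographic: "crystallographic_root_system R"
    and regular: "\<And>\<alpha>. \<alpha> \<in> R \<Longrightarrow> \<alpha> \<bullet> v \<noteq> 0"
    and Rp_def: "Rp = {\<alpha>\<in>R. \<alpha> \<bullet> v > 0}"
begin

abbreviation "W \<equiv> weyl_group R"

lemma finite_R [simp]: "finite R" and zero_notin_R: "0 \<notin> R" and span_R: "span R = UNIV"
  and rrefl_R: "\<alpha> \<in> R \<Longrightarrow> \<beta> \<in> R \<Longrightarrow> rrefl \<alpha> \<beta> \<in> R"
  and integral_R: "\<alpha> \<in> R \<Longrightarrow> \<beta> \<in> R \<Longrightarrow> \<beta> \<bullet> coroot \<alpha> \<in> \<int>"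
  using crystallographic by (auto simp: crystallographic_root_system_def)

lemma finite_Rp [simp]: "finite Rp"
  by (simp add: Rp_def)

lemma Rp_R: "\<alpha> \<in> Rp \<Longrightarrow> \<alpha> \<in> R" and Rp_pos: "\<alpha> \<in> Rp \<Longrightarrow> \<alpha> \<bullet> v > 0" and R_nz: "\<alpha> \<in> R \<Longrightarrow> \<alpha> \<noteq> 0"
  using zero_notin_R by (auto simp: Rp_def)

lemma minus_R: "\<alpha> \<in> R \<Longrightarrow> - \<alpha> \<in> R"
  using rrefl_R[of \<alpha> \<alpha>] rrefl_self[of \<alpha>] R_nz by auto

lemma R_cases: "\<alpha> \<in> R \<Longrightarrow> \<alpha> \<in> Rp \<or> - \<alpha> \<in> Rp"
  using regular[of \<alpha>] minus_R[of \<alpha>] by (auto simp: Rp_def)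

lemma Rp_not_minus: "\<alpha> \<in> Rp \<Longrightarrow> - \<alpha> \<notin> Rp"
  by (auto simp: Rp_def)

lemma poscone_nonneg: "x \<in> poscone Rp \<Longrightarrow> x \<bullet> v \<ge> 0"
  unfolding poscone_def using less_imp_le[OF Rp_pos]
  by (auto simp: inner_sum_left intro!: sum_nonneg mult_nonneg_nonneg)

text \<open>The height of a combination is a sum of nonnegative terms, so a nonpositive total kills
  every coefficient. This is what makes dominance antisymmetric.\<close>

lemma poscone_eq_0:
  assumes "x \<in> poscone Rp" "x \<bullet> v \<le> 0" shows "x = 0"
proof -
  obtain n :: "real^'n \<Rightarrow> nat" where x: "x = (\<Sum>\<alpha>\<in>Rp. real (n \<alpha>) *\<^sub>R \<alpha>)"
    using assms(1) by (auto simp: poscone_def)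
  have nn: "\<And>\<alpha>. \<alpha> \<in> Rp \<Longrightarrow> 0 \<le> real (n \<alpha>) * (\<alpha> \<bullet> v)"
    using Rp_pos by (simp add: less_imp_le)
  have "(\<Sum>\<alpha>\<in>Rp. real (n \<alpha>) * (\<alpha> \<bullet> v)) = 0"
    using assms(2) nn sum_nonneg[of Rp "\<lambda>\<alpha>. real (n \<alpha>) * (\<alpha> \<bullet> v)"] by (simp add: x inner_sum_left)
  then have "\<forall>\<alpha>\<in>Rp. real (n \<alpha>) * (\<alpha> \<bullet> v) = 0"
    using sum_nonneg_eq_0_iff[of Rp "\<lambda>\<alpha>. real (n \<alpha>) * (\<alpha> \<bullet> v)"] nn by simp
  then have "\<forall>\<alpha>\<in>Rp. real (n \<alpha>) = 0"
    using Rp_pos by fastforce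
  then show ?thesis by (simp add: x)
qed

lemma W_orthogonal: "w \<in> W \<Longrightarrow> orthogonal_transformation w"
proof (induction rule: weyl_group.induct)
  case wg_id show ?case by (simp add: orthogonal_transformation_def linear_id)
next
  case (wg_step w \<alpha>) then show ?case by (intro orthogonal_transformation_compose orthogonal_rrefl)
qed

lemma W_linear: "w \<in> W \<Longrightarrow> linear w"
  using W_orthogonal orthogonal_transformation_linear by blast

lemma W_R: "w \<in> W \<Longrightarrow> \<alpha> \<in> R \<Longrightarrow> w \<alpha> \<in> R"
  by (induction rule: weyl_group.induct) (auto intro: rrefl_R)

lemma W_comp: "w \<in> W \<Longrightarrow> u \<in> W \<Longrightarrow> w \<circ> u \<in> W"
  by (induction rule: weyl_group.induct) (auto simp: comp_assoc intro: weyl_group.intros)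

lemma W_rrefl: "\<alpha> \<in> R \<Longrightarrow> rrefl \<alpha> \<in> W"
  using weyl_group.wg_step[OF weyl_group.wg_id] by fastforce

lemma W_bij: "w \<in> W \<Longrightarrow> bij w"
  using W_orthogonal orthogonal_transformation_bij by blast

lemma W_inj: "w \<in> W \<Longrightarrow> inj w"
  using W_bij bij_is_inj by blast

lemma W_inv: "w \<in> W \<Longrightarrow> inv w \<in> W"
proof (induction rule: weyl_group.induct)
  case wg_id show ?case using weyl_group.wg_id by (metis inv_id)
next
  case (wg_step w \<alpha>)
  have "inv (rrefl \<alpha>) = rrefl \<alpha>"
    by (rule inv_equality) simp_all
  moreover have "bij (rrefl \<alpha>)" using orthogonal_rrefl orthogonal_transformation_bij by blast
  ultimately have "inv (rrefl \<alpha> \<circ> w) = inv w \<circ> rrefl \<alpha>"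
    using W_bij[OF wg_step(1)] by (subst o_inv_distrib) auto
  then show ?case using W_comp W_rrefl wg_step by metis
qed

lemma W_inv_apply [simp]: "w \<in> W \<Longrightarrow> inv w (w x) = x" "w \<in> W \<Longrightarrow> w (inv w x) = x"
  using W_bij by (auto simp: bij_is_inj bij_is_surj surj_f_inv_f)

lemma W_inner: "w \<in> W \<Longrightarrow> w x \<bullet> w y = x \<bullet> y"
  using W_orthogonal by (auto simp: orthogonal_transformation_def)

lemma W_inner_inv: "w \<in> W \<Longrightarrow> x \<bullet> w y = inv w x \<bullet> y"
  using W_inner[of w "inv w x" y] by simp

lemma W_norm: "w \<in> W \<Longrightarrow> norm (w x) = norm x"
  using W_orthogonal orthogonal_transformation_norm by blast

text \<open>By linearity an element is determined by its restriction to the finite spanning set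
  \<open>R\<close>.\<close>

lemma finite_W: "finite W"
proof -
  have "inj_on (\<lambda>w. restrict w R) W"
  proof (rule inj_onI)
    fix w u assume wu: "w \<in> W" "u \<in> W" "restrict w R = restrict u R"
    have "w x = u x" if "x \<in> R" for x using wu(3) that by (metis restrict_apply')
    then have "w x = u x" for x
      using linear_eq_on[OF W_linear[OF wu(1)] W_linear[OF wu(2)], of x R] span_R by auto
    then show "w = u" by auto
  qed
  moreover have "(\<lambda>w. restrict w R) ` W \<subseteq> R \<rightarrow>\<^sub>E R" using W_R by auto
  moreover have "finite (R \<rightarrow>\<^sub>E R)" by (intro finite_PiE) auto
  ultimately show ?thesis by (meson finite_imageD finite_subset)
qed

lemma W_nonempty: "W \<noteq> {}" "card W > 0"
  using weyl_group.wg_id finite_W by (auto simp: card_gt_0_iff)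

lemma sum_W_comp_right:
  assumes "u \<in> W" shows "(\<Sum>w\<in>W. f (w \<circ> u)) = (\<Sum>w\<in>W. f w)"
proof (rule sum.reindex_bij_witness[of _ "\<lambda>w. w \<circ> inv u" "\<lambda>w. w \<circ> u"])
  fix a assume "a \<in> W"
  show "a \<circ> u \<circ> inv u = a" "a \<circ> inv u \<circ> u = a" using W_inv_apply[OF assms] by (auto simp: fun_eq_iff)
  show "a \<circ> u \<in> W" "a \<circ> inv u \<in> W" using W_comp assms W_inv \<open>a \<in> W\<close> by blast+
qed simp

lemma sum_W_inv: "(\<Sum>w\<in>W. f (inv w)) = (\<Sum>w\<in>W. f w)"
  by (rule sum.reindex_bij_witness[of _ inv inv]) (auto simp: W_inv inv_inv_eq W_bij)

lemma wsign_rrefl_comp: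
  assumes "w \<in> W" "\<alpha> \<in> R" shows "wsign (rrefl \<alpha> \<circ> w) = - wsign w"
  using wsign_rrefl[OF R_nz[OF assms(2)]] W_linear[OF assms(1)] linear_rrefl[of \<alpha>]
  by (simp add: wsign_def matrix_compose det_mul)

lemma wsign_comp: "w \<in> W \<Longrightarrow> u \<in> W \<Longrightarrow> wsign (w \<circ> u) = wsign w * wsign u"
  using W_linear by (simp add: wsign_def matrix_compose det_mul)

lemma wsign_id: "wsign id = 1"
  by (simp add: wsign_def matrix_id_mat_1)

lemma wsign_square: "w \<in> W \<Longrightarrow> wsign w * wsign w = 1"
proof (induction rule: weyl_group.induct)
  case (wg_step w \<alpha>) then show ?case by (metis wsign_rrefl_comp minus_mult_minus)
next
  case wg_id show ?case by (metis wsign_id mult_1)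
qed

lemma wsign_inv: "w \<in> W \<Longrightarrow> wsign (inv w) = wsign w"
proof -
  assume w: "w \<in> W"
  have "inv w \<circ> w = id" using w by auto
  then have "wsign (inv w) * wsign w = 1" using wsign_comp[OF W_inv[OF w] w] wsign_id by metis
  then show ?thesis using wsign_square[OF w] by (metis mult_right_cancel mult_zero_right zero_neq_one)
qed

section \<open>Simple roots as indecomposable positive roots, and induction along the height\<close>

definition simple :: "real^'n \<Rightarrow> bool" where
  "simple \<gamma> \<longleftrightarrow> \<gamma> \<in> Rp \<and> \<not> (\<exists>\<beta>1\<in>Rp. \<exists>\<beta>2\<in>Rp. \<gamma> = \<beta>1 + \<beta>2)"

lemma simple_Rp: "simple \<gamma> \<Longrightarrow> \<gamma> \<in> Rp" and simple_R: "simple \<gamma> \<Longrightarrow> \<gamma> \<in> R"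
  by (auto simp: simple_def Rp_R)

text \<open>Heights are real numbers; the descent is well-founded because only finitely many
  positive roots lie below a given one.\<close>

lemma pos_induct [consumes 1, case_names less]:
  assumes "\<alpha> \<in> Rp" and step: "\<And>\<alpha>. \<alpha> \<in> Rp \<Longrightarrow> (\<And>\<beta>. \<beta> \<in> Rp \<Longrightarrow> \<beta> \<bullet> v < \<alpha> \<bullet> v \<Longrightarrow> Q \<beta>) \<Longrightarrow> Q \<alpha>"
  shows "Q \<alpha>"
  using assms(1)
proof (induction "card {\<beta>\<in>Rp. \<beta> \<bullet> v < \<alpha> \<bullet> v}" arbitrary: \<alpha> rule: less_induct)
  case less
  show ?case
  proof (rule step[OF less.prems])
    fix \<beta> assume b: "\<beta> \<in> Rp" "\<beta> \<bullet> v < \<alpha> \<bullet> v"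
    then have "{\<delta>\<in>Rp. \<delta> \<bullet> v < \<beta> \<bullet> v} \<subset> {\<delta>\<in>Rp. \<delta> \<bullet> v < \<alpha> \<bullet> v}" by auto
    then show "Q \<beta>" using less.hyps[of \<beta>] b by (simp add: psubset_card_mono)
  qed
qed

text \<open>\<open>2 * t\<close> and \<open>2 / t\<close> are integers with product 4, which leaves
  1, 2 and 4 for \<open>2 * t\<close>.\<close>

lemma proportional_cases:
  assumes "\<alpha> \<in> R" "t *\<^sub>R \<alpha> \<in> R" "t > 0"
  shows "t = 1/2 \<or> t = 1 \<or> t = 2"
proof -
  have "(t *\<^sub>R \<alpha>) \<bullet> coroot \<alpha> \<in> \<int>" "\<alpha> \<bullet> coroot (t *\<^sub>R \<alpha>) \<in> \<int>" using integral_R assms by blast+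
  then have "2 * t \<in> \<int>" "2 / t \<in> \<int>"
    using coroot_inner_self[OF R_nz[OF assms(1)]] by (simp_all add: coroot_scaleR mult.commute)
  then obtain m n :: int where mn: "2 * t = of_int m" "2 / t = of_int n" by (auto elim!: Ints_cases)
  have "of_int (m * n) = (2 * t) * (2 / t)" using mn by simp
  also have "\<dots> = 4" using assms by simp
  finally have p: "m * n = 4" by linarith
  have "m > 0" using mn(1) assms(3) by linarith
  moreover have "m \<le> 4" using p \<open>m > 0\<close> by (metis dvd_triv_left zdvd_imp_le zero_less_numeral)
  ultimately have "m = 1 \<or> m = 2 \<or> m = 3 \<or> m = 4" by auto
  moreover have "m \<noteq> 3" using p by (cases "m = 3") (simp_all, presburger)
  ultimately show ?thesis using mn(1) by auto
qed

lemma simple_proportional: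
  assumes "simple \<gamma>" "t *\<^sub>R \<gamma> \<in> Rp" shows "t = 1 \<or> t = 2"
proof -
  have "t > 0" using Rp_pos[OF assms(2)] Rp_pos[OF simple_Rp[OF assms(1)]] by (simp add: zero_less_mult_iff)
  moreover have "t \<noteq> 1/2"
  proof
    assume "t = 1/2"
    then have "\<gamma> = t *\<^sub>R \<gamma> + t *\<^sub>R \<gamma>" by (simp only: scaleR_left_distrib[symmetric]) simp
    then show False using assms unfolding simple_def by blast
  qed
  ultimately show ?thesis using proportional_cases[of \<gamma> t] assms Rp_R simple_R by blast
qed

text \<open>Both Cartan integers are positive, and for nonproportional roots their product is less
  than 4. So one of them is 1, and the corresponding reflection yields the difference up to
  sign.\<close>

lemma diff_root:
  assumes "\<beta> \<in> R" "\<gamma> \<in> R" "\<beta> \<bullet> \<gamma> > 0" "\<And>t. \<beta> \<noteq> t *\<^sub>R \<gamma>"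
  shows "\<beta> - \<gamma> \<in> R"
proof -
  have nz: "\<beta> \<bullet> \<beta> > 0" "\<gamma> \<bullet> \<gamma> > 0" using R_nz assms by auto
  obtain p q :: int where p: "\<beta> \<bullet> coroot \<gamma> = of_int p" and q: "\<gamma> \<bullet> coroot \<beta> = of_int q"
    using integral_R assms by (meson Ints_cases)
  have pos: "p > 0" "q > 0"
  proof -
    have "real_of_int p > 0" "real_of_int q > 0"
      unfolding p[symmetric] q[symmetric] using nz assms(3) by (simp_all add: coroot_def inner_commute)
    then show "p > 0" "q > 0" by auto
  qed
  have "p = 1 \<or> q = 1"
  proof (rule ccontr)
    assume "\<not> ?thesis"
    then have "p \<ge> 2" "q \<ge> 2" using pos by auto
    then have "p * q \<ge> 2 * 2" by (intro mult_mono) auto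
    then have "real_of_int p * real_of_int q \<ge> 4" by (metis mult_2 numeral_Bit0 of_int_le_iff of_int_mult of_int_numeral)
    then have "4 \<le> 4 * (\<beta> \<bullet> \<gamma>)\<^sup>2 / ((\<beta> \<bullet> \<beta>) * (\<gamma> \<bullet> \<gamma>))"
      unfolding p[symmetric] q[symmetric] by (simp add: coroot_def inner_commute power2_eq_square mult_ac)
    then have "(\<beta> \<bullet> \<beta>) * (\<gamma> \<bullet> \<gamma>) \<le> (\<beta> \<bullet> \<gamma>)\<^sup>2" using nz by (simp add: field_simps)
    then have *: "\<beta> \<bullet> \<beta> \<le> (\<beta> \<bullet> \<gamma>)\<^sup>2 / (\<gamma> \<bullet> \<gamma>)" using nz by (simp add: field_simps)
    \<comment> \<open>\<open>t *\<^sub>R \<gamma>\<close> is the projection of \<beta> to the line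
      of \<gamma>. A product of at least 4 means equality in Cauchy-Schwarz, so the orthogonal
      remainder vanishes.\<close>
    define t where "t = (\<beta> \<bullet> \<gamma>) / (\<gamma> \<bullet> \<gamma>)"
    have "(\<beta> - t *\<^sub>R \<gamma>) \<bullet> (\<beta> - t *\<^sub>R \<gamma>) = \<beta> \<bullet> \<beta> - 2 * t * (\<beta> \<bullet> \<gamma>) + t * t * (\<gamma> \<bullet> \<gamma>)"
      by (simp add: inner_diff inner_commute algebra_simps)
    also have "\<dots> = \<beta> \<bullet> \<beta> - (\<beta> \<bullet> \<gamma>)\<^sup>2 / (\<gamma> \<bullet> \<gamma>)"
      using nz by (simp add: t_def field_simps power2_eq_square)
    finally have "(\<beta> - t *\<^sub>R \<gamma>) \<bullet> (\<beta> - t *\<^sub>R \<gamma>) \<le> 0" using * by simp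
    then have "\<beta> = t *\<^sub>R \<gamma>" by (metis inner_gt_zero_iff not_less right_minus_eq)
    then show False using assms(4) by blast
  qed
  then show ?thesis
  proof
    assume "p = 1" then show ?thesis using rrefl_R[OF assms(2,1)] p by (simp add: rrefl_def)
  next
    assume "q = 1" then show ?thesis using minus_R[OF rrefl_R[OF assms(1,2)]] q by (simp add: rrefl_def)
  qed
qed

text \<open>Descending along the root string through \<open>\<beta>\<close>: indecomposability of \<open>\<gamma>\<close> keeps every member positive.\<close>

lemma simple_rrefl_pos:
  assumes g: "simple \<gamma>" and "\<beta> \<in> Rp" "\<And>t. \<beta> \<noteq> t *\<^sub>R \<gamma>"
  shows "rrefl \<gamma> \<beta> \<in> Rp"
  using assms(2,3)
proof (induction rule: pos_induct)
  case (less \<beta>)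
  have gR: "\<gamma> \<in> R" "\<gamma> \<in> Rp" using g simple_R simple_Rp by auto
  have gv: "\<gamma> \<bullet> v > 0" using g simple_Rp Rp_pos by auto
  have gnn: "\<gamma> \<bullet> \<gamma> > 0" using R_nz gR by auto
  have bR: "\<beta> \<in> R" using less Rp_R by auto
  have sR: "rrefl \<gamma> \<beta> \<in> R" using rrefl_R gR bR by blast
  \<comment> \<open>A negative root \<open>x - \<gamma>\<close> would decompose \<gamma> into the
    positive roots \<open>x\<close> and \<open>\<gamma> - x\<close>.\<close>
  have nodec: "x \<in> Rp \<Longrightarrow> x - \<gamma> \<in> R \<Longrightarrow> x - \<gamma> \<in> Rp" for x
    using R_cases[of "x - \<gamma>"] g by (force simp: simple_def)
  show ?case
  proof (cases "\<beta> \<bullet> \<gamma> > 0")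
    case False
    then have "\<beta> \<bullet> coroot \<gamma> \<le> 0" using gnn by (simp add: coroot_def divide_le_0_iff mult_le_0_iff)
    then have "rrefl \<gamma> \<beta> \<bullet> v \<ge> \<beta> \<bullet> v" using gv by (simp add: rrefl_def inner_diff mult_le_0_iff)
    then show ?thesis using sR Rp_pos[OF less(1)] by (simp add: Rp_def)
  next
    case True
    have d: "\<beta> - \<gamma> \<in> Rp" using nodec[OF less(1)] diff_root[OF bR gR(1) True] less.prems by blast
    have np: "\<beta> - \<gamma> \<noteq> t *\<^sub>R \<gamma>" for t
    proof
      assume "\<beta> - \<gamma> = t *\<^sub>R \<gamma>"
      then have "\<beta> = (t + 1) *\<^sub>R \<gamma>" by (simp add: algebra_simps)
      then show False using less.prems by blast
    qed
    have "rrefl \<gamma> (\<beta> - \<gamma>) \<in> Rp" using less.IH[OF d] np gv by (simp add: inner_diff)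
    moreover have "rrefl \<gamma> (\<beta> - \<gamma>) - \<gamma> = rrefl \<gamma> \<beta>"
      using linear_diff[OF linear_rrefl[of \<gamma>], of \<beta> \<gamma>] rrefl_self[of \<gamma>] R_nz[OF gR(1)]
      by (simp add: inner_diff algebra_simps)
    ultimately show ?thesis using nodec sR by metis
  qed
qed

text \<open>Positive roots are sums of simple ones, so nonpositive pairings with all simple roots
  would give a nonpositive pairing of \<alpha> with itself.\<close>

lemma exists_simple_pos:
  assumes "\<alpha> \<in> Rp" shows "\<exists>\<gamma>. simple \<gamma> \<and> \<alpha> \<bullet> \<gamma> > 0"
proof (rule ccontr)
  assume "\<not> ?thesis"
  then have c: "\<And>\<gamma>. simple \<gamma> \<Longrightarrow> \<alpha> \<bullet> \<gamma> \<le> 0" by force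
  have "\<alpha> \<bullet> \<beta> \<le> 0" if "\<beta> \<in> Rp" for \<beta>
    using that
  proof (induction rule: pos_induct)
    case (less \<beta>)
    show ?case
    proof (cases "simple \<beta>")
      case False
      then obtain b1 b2 where b: "b1 \<in> Rp" "b2 \<in> Rp" "\<beta> = b1 + b2" using less(1) by (auto simp: simple_def)
      then show ?thesis using less.IH[of b1] less.IH[of b2] Rp_pos by (fastforce simp: inner_add)
    qed (use c in simp)
  qed
  from this[OF assms] show False using R_nz[OF Rp_R[OF assms]] by (simp add: inner_gt_zero_iff[symmetric] not_le del: inner_gt_zero_iff)
qed

text \<open>Reflecting in a simple root that pairs positively lowers the height and keeps the root
  positive, until a multiple of a simple root is left. Read upwards, the step has
  \<open>\<beta> \<bullet> coroot \<gamma> < 0\<close>; later this sign makes the coefficients in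
  coroot expansions nonnegative.\<close>

lemma simple_induct [consumes 1, case_names simple twice step]:
  assumes "\<alpha> \<in> Rp"
    and s: "\<And>\<gamma>. simple \<gamma> \<Longrightarrow> Q \<gamma>"
    and t: "\<And>\<gamma>. simple \<gamma> \<Longrightarrow> 2 *\<^sub>R \<gamma> \<in> Rp \<Longrightarrow> Q (2 *\<^sub>R \<gamma>)"
    and st: "\<And>\<beta> \<gamma>. simple \<gamma> \<Longrightarrow> \<beta> \<in> Rp \<Longrightarrow> Q \<beta> \<Longrightarrow> \<beta> \<bullet> coroot \<gamma> < 0 \<Longrightarrow> rrefl \<gamma> \<beta> \<in> Rp \<Longrightarrow> Q (rrefl \<gamma> \<beta>)"
  shows "Q \<alpha>"
  using assms(1)
proof (induction rule: pos_induct)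
  case (less \<alpha>)
  obtain \<gamma> where g: "simple \<gamma>" "\<alpha> \<bullet> \<gamma> > 0" using exists_simple_pos[OF less(1)] by blast
  show ?case
  proof (cases "\<exists>t. \<alpha> = t *\<^sub>R \<gamma>")
    case True
    then show ?thesis using simple_proportional[OF g(1)] less(1) s[OF g(1)] t[OF g(1)] by (metis scaleR_one)
  next
    case False
    define \<beta> where "\<beta> = rrefl \<gamma> \<alpha>"
    have b: "\<beta> \<in> Rp" unfolding \<beta>_def using simple_rrefl_pos[OF g(1) less(1)] False by blast
    have gnn: "\<gamma> \<bullet> \<gamma> > 0" using R_nz[OF simple_R[OF g(1)]] by simp
    have pos: "\<alpha> \<bullet> coroot \<gamma> > 0" using g(2) gnn by (simp add: coroot_def)
    have lt: "\<beta> \<bullet> v < \<alpha> \<bullet> v" using pos Rp_pos[OF simple_Rp[OF g(1)]] by (simp add: \<beta>_def rrefl_def inner_diff)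
    have "\<beta> \<bullet> coroot \<gamma> = - (\<alpha> \<bullet> coroot \<gamma>)"
      using coroot_inner_self[of \<gamma>] gnn by (simp add: \<beta>_def rrefl_def inner_diff)
    then have "Q (rrefl \<gamma> \<beta>)" using st[OF g(1) b less.IH[OF b lt]] pos less(1) by (simp add: \<beta>_def)
    then show ?thesis by (simp add: \<beta>_def)
  qed
qed

section \<open>Words in simple reflections, the exchange condition, and Weyl orbits under
  dominance\<close>

inductive word :: "nat \<Rightarrow> (real^'n \<Rightarrow> real^'n) \<Rightarrow> bool" where
  word_id: "word 0 id"
| word_step: "word k w \<Longrightarrow> simple \<gamma> \<Longrightarrow> word (Suc k) (w \<circ> rrefl \<gamma>)"

lemma word_W: "word k w \<Longrightarrow> w \<in> W"
proof (induction rule: word.induct)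
  case word_id show ?case by (rule weyl_group.wg_id)
next
  case (word_step k w \<gamma>) then show ?case by (intro W_comp W_rrefl simple_R)
qed

lemma word_comp: "word k w \<Longrightarrow> word l u \<Longrightarrow> word (l + k) (u \<circ> w)"
  by (induction rule: word.induct) (auto simp flip: comp_assoc intro: word.intros)

lemma word_simple: "simple \<gamma> \<Longrightarrow> word 1 (rrefl \<gamma>)"
  using word_step[OF word_id] by fastforce

lemma rrefl_word: "\<alpha> \<in> Rp \<Longrightarrow> \<exists>k. word k (rrefl \<alpha>)"
proof (induction rule: simple_induct)
  case (simple \<gamma>) then show ?case using word_simple by blast
next
  case (twice \<gamma>) then show ?case using word_simple by (auto simp: rrefl_scaleR)
next
  case (step \<beta> \<gamma>)
  then obtain k where k: "word k (rrefl \<beta>)" by blast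
  have "rrefl (rrefl \<gamma> \<beta>) = rrefl \<gamma> \<circ> rrefl \<beta> \<circ> rrefl \<gamma>"
    using rrefl_orthogonal[OF orthogonal_rrefl[of \<gamma>], of \<beta> "rrefl \<gamma> x" for x] by (auto simp: fun_eq_iff)
  then show ?case using word_comp[OF word_simple[OF step(1)] word_comp[OF k word_simple[OF step(1)]]]
    by (metis comp_assoc)
qed

lemma W_word: "w \<in> W \<Longrightarrow> \<exists>k. word k w"
proof (induction rule: weyl_group.induct)
  case wg_id then show ?case using word_id by blast
next
  case (wg_step w \<alpha>)
  have "\<exists>k. word k (rrefl \<alpha>)" using R_cases[OF wg_step(2)] rrefl_word[of \<alpha>] rrefl_word[of "- \<alpha>"] by auto
  then show ?case using wg_step.IH word_comp by blast
qed

lemma W_simple_induct [consumes 1, case_names id step]: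
  assumes "w \<in> W" "Q id" "\<And>w \<gamma>. w \<in> W \<Longrightarrow> simple \<gamma> \<Longrightarrow> Q w \<Longrightarrow> Q (w \<circ> rrefl \<gamma>)"
  shows "Q w"
proof -
  have "word k u \<Longrightarrow> Q u" for k u
  proof (induction rule: word.induct)
    case word_id show ?case by (rule assms)
  next
    case (word_step k w \<gamma>) then show ?case by (intro assms(3) word_W)
  qed
  then show ?thesis using W_word[OF assms(1)] by blast
qed

text \<open>Words grow on the right, whereas the exchange argument peels letters off on the left.
  The index counts the letters of some expression, not necessarily a reduced one.\<close>

lemma word_left: "word (Suc k) w \<Longrightarrow> \<exists>\<beta> u. simple \<beta> \<and> word k u \<and> w = rrefl \<beta> \<circ> u"
proof (induction k arbitrary: w)
  case 0
  then show ?case by (auto elim!: word.cases intro!: exI[of _ id] word.intros)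
next
  case (Suc k)
  then obtain w' \<gamma> where w: "word (Suc k) w'" "simple \<gamma>" "w = w' \<circ> rrefl \<gamma>" by (auto elim: word.cases)
  obtain \<beta> u where "simple \<beta>" "word k u" "w' = rrefl \<beta> \<circ> u" using Suc.IH[OF w(1)] by blast
  then show ?case using w word_step[of k u \<gamma>] by (metis comp_assoc)
qed

text \<open>The exchange condition. If the rest \<open>u\<close> of the word keeps \<gamma> positive
  and the leftmost simple reflection makes it negative, then \<open>u \<gamma>\<close> is a multiple
  of that simple root. So \<open>u\<close> conjugates one reflection into the other, and the
  leftmost letter cancels.\<close>

lemma word_exchange:
  assumes "word k w" "simple \<gamma>" "w \<gamma> \<notin> Rp"
  shows "k > 0 \<and> word (k - 1) (w \<circ> rrefl \<gamma>)"
  using assms(1,3)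
proof (induction k arbitrary: w)
  case 0
  then have "w = id" by (auto elim: word.cases)
  then show ?case using 0 assms(2) simple_Rp by auto
next
  case (Suc k)
  obtain \<beta> u where u: "simple \<beta>" "word k u" "w = rrefl \<beta> \<circ> u" using word_left[OF Suc.prems(1)] by blast
  have uW: "u \<in> W" using u word_W by blast
  show ?case
  proof (cases "u \<gamma> \<in> Rp")
    case False
    then have "k > 0" "word (k - 1) (u \<circ> rrefl \<gamma>)" using Suc.IH[OF u(2)] by blast+
    then have "word (1 + (k - 1)) (rrefl \<beta> \<circ> (u \<circ> rrefl \<gamma>))" by (intro word_comp word_simple u)
    moreover have "1 + (k - 1) = Suc k - 1" using \<open>k > 0\<close> by simp
    ultimately have "word (Suc k - 1) (w \<circ> rrefl \<gamma>)" unfolding u(3) by (metis comp_assoc)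
    then show ?thesis by blast
  next
    case True
    then have "\<exists>t. u \<gamma> = t *\<^sub>R \<beta>" using simple_rrefl_pos[OF u(1) True] Suc.prems(2) u(3) by auto
    then obtain t where t: "u \<gamma> = t *\<^sub>R \<beta>" by blast
    have "t \<noteq> 0" using t R_nz[OF Rp_R[OF True]] by auto
    have "w (rrefl \<gamma> x) = u x" for x
    proof -
      have "u (rrefl \<gamma> x) = rrefl (u \<gamma>) (u x)" using rrefl_orthogonal[OF W_orthogonal[OF uW]] by simp
      also have "\<dots> = rrefl \<beta> (u x)" using t \<open>t \<noteq> 0\<close> by (simp add: rrefl_scaleR)
      finally show ?thesis by (simp add: u(3))
    qed
    then have "w \<circ> rrefl \<gamma> = u" by auto
    then show ?thesis using u(2) by simp
  qed
qed

definition regular_dominant :: "real^'n \<Rightarrow> bool" where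
  "regular_dominant \<mu> \<longleftrightarrow> (\<forall>\<alpha>\<in>Rp. \<mu> \<bullet> coroot \<alpha> > 0)"

definition weight :: "real^'n \<Rightarrow> bool" where
  "weight \<mu> \<longleftrightarrow> (\<forall>\<alpha>\<in>R. \<mu> \<bullet> coroot \<alpha> \<in> \<int>)"

text \<open>Induction on the number of letters. If \<open>u\<close> keeps the last simple root
  \<gamma> positive, the letter subtracts a nonnegative multiple of the positive root
  \<open>u \<gamma>\<close>; otherwise exchange gives a shorter word for the same element. For
  regular \<mu> the multiple is positive, which makes the stabilizer trivial.\<close>

lemma word_dominance:
  assumes "word k w" and d: "\<And>\<gamma>. simple \<gamma> \<Longrightarrow> \<mu> \<bullet> coroot \<gamma> \<in> \<nat>"
  shows "\<mu> - w \<mu> \<in> poscone Rp \<and> (regular_dominant \<mu> \<and> w \<mu> = \<mu> \<longrightarrow> w = id)"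
  using assms(1)
proof (induction k arbitrary: w rule: less_induct)
  case (less k)
  show ?case using less.prems
  proof (cases rule: word.cases)
    case (word_step l u \<gamma>)
    have uW: "u \<in> W" using word_step word_W by blast
    show ?thesis
    proof (cases "u \<gamma> \<in> Rp")
      case False
      then have "word (l - 1) w" using word_exchange[of l u \<gamma>] word_step by blast
      then show ?thesis using less.IH[of "l - 1"] word_step(1) by auto
    next
      case True
      have "w \<mu> = u \<mu> - (\<mu> \<bullet> coroot \<gamma>) *\<^sub>R u \<gamma>"
        using W_linear[OF uW] by (simp add: word_step rrefl_def linear_diff linear_cmul)
      then have eq: "\<mu> - w \<mu> = (\<mu> - u \<mu>) + (\<mu> \<bullet> coroot \<gamma>) *\<^sub>R u \<gamma>" by simp
      have u: "\<mu> - u \<mu> \<in> poscone Rp" using less.IH[of l u] word_step by auto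
      have p: "(\<mu> \<bullet> coroot \<gamma>) *\<^sub>R u \<gamma> \<in> poscone Rp"
        by (intro poscone_Nats poscone_base True d word_step(4)) simp
      have "w \<mu> \<noteq> \<mu>" if r: "regular_dominant \<mu>"
      proof
        assume "w \<mu> = \<mu>"
        then have "(\<mu> - u \<mu>) \<bullet> v + (\<mu> \<bullet> coroot \<gamma>) * (u \<gamma> \<bullet> v) = 0" using eq
          by (metis cancel_comm_monoid_add_class.diff_cancel inner_add_left inner_scaleR_left inner_zero_left)
        moreover have "(\<mu> \<bullet> coroot \<gamma>) * (u \<gamma> \<bullet> v) > 0"
          using r simple_Rp[OF word_step(4)] Rp_pos[OF True] by (simp add: regular_dominant_def)
        ultimately show False using poscone_nonneg[OF u] by linarith
      qed
      then show ?thesis using poscone_add[OF u p] unfolding eq by blast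
    qed
  qed auto
qed

lemma dominance_W:
  assumes "w \<in> W" "\<And>\<gamma>. simple \<gamma> \<Longrightarrow> \<mu> \<bullet> coroot \<gamma> \<in> \<nat>"
  shows "\<mu> - w \<mu> \<in> poscone Rp"
  using word_dominance W_word[OF assms(1)] assms(2) by blast

lemma regular_stabilizer:
  assumes "w \<in> W" "\<And>\<gamma>. simple \<gamma> \<Longrightarrow> \<mu> \<bullet> coroot \<gamma> \<in> \<nat>" "regular_dominant \<mu>" "w \<mu> = \<mu>"
  shows "w = id"
  using word_dominance W_word[OF assms(1)] assms(2-) by blast

section \<open>The vector \<rho> and dominant weights, with two roots on a ray allowed\<close>

definition srep :: "real^'n \<Rightarrow> real^'n" where
  "srep \<gamma> = (if 2 *\<^sub>R \<gamma> \<in> R then 2 *\<^sub>R \<gamma> else \<gamma>)"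

lemma srep_multiple: "\<exists>t. (t = 1 \<or> t = 2) \<and> srep \<gamma> = t *\<^sub>R \<gamma>"
proof (cases "2 *\<^sub>R \<gamma> \<in> R")
  case True then show ?thesis by (intro exI[of _ 2]) (simp add: srep_def)
next
  case False then show ?thesis by (intro exI[of _ 1]) (simp add: srep_def)
qed

lemma srep_roots0:
  assumes "simple \<gamma>" shows "srep \<gamma> \<in> roots0 R \<inter> Rp"
proof -
  have g: "\<gamma> \<in> R" "\<gamma> \<bullet> v > 0" using simple_R simple_Rp Rp_pos assms by blast+
  have "4 *\<^sub>R \<gamma> \<notin> R" using proportional_cases[OF g(1), of 4] by auto
  then show ?thesis using g by (auto simp: srep_def roots0_def Rp_def)
qed

lemma roots0_proportional:
  assumes "simple \<gamma>" "t *\<^sub>R \<gamma> \<in> roots0 R \<inter> Rp" shows "t *\<^sub>R \<gamma> = srep \<gamma>"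
  using simple_proportional[OF assms(1), of t] assms by (auto simp: srep_def roots0_def Rp_R)

lemma roots1_proportional:
  assumes "simple \<gamma>" "t *\<^sub>R \<gamma> \<in> roots1 R \<inter> Rp" shows "t *\<^sub>R \<gamma> = \<gamma>"
  using simple_proportional[OF assms(1), of t] assms simple_R by (auto simp: roots1_def)

lemma simple_roots1:
  assumes "simple \<gamma>" shows "\<gamma> \<in> roots1 R \<inter> Rp"
proof -
  have g: "\<gamma> \<in> Rp" using simple_Rp assms by blast
  have "(1/2) *\<^sub>R \<gamma> \<notin> Rp" using simple_proportional[OF assms, of "1/2"] by auto
  then have "(1/2) *\<^sub>R \<gamma> \<notin> R" using Rp_pos[OF g] by (simp add: Rp_def)
  then show ?thesis using g by (auto simp: roots1_def Rp_R)
qed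

lemma W_roots0: "w \<in> W \<Longrightarrow> \<alpha> \<in> roots0 R \<Longrightarrow> w \<alpha> \<in> roots0 R"
  using W_R[of w] W_R[OF W_inv, of w "2 *\<^sub>R w \<alpha>"] linear_cmul[OF W_linear[OF W_inv, of w], of 2 "w \<alpha>"]
  by (auto simp: roots0_def)

lemma W_roots1: "w \<in> W \<Longrightarrow> \<alpha> \<in> roots1 R \<Longrightarrow> w \<alpha> \<in> roots1 R"
  using W_R[of w] W_R[OF W_inv, of w "(1/2) *\<^sub>R w \<alpha>"] linear_cmul[OF W_linear[OF W_inv, of w], of "1/2" "w \<alpha>"]
  by (auto simp: roots1_def)

lemma roots_finite [simp]: "finite (roots0 R)" "finite (roots1 R)"
  by (simp_all add: roots0_def roots1_def)

text \<open>A simple reflection keeps positive every positive root off its line, and within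
  \<open>X\<close> that line meets \<open>Rp\<close> at most in \<open>g'\<close>. The general
  \<open>X\<close> covers \<open>roots0\<close> with \<open>g' = srep \<gamma>\<close> and
  \<open>roots1\<close> with \<open>g' = \<gamma>\<close>.\<close>

lemma simple_permutes:
  assumes g: "simple \<gamma>" and X: "\<And>\<alpha>. \<alpha> \<in> X \<Longrightarrow> rrefl \<gamma> \<alpha> \<in> X"
    and g': "g' \<noteq> 0" "g' = r *\<^sub>R \<gamma>" "\<And>t. t *\<^sub>R \<gamma> \<in> X \<inter> Rp \<Longrightarrow> t *\<^sub>R \<gamma> = g'"
  shows "bij_betw (rrefl \<gamma>) (X \<inter> Rp - {g'}) (X \<inter> Rp - {g'})"
proof -
  have cl: "rrefl \<gamma> \<alpha> \<in> X \<inter> Rp - {g'}" if a: "\<alpha> \<in> X \<inter> Rp - {g'}" for \<alpha>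
  proof -
    have "rrefl \<gamma> \<alpha> \<in> Rp" by (rule simple_rrefl_pos[OF g]) (use a g' in auto)
    moreover have "rrefl \<gamma> \<alpha> \<noteq> g'"
    proof
      assume e: "rrefl \<gamma> \<alpha> = g'"
      then have "\<alpha> = rrefl \<gamma> g'" by (metis rrefl_rrefl)
      also have "\<dots> = - g'" using g'(2) rrefl_self[OF R_nz[OF simple_R[OF g]]]
        by (simp add: linear_cmul[OF linear_rrefl])
      finally have "\<alpha> = - g'" .
      then show False using a \<open>rrefl \<gamma> \<alpha> \<in> Rp\<close> e Rp_not_minus by auto
    qed
    ultimately show ?thesis using X a by auto
  qed
  show ?thesis
    by (rule bij_betwI[of _ _ _ "rrefl \<gamma>"]) (use cl in \<open>auto\<close>)
qed

lemma simple_permutes_roots0: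
  assumes "simple \<gamma>" shows "bij_betw (rrefl \<gamma>) (roots0 R \<inter> Rp - {srep \<gamma>}) (roots0 R \<inter> Rp - {srep \<gamma>})"
proof (rule simple_permutes[OF assms])
  show "srep \<gamma> = (if 2 *\<^sub>R \<gamma> \<in> R then 2 else 1) *\<^sub>R \<gamma>" by (simp add: srep_def)
  show "srep \<gamma> \<noteq> 0" using srep_roots0[OF assms] by (auto simp: Rp_R R_nz)
qed (use W_roots0 W_rrefl simple_R roots0_proportional assms in auto)

lemma simple_permutes_roots1:
  assumes "simple \<gamma>" shows "bij_betw (rrefl \<gamma>) (roots1 R \<inter> Rp - {\<gamma>}) (roots1 R \<inter> Rp - {\<gamma>})"
proof (rule simple_permutes[OF assms, where r = 1])
  show "\<gamma> \<noteq> 0" using simple_R[OF assms] by (auto simp: R_nz)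
qed (use W_roots1 W_rrefl simple_R roots1_proportional assms in auto)

text \<open>The reflection permutes the other summands of \<rho> and reverses the sign of their
  pairings, so they cancel and \<open>srep \<gamma>\<close> alone contributes. The coroot has to be
  that of the member of \<open>roots0\<close> on the ray: if \<open>2 *\<^sub>R \<gamma>\<close> is
  a root, \<open>coroot \<gamma>\<close> itself pairs to 2 with \<rho>.\<close>

lemma rho_simple:
  assumes "simple \<gamma>" shows "rho R Rp \<bullet> coroot (srep \<gamma>) = 1"
proof -
  let ?X = "roots0 R \<inter> Rp"
  have s: "srep \<gamma> \<in> ?X" using srep_roots0[OF assms] .
  obtain t where t: "t = 1 \<or> t = 2" "srep \<gamma> = t *\<^sub>R \<gamma>" using srep_multiple by blast
  have nz: "srep \<gamma> \<noteq> 0" "\<gamma> \<noteq> 0" using s R_nz simple_R[OF assms] by (auto simp: Rp_R)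
  have "(\<Sum>\<alpha>\<in>?X - {srep \<gamma>}. \<alpha> \<bullet> coroot (srep \<gamma>)) = (\<Sum>\<alpha>\<in>?X - {srep \<gamma>}. rrefl \<gamma> \<alpha> \<bullet> coroot (srep \<gamma>))"
    by (rule sum.reindex_bij_betw[OF simple_permutes_roots0[OF assms], symmetric])
  also have "\<dots> = (\<Sum>\<alpha>\<in>?X - {srep \<gamma>}. - (\<alpha> \<bullet> coroot (srep \<gamma>)))"
  proof (rule sum.cong)
    fix \<alpha>
    have "rrefl \<gamma> \<alpha> = rrefl (srep \<gamma>) \<alpha>" using t by (auto simp: rrefl_scaleR)
    then show "rrefl \<gamma> \<alpha> \<bullet> coroot (srep \<gamma>) = - (\<alpha> \<bullet> coroot (srep \<gamma>))"
      using coroot_inner_self[OF nz(1)] by (simp add: rrefl_def inner_diff)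
  qed simp
  finally have z: "(\<Sum>\<alpha>\<in>?X - {srep \<gamma>}. \<alpha> \<bullet> coroot (srep \<gamma>)) = 0" by (simp add: sum_negf)
  have "(\<Sum>\<alpha>\<in>?X. \<alpha> \<bullet> coroot (srep \<gamma>)) = 2"
    by (subst sum.remove[of _ "srep \<gamma>"]) (use s z nz coroot_inner_self in auto)
  then show ?thesis by (simp add: rho_def inner_sum_left)
qed

lemma coroot_srep_multiple:
  "\<exists>t. (t = 1 \<or> t = 2) \<and> coroot \<gamma> = t *\<^sub>R coroot (srep \<gamma>)"
proof (cases "2 *\<^sub>R \<gamma> \<in> R")
  case True then show ?thesis by (intro exI[of _ 2]) (simp add: srep_def coroot_scaleR)
next
  case False then show ?thesis by (intro exI[of _ 1]) (simp add: srep_def)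
qed

lemma inner_coroot_neg_iff: "x \<bullet> coroot a < 0 \<longleftrightarrow> x \<bullet> a < 0"
proof (cases "a = 0")
  case False
  then have "2 / (a \<bullet> a) > 0" by simp
  then show ?thesis by (simp only: coroot_def inner_scaleR_right mult_less_0_iff) (metis less_asym)
qed (simp add: coroot_def)

lemma inner_coroot_neg_swap: "x \<bullet> coroot a < 0 \<Longrightarrow> a \<bullet> coroot x < 0"
  by (simp add: inner_coroot_neg_iff inner_commute)

text \<open>Every positive coroot is a combination of the coroots of the
  \<open>srep \<gamma>\<close> with natural coefficients: in the ascent, reflecting \<beta> in
  \<gamma> adds \<open>- (\<gamma> \<bullet> coroot \<beta>)\<close> copies of
  \<open>coroot \<gamma>\<close>, a natural number because \<beta> and \<gamma> pair
  negatively.\<close>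

lemma Nats_dominant_from_simple:
  assumes "\<And>\<gamma>. simple \<gamma> \<Longrightarrow> \<mu> \<bullet> coroot (srep \<gamma>) \<in> \<nat>" "\<alpha> \<in> Rp"
  shows "\<mu> \<bullet> coroot \<alpha> \<in> \<nat>"
proof -
  have s: "\<mu> \<bullet> coroot \<gamma> \<in> \<nat>" if "simple \<gamma>" for \<gamma>
    using coroot_srep_multiple[of \<gamma>] assms(1)[OF that] by auto
  show ?thesis using assms(2)
  proof (induction rule: simple_induct)
    case (simple \<gamma>) then show ?case by (rule s)
  next
    case (twice \<gamma>) then show ?case using assms(1)[of \<gamma>] by (simp add: srep_def Rp_R)
  next
    case (step \<beta> \<gamma>)
    have "\<gamma> \<bullet> coroot \<beta> \<in> \<int>" using integral_R step Rp_R simple_R by blast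
    moreover have "\<gamma> \<bullet> coroot \<beta> \<le> 0" using inner_coroot_neg_swap[OF step.hyps(3)] by simp
    ultimately have n: "- (\<gamma> \<bullet> coroot \<beta>) \<in> \<nat>" by (simp add: Nats_altdef2)
    have "coroot (rrefl \<gamma> \<beta>) = rrefl \<gamma> (coroot \<beta>)" using coroot_orthogonal[OF orthogonal_rrefl] .
    also have "\<dots> = coroot \<beta> - (\<gamma> \<bullet> coroot \<beta>) *\<^sub>R coroot \<gamma>"
      by (simp add: rrefl_def coroot_def inner_commute)
    finally have "\<mu> \<bullet> coroot (rrefl \<gamma> \<beta>) = \<mu> \<bullet> coroot \<beta> + (- (\<gamma> \<bullet> coroot \<beta>)) * (\<mu> \<bullet> coroot \<gamma>)"
      by (simp add: inner_diff)
    then show ?case using step.IH n s[OF step.hyps(1)] by (simp only: Nats_add Nats_mult)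
  qed
qed

lemma rho_Nats: "\<alpha> \<in> Rp \<Longrightarrow> rho R Rp \<bullet> coroot \<alpha> \<in> \<nat>"
  using Nats_dominant_from_simple[of "rho R Rp" \<alpha>] rho_simple by auto

lemma rho_pos: "\<alpha> \<in> Rp \<Longrightarrow> rho R Rp \<bullet> coroot \<alpha> > 0"
proof (induction rule: simple_induct)
  case (simple \<gamma>) then show ?case using coroot_srep_multiple[of \<gamma>] rho_simple[of \<gamma>] by auto
next
  case (twice \<gamma>) then show ?case using rho_simple[of \<gamma>] by (simp add: srep_def Rp_R)
next
  case (step \<beta> \<gamma>)
  have n: "\<gamma> \<bullet> coroot \<beta> \<le> 0" using inner_coroot_neg_swap[OF step.hyps(3)] by simp
  have "coroot (rrefl \<gamma> \<beta>) = rrefl \<gamma> (coroot \<beta>)" using coroot_orthogonal[OF orthogonal_rrefl] .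
  also have "\<dots> = coroot \<beta> - (\<gamma> \<bullet> coroot \<beta>) *\<^sub>R coroot \<gamma>"
    by (simp add: rrefl_def coroot_def inner_commute)
  finally have "rho R Rp \<bullet> coroot (rrefl \<gamma> \<beta>) = rho R Rp \<bullet> coroot \<beta> - (\<gamma> \<bullet> coroot \<beta>) * (rho R Rp \<bullet> coroot \<gamma>)"
    by (simp add: inner_diff)
  moreover have "(\<gamma> \<bullet> coroot \<beta>) * (rho R Rp \<bullet> coroot \<gamma>) \<le> 0"
    using n rho_Nats[OF simple_Rp[OF step.hyps(1)]] by (simp add: mult_nonpos_nonneg Nats_altdef2)
  ultimately show ?case using step.IH by linarith
qed

lemma dominant_weights_D: "\<mu> \<in> dominant_weights Rp \<Longrightarrow> \<alpha> \<in> Rp \<Longrightarrow> \<mu> \<bullet> coroot \<alpha> \<in> \<nat>"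
  by (simp add: dominant_weights_def)

lemma dominant_weight: "\<mu> \<in> dominant_weights Rp \<Longrightarrow> weight \<mu>"
  unfolding weight_def using R_cases dominant_weights_D by (fastforce simp: Nats_altdef2 dest: Ints_minus)

lemma weight_dominant: "weight \<mu> \<Longrightarrow> (\<And>\<alpha>. \<alpha> \<in> Rp \<Longrightarrow> \<mu> \<bullet> coroot \<alpha> \<ge> 0) \<Longrightarrow> \<mu> \<in> dominant_weights Rp"
  by (simp add: weight_def dominant_weights_def Nats_altdef2 Rp_R)

lemma weight_add: "weight x \<Longrightarrow> weight y \<Longrightarrow> weight (x + y)"
  and weight_diff: "weight x \<Longrightarrow> weight y \<Longrightarrow> weight (x - y)"
  by (simp_all add: weight_def inner_add inner_diff)

lemma weight_poscone: "x \<in> poscone Rp \<Longrightarrow> weight x"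
  unfolding poscone_def weight_def
  by (auto simp: inner_sum_left intro!: Ints_sum Ints_mult) (metis integral_R Rp_R)

lemma weight_rho: "weight (rho R Rp)"
  by (rule dominant_weight) (simp add: dominant_weights_def rho_Nats)

lemma dominant_add_rho:
  assumes "\<mu> \<in> dominant_weights Rp"
  shows "rho R Rp + \<mu> \<in> dominant_weights Rp" "regular_dominant (rho R Rp + \<mu>)"
  using dominant_weights_D[OF assms] rho_Nats rho_pos
  by (auto simp: dominant_weights_def regular_dominant_def inner_add Nats_altdef2 add_pos_nonneg)

text \<open>On the coroots of the \<open>srep \<gamma>\<close> the pairings of \<theta> are positive
  integers, hence at least 1, and \<rho> takes away exactly 1; the other positive coroots follow
  from these.\<close>

lemma regular_dominant_diff_rho:
  assumes "weight \<theta>" "regular_dominant \<theta>" shows "\<theta> - rho R Rp \<in> dominant_weights Rp"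
proof -
  have "(\<theta> - rho R Rp) \<bullet> coroot (srep \<gamma>) \<in> \<nat>" if g: "simple \<gamma>" for \<gamma>
  proof -
    have "srep \<gamma> \<in> Rp" "srep \<gamma> \<in> R" using srep_roots0[OF g] Rp_R by auto
    then have "\<theta> \<bullet> coroot (srep \<gamma>) \<in> \<int>" "\<theta> \<bullet> coroot (srep \<gamma>) > 0"
      using assms by (auto simp: weight_def regular_dominant_def)
    then show ?thesis using rho_simple[OF g] by (auto elim!: Ints_cases simp: inner_diff Nats_altdef2)
  qed
  then show ?thesis using Nats_dominant_from_simple by (auto simp: dominant_weights_def)
qed

text \<open>An orbit point of maximal height is dominant, since reflecting in a positive root with
  negative pairing would raise it.\<close>

lemma exists_dominant: "\<exists>w\<in>W. \<forall>\<alpha>\<in>Rp. w \<theta> \<bullet> coroot \<alpha> \<ge> 0"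
proof -
  obtain w where w: "w \<in> W" "\<And>u. u \<in> W \<Longrightarrow> u \<theta> \<bullet> v \<le> w \<theta> \<bullet> v"
    using arg_min_if_finite[OF finite_W W_nonempty(1), of "\<lambda>w. - (w \<theta> \<bullet> v)"]
    by (metis neg_le_iff_le not_less)
  have "w \<theta> \<bullet> coroot \<alpha> \<ge> 0" if a: "\<alpha> \<in> Rp" for \<alpha>
  proof -
    have "(rrefl \<alpha> \<circ> w) \<theta> \<bullet> v \<le> w \<theta> \<bullet> v" using w a Rp_R weyl_group.wg_step by blast
    then have "(w \<theta> \<bullet> coroot \<alpha>) * (\<alpha> \<bullet> v) \<ge> 0" by (simp add: rrefl_def inner_diff)
    then show ?thesis using Rp_pos[OF a] by (simp add: zero_le_mult_iff)
  qed
  then show ?thesis using w by blast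
qed

end

section \<open>Fourier coefficients on the alcove\<close>

text \<open>The change-of-variables theorems of the library want a well-ordered index type, so invariance
  of Lebesgue measure under orthogonal maps is obtained from translation invariance and Fubini,
  comparing with the unit ball.\<close>

lemma nn_integral_lborel_translate:
  fixes c :: "'a::euclidean_space"
  assumes [measurable]: "f \<in> borel_measurable borel"
  shows "(\<integral>\<^sup>+x. f (x + c) \<partial>lborel) = (\<integral>\<^sup>+x. f x \<partial>lborel)"
proof -
  have "(\<integral>\<^sup>+x. f x \<partial>lborel) = (\<integral>\<^sup>+x. f x \<partial>distr lborel borel ((+) c))"
    by (simp only: lborel_distr_plus)
  also have "\<dots> = (\<integral>\<^sup>+x. f (c + x) \<partial>lborel)"
    by (subst nn_integral_distr) simp_all
  finally show ?thesis by (simp add: add.commute)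
qed

lemma lborel_distr_orthogonal:
  fixes f :: "'a::euclidean_space \<Rightarrow> 'a"
  assumes f: "orthogonal_transformation f"
  shows "distr lborel borel f = lborel"
proof (rule measure_eqI)
  have lin: "linear f" using f orthogonal_transformation_linear by blast
  have fm [measurable]: "f \<in> borel_measurable borel"
    using linear_continuous_on lin linear_conv_bounded_linear borel_measurable_continuous_onI by blast
  have fi: "f (inv f x) = x" for x
    using orthogonal_transformation_surj[OF f] by (simp add: surj_f_inv_f)
  define B where "B = ball (0::'a) 1"
  have B [measurable]: "B \<in> sets borel" by (simp add: B_def)
  have Bpos: "emeasure lborel B \<noteq> 0" "emeasure lborel B \<noteq> top"
    using emeasure_bounded_finite[of B, unfolded B_def] less_imp_neq[OF unit_ball_vol_pos[of "real DIM('a)"], symmetric]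
    by (simp_all add: B_def emeasure_ball less_top)
  fix A assume "A \<in> sets (distr lborel borel f)"
  then have A [measurable]: "A \<in> sets borel" by simp
  \<comment> \<open>The product of the two measures is a double integral. Shifting \<open>y\<close>
    by \<open>inv f x\<close> brings \<open>x\<close> into the argument of \<open>A\<close>,
    shifting \<open>x\<close> by \<open>f y\<close> then moves it to \<open>B\<close>, and for fixed
    \<open>x\<close> the admissible \<open>y\<close> fill the unit ball around
    \<open>inv f x\<close>.\<close>
  have "emeasure lborel B * emeasure (distr lborel borel f) A
      = (\<integral>\<^sup>+x. indicator B x * (\<integral>\<^sup>+y. indicator A (f y) \<partial>lborel) \<partial>lborel)"
    using nn_integral_distr[of f lborel borel "indicator A"] by (subst nn_integral_multc) (auto intro: borel_measurable_indicator)
  also have "\<dots> = (\<integral>\<^sup>+x. indicator B x * (\<integral>\<^sup>+y. indicator A (f y + x) \<partial>lborel) \<partial>lborel)"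
  proof (rule nn_integral_cong)
    fix x
    have "(\<integral>\<^sup>+y. indicator A (f y) \<partial>lborel) = (\<integral>\<^sup>+y. indicator A (f (y + inv f x)) \<partial>lborel)"
      by (rule nn_integral_lborel_translate[symmetric]) measurable
    then show "indicator B x * (\<integral>\<^sup>+y. indicator A (f y) \<partial>lborel)
        = indicator B x * (\<integral>\<^sup>+y. indicator A (f y + x) \<partial>lborel)"
      by (simp add: linear_add[OF lin] fi)
  qed
  also have "\<dots> = (\<integral>\<^sup>+x. (\<integral>\<^sup>+y. indicator B x * indicator A (f y + x) \<partial>lborel) \<partial>lborel)"
    by (rule nn_integral_cong, rule nn_integral_cmult[symmetric]) measurable
  also have "\<dots> = (\<integral>\<^sup>+y. (\<integral>\<^sup>+x. indicator B x * indicator A (f y + x) \<partial>lborel) \<partial>lborel)"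
    by (rule lborel_pair.Fubini') measurable
  also have "\<dots> = (\<integral>\<^sup>+y. (\<integral>\<^sup>+x. indicator B (x - f y) * indicator A x \<partial>lborel) \<partial>lborel)"
  proof (rule nn_integral_cong)
    fix y
    show "(\<integral>\<^sup>+x. indicator B x * indicator A (f y + x) \<partial>lborel)
        = (\<integral>\<^sup>+x. indicator B (x - f y) * indicator A x \<partial>lborel)"
      using nn_integral_lborel_translate[of "\<lambda>x. indicator B (x - f y) * indicator A x" "f y"]
      by (simp add: add.commute)
  qed
  also have "\<dots> = (\<integral>\<^sup>+x. (\<integral>\<^sup>+y. indicator B (x - f y) * indicator A x \<partial>lborel) \<partial>lborel)"
    by (rule lborel_pair.Fubini') measurable
  also have "\<dots> = (\<integral>\<^sup>+x. emeasure lborel B * indicator A x \<partial>lborel)"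
  proof (rule nn_integral_cong)
    fix x
    have "norm (x - f y) = dist (inv f x) y" for y
      using orthogonal_transformation_norm[OF f, of "inv f x - y"] by (simp add: linear_diff[OF lin] fi dist_norm)
    then have "(\<integral>\<^sup>+y. indicator B (x - f y) \<partial>lborel) = (\<integral>\<^sup>+y. indicator (ball (inv f x) 1) y \<partial>lborel)"
      by (intro nn_integral_cong) (simp add: B_def indicator_def)
    also have "\<dots> = emeasure lborel (ball (inv f x) 1)" by simp
    also have "\<dots> = emeasure lborel B" by (simp add: B_def emeasure_ball)
    finally show "(\<integral>\<^sup>+y. indicator B (x - f y) * indicator A x \<partial>lborel) = emeasure lborel B * indicator A x"
      by (subst nn_integral_multc) auto
  qed
  also have "\<dots> = emeasure lborel B * emeasure lborel A"
    by (subst nn_integral_cmult) auto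
  finally show "emeasure (distr lborel borel f) A = emeasure lborel A"
    using Bpos ennreal_mult_cancel_left by blast
qed simp

lemma integral_lborel_orthogonal:
  fixes f :: "'a::euclidean_space \<Rightarrow> 'a" and g :: "'a \<Rightarrow> 'b::{banach, second_countable_topology}"
  assumes f: "orthogonal_transformation f" and [measurable]: "g \<in> borel_measurable borel"
  shows "(\<integral>x. g (f x) \<partial>lborel) = (\<integral>x. g x \<partial>lborel)"
proof -
  have [measurable]: "f \<in> borel_measurable borel"
    using linear_continuous_on orthogonal_transformation_linear[OF f] linear_conv_bounded_linear borel_measurable_continuous_onI by blast
  have "(\<integral>x. g x \<partial>lborel) = (\<integral>x. g x \<partial>distr lborel borel f)"
    by (simp only: lborel_distr_orthogonal[OF f])
  also have "\<dots> = (\<integral>x. g (f x) \<partial>lborel)"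
    by (subst integral_distr) simp_all
  finally show ?thesis by simp
qed

lemma integral_lborel_translate:
  fixes c :: "'a::euclidean_space" and g :: "'a \<Rightarrow> 'b::{banach, second_countable_topology}"
  assumes [measurable]: "g \<in> borel_measurable borel"
  shows "(\<integral>x. g (x + c) \<partial>lborel) = (\<integral>x. g x \<partial>lborel)"
proof -
  have "(\<integral>x. g x \<partial>lborel) = (\<integral>x. g x \<partial>distr lborel borel ((+) c))"
    by (simp only: lborel_distr_plus)
  also have "\<dots> = (\<integral>x. g (c + x) \<partial>lborel)"
    by (subst integral_distr) simp_all
  finally show ?thesis by (simp add: add.commute)
qed

lemma integrable_lborel_bounded_support:
  fixes h :: "'a::euclidean_space \<Rightarrow> 'b::{banach, second_countable_topology}"
  assumes "h \<in> borel_measurable borel" "\<And>x. norm (h x) \<le> C" "\<And>x. norm x > r \<Longrightarrow> h x = 0"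
  shows "integrable lborel h"
proof (rule Bochner_Integration.integrable_bound)
  show "integrable lborel (\<lambda>x. indicator (cball (0::'a) r) x * C)"
    using borel_integrable_compact[of "cball 0 r" "\<lambda>_. C"] by simp
  have "norm (h x) \<le> norm (indicator (cball 0 r) x * C)" for x
    using assms(2)[of x] assms(3)[of x] by (auto simp: indicator_def)
  then show "AE x in lborel. norm (h x) \<le> norm (indicator (cball 0 r) x * C)" by simp
qed (use assms in simp)

text \<open>The exponent is an arbitrary vector because the factors of \<open>delta\<close> carry
  half roots, which need not be weights.\<close>

definition chr :: "real^'n \<Rightarrow> real^'n \<Rightarrow> complex" where
  "chr \<kappa> \<xi> = exp (\<i> * complex_of_real (\<kappa> \<bullet> \<xi>))"

lemma chr_0 [simp]: "chr 0 \<xi> = 1"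
  by (simp add: chr_def)

lemma chr_add: "chr (a + b) \<xi> = chr a \<xi> * chr b \<xi>"
  by (simp add: chr_def inner_add_left distrib_left exp_add)

lemma chr_add_right: "chr a (\<xi> + \<eta>) = chr a \<xi> * chr a \<eta>"
  by (simp add: chr_def inner_add_right distrib_left exp_add)

lemma norm_chr [simp]: "norm (chr a \<xi>) = 1"
  by (simp add: chr_def)

lemma cnj_chr: "cnj (chr a \<xi>) = chr (- a) \<xi>"
  by (simp add: chr_def exp_cnj)

lemma continuous_chr [continuous_intros]: "continuous_on S f \<Longrightarrow> continuous_on S (\<lambda>x. chr a (f x))"
  unfolding chr_def by (intro continuous_intros)

lemma chr_power: "chr a \<xi> ^ k = chr (real k *\<^sub>R a) \<xi>"
  by (induction k) (simp_all add: scaleR_left_distrib chr_add)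

section \<open>Geometry of the alcove and of the translation lattice\<close>

context root_system
begin

lemma chr_W: "w \<in> W \<Longrightarrow> chr a (w \<xi>) = chr (inv w a) \<xi>"
  by (simp add: chr_def W_inner_inv)

lemma W_continuous: "w \<in> W \<Longrightarrow> continuous_on S w"
  using W_linear linear_continuous_on linear_conv_bounded_linear by blast

lemma W_measurable: "w \<in> W \<Longrightarrow> w \<in> borel_measurable borel"
  using W_continuous borel_measurable_continuous_onI by blast

text \<open>The roots span, so each coordinate is a fixed combination of pairings with roots. For
  \<open>C = 0\<close> this says that these pairings separate points; for \<open>C = 2 * pi\<close>
  it bounds the alcove.\<close>

lemma norm_bound_roots: "\<exists>K>0. \<forall>\<xi> C. (\<forall>\<alpha>\<in>R. \<bar>\<xi> \<bullet> \<alpha>\<bar> \<le> C) \<longrightarrow> norm \<xi> \<le> K * C"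
proof -
  have "\<exists>u. (\<Sum>v\<in>R. u v *\<^sub>R v) = b" for b
  proof -
    have "b \<in> range (\<lambda>u. \<Sum>v\<in>R. u v *\<^sub>R v)" using span_R span_finite[OF finite_R] by blast
    then show ?thesis by (metis (no_types, lifting) imageE)
  qed
  then obtain u where u: "\<And>b. (\<Sum>v\<in>R. u b v *\<^sub>R v) = b" by metis
  define K where "K = 1 + (\<Sum>b\<in>Basis. \<Sum>v\<in>R. \<bar>u b v\<bar>)"
  have pos: "(\<Sum>b\<in>Basis. \<Sum>v\<in>R. \<bar>u b v\<bar>) \<ge> 0" by (intro sum_nonneg) auto
  have "norm \<xi> \<le> K * C" if C: "\<forall>\<alpha>\<in>R. \<bar>\<xi> \<bullet> \<alpha>\<bar> \<le> C" for \<xi> C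
  proof -
    obtain \<alpha> where "\<alpha> \<in> R" using span_R by (metis ex_in_conv span_empty UNIV_I singletonD zero_neq_one)
    then have C0: "C \<ge> 0" using C by (meson abs_ge_zero order_trans)
    have "norm \<xi> \<le> (\<Sum>b\<in>Basis. \<bar>\<xi> \<bullet> b\<bar>)" by (rule norm_le_l1)
    also have "\<dots> \<le> (\<Sum>b\<in>Basis. \<Sum>v\<in>R. \<bar>u b v\<bar> * C)"
    proof (rule sum_mono)
      fix b :: "real^'n"
      have "\<xi> \<bullet> b = (\<Sum>v\<in>R. u b v * (\<xi> \<bullet> v))"
        using arg_cong[OF u[of b], of "\<lambda>y. \<xi> \<bullet> y"] by (simp add: inner_sum_right)
      also have "\<bar>\<dots>\<bar> \<le> (\<Sum>v\<in>R. \<bar>u b v * (\<xi> \<bullet> v)\<bar>)" by (rule sum_abs)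
      also have "\<dots> \<le> (\<Sum>v\<in>R. \<bar>u b v\<bar> * C)"
        by (intro sum_mono) (use C in \<open>auto simp: abs_mult intro: mult_left_mono\<close>)
      finally show "\<bar>\<xi> \<bullet> b\<bar> \<le> (\<Sum>v\<in>R. \<bar>u b v\<bar> * C)" .
    qed
    also have "\<dots> = (\<Sum>b\<in>Basis. \<Sum>v\<in>R. \<bar>u b v\<bar>) * C" by (simp add: sum_distrib_right)
    also have "\<dots> \<le> K * C" using C0 by (intro mult_right_mono) (auto simp: K_def)
    finally show ?thesis .
  qed
  moreover have "K > 0" using pos by (simp add: K_def)
  ultimately show ?thesis by blast
qed

lemma alcove_bounds: "\<xi> \<in> alcove Rp \<Longrightarrow> \<alpha> \<in> R \<Longrightarrow> \<bar>\<xi> \<bullet> \<alpha>\<bar> \<le> 2 * pi"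
  using R_cases[of \<alpha>] by (force simp: alcove_def)

lemma alcove_bounded: "\<exists>r. \<forall>\<xi>\<in>alcove Rp. norm \<xi> \<le> r"
  using norm_bound_roots alcove_bounds by meson

lemma open_alcove: "open (alcove Rp)"
proof -
  have "alcove Rp = (\<Inter>\<alpha>\<in>Rp. {\<xi>. 0 < \<xi> \<bullet> \<alpha>} \<inter> {\<xi>. \<xi> \<bullet> \<alpha> < 2 * pi})" by (auto simp: alcove_def)
  also have "open \<dots>" by (intro open_INT ballI open_Int open_Collect_less continuous_intros finite_Rp)
  finally show ?thesis .
qed

lemma alcove_nonempty: "\<exists>a. a \<in> alcove Rp"
proof -
  define M where "M = (\<Sum>\<alpha>\<in>Rp. \<alpha> \<bullet> v) + 1"
  have nn: "(\<Sum>\<alpha>\<in>Rp. \<alpha> \<bullet> v) \<ge> 0" using Rp_pos by (intro sum_nonneg) (simp add: less_imp_le)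
  have "(1 / M) *\<^sub>R v \<in> alcove Rp"
    unfolding alcove_def
  proof (intro CollectI ballI conjI)
    fix \<alpha> assume a: "\<alpha> \<in> Rp"
    show "0 < (1 / M) *\<^sub>R v \<bullet> \<alpha>" using Rp_pos[OF a] nn by (simp add: inner_commute M_def)
    have "\<alpha> \<bullet> v \<le> (\<Sum>\<alpha>\<in>Rp. \<alpha> \<bullet> v)"
      using Rp_pos a by (intro member_le_sum) (auto simp: less_imp_le)
    then have "(1 / M) * (\<alpha> \<bullet> v) < 1" using nn by (simp add: M_def field_simps)
    also have "1 < 2 * pi" using pi_gt3 by linarith
    finally show "(1 / M) *\<^sub>R v \<bullet> \<alpha> < 2 * pi" by (simp add: inner_commute)
  qed
  then show ?thesis by blast
qed

text \<open>\<open>2 * pi\<close> times the coroot lattice, the common periods of all characters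
  with weight exponents. It is generated as a monoid; negatives come from \<open>R\<close> being
  closed under negation.\<close>

inductive_set lattice :: "(real^'n) set" where
  lattice_0: "0 \<in> lattice"
| lattice_step: "t \<in> lattice \<Longrightarrow> \<alpha> \<in> R \<Longrightarrow> t + (2 * pi) *\<^sub>R coroot \<alpha> \<in> lattice"

lemma lattice_add: "t \<in> lattice \<Longrightarrow> u \<in> lattice \<Longrightarrow> t + u \<in> lattice"
proof (induction t rule: lattice.induct)
  case (lattice_step t \<alpha>)
  then have "(t + u) + (2 * pi) *\<^sub>R coroot \<alpha> \<in> lattice" by (intro lattice.lattice_step)
  then show ?case by (simp add: ac_simps)
qed simp

lemma lattice_coroot: "\<alpha> \<in> R \<Longrightarrow> (2 * pi) *\<^sub>R coroot \<alpha> \<in> lattice"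
  using lattice_step[OF lattice_0] by simp

lemma lattice_minus: "t \<in> lattice \<Longrightarrow> - t \<in> lattice"
proof (induction t rule: lattice.induct)
  case lattice_0 then show ?case by (simp add: lattice.lattice_0)
next
  case (lattice_step t \<alpha>)
  have "- t + (2 * pi) *\<^sub>R coroot (- \<alpha>) \<in> lattice"
    using lattice_step minus_R by (intro lattice.lattice_step)
  then show ?case by simp
qed

lemma lattice_W: assumes "w \<in> W" shows "t \<in> lattice \<Longrightarrow> w t \<in> lattice"
proof (induction t rule: lattice.induct)
  case lattice_0 then show ?case using linear_0[OF W_linear[OF assms]] by (simp add: lattice.lattice_0)
next
  case (lattice_step t \<alpha>)
  have "w (t + (2 * pi) *\<^sub>R coroot \<alpha>) = w t + (2 * pi) *\<^sub>R coroot (w \<alpha>)"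
    using W_linear[OF assms] coroot_orthogonal[OF W_orthogonal[OF assms], of \<alpha>] by (simp add: linear_add linear_cmul)
  then show ?case using lattice_step W_R[OF assms] lattice.lattice_step by metis
qed

lemma lattice_weight: assumes "weight \<kappa>" shows "t \<in> lattice \<Longrightarrow> \<exists>k::int. \<kappa> \<bullet> t = 2 * pi * of_int k"
proof (induction t rule: lattice.induct)
  case lattice_0 show ?case by (intro exI[of _ 0]) simp
next
  case (lattice_step t \<alpha>)
  obtain k where "\<kappa> \<bullet> t = 2 * pi * of_int k" using lattice_step by blast
  moreover obtain l where "\<kappa> \<bullet> coroot \<alpha> = of_int l" using lattice_step assms by (auto simp: weight_def elim!: Ints_cases)
  ultimately show ?case by (intro exI[of _ "k + l"]) (simp add: inner_add algebra_simps)
qed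

lemma weight_R: "\<alpha> \<in> R \<Longrightarrow> weight \<alpha>"
  by (simp add: weight_def integral_R)

lemma chr_lattice: "weight \<kappa> \<Longrightarrow> t \<in> lattice \<Longrightarrow> chr \<kappa> t = 1"
proof -
  assume "weight \<kappa>" "t \<in> lattice"
  then obtain k :: int where "\<kappa> \<bullet> t = 2 * pi * of_int k" using lattice_weight by blast
  then have "chr \<kappa> t = cis (2 * pi * of_int k)" by (simp add: chr_def cis_conv_exp)
  also have "\<dots> = 1" by (rule cis_multiple_2pi) simp
  finally show ?thesis .
qed

text \<open>The pairings with roots determine a vector; on the lattice they lie in
  \<open>2 * pi\<close> times the integers, and in a ball they are bounded by
  Cauchy-Schwarz.\<close>

lemma finite_lattice_ball: "finite {t\<in>lattice. norm t \<le> B}"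
proof -
  obtain N :: int where N: "\<And>\<alpha>. \<alpha> \<in> R \<Longrightarrow> B * norm \<alpha> / (2 * pi) \<le> of_int N"
  proof
    fix \<alpha> assume a: "\<alpha> \<in> R"
    have "B * norm \<alpha> / (2 * pi) \<le> \<bar>B * norm \<alpha> / (2 * pi)\<bar>" by (rule abs_ge_self)
    also have "\<dots> \<le> (\<Sum>\<alpha>\<in>R. \<bar>B * norm \<alpha> / (2 * pi)\<bar>)" using a by (intro member_le_sum) auto
    also have "\<dots> \<le> of_int \<lceil>\<Sum>\<alpha>\<in>R. \<bar>B * norm \<alpha> / (2 * pi)\<bar>\<rceil>" by (rule le_of_int_ceiling)
    finally show "B * norm \<alpha> / (2 * pi) \<le> of_int \<lceil>\<Sum>\<alpha>\<in>R. \<bar>B * norm \<alpha> / (2 * pi)\<bar>\<rceil>" .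
  qed
  define \<phi> where "\<phi> t = restrict (\<lambda>\<alpha>. \<alpha> \<bullet> t) R" for t :: "real^'n"
  have "inj \<phi>"
  proof (rule injI)
    fix s t assume st: "\<phi> s = \<phi> t"
    have "\<alpha> \<bullet> s = \<alpha> \<bullet> t" if "\<alpha> \<in> R" for \<alpha> using fun_cong[OF st, of \<alpha>] that by (simp add: \<phi>_def)
    then have "\<forall>\<alpha>\<in>R. \<bar>(s - t) \<bullet> \<alpha>\<bar> \<le> 0" by (simp add: inner_diff inner_commute)
    then show "s = t" using norm_bound_roots by fastforce
  qed
  moreover have "\<phi> ` {t\<in>lattice. norm t \<le> B} \<subseteq> R \<rightarrow>\<^sub>E (\<lambda>k. 2 * pi * of_int k) ` {-N..N}"
  proof
    fix h assume "h \<in> \<phi> ` {t\<in>lattice. norm t \<le> B}"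
    then obtain t where t: "t \<in> lattice" "norm t \<le> B" "h = \<phi> t" by blast
    have "\<alpha> \<bullet> t \<in> (\<lambda>k. 2 * pi * of_int k) ` {-N..N}" if a: "\<alpha> \<in> R" for \<alpha>
    proof -
      obtain k :: int where k: "\<alpha> \<bullet> t = 2 * pi * of_int k" using lattice_weight weight_R a t by blast
      have "2 * pi * \<bar>of_int k\<bar> = \<bar>\<alpha> \<bullet> t\<bar>" unfolding k by (simp add: abs_mult)
      also have "\<dots> \<le> norm \<alpha> * norm t" by (rule Cauchy_Schwarz_ineq2)
      also have "\<dots> \<le> norm \<alpha> * B" using t by (intro mult_left_mono) auto
      finally have "\<bar>real_of_int k\<bar> \<le> B * norm \<alpha> / (2 * pi)" by (simp add: field_simps)
      then have "\<bar>real_of_int k\<bar> \<le> of_int N" using N[OF a] by linarith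
      then have "k \<in> {-N..N}" by auto
      then show ?thesis using k by blast
    qed
    then show "h \<in> R \<rightarrow>\<^sub>E (\<lambda>k. 2 * pi * of_int k) ` {-N..N}" by (auto simp: t \<phi>_def)
  qed
  moreover have "finite (R \<rightarrow>\<^sub>E (\<lambda>k. 2 * pi * of_int k) ` {-N..N})" by (intro finite_PiE) auto
  ultimately show ?thesis by (meson finite_imageD finite_subset inj_on_subset subset_UNIV)
qed

section \<open>Covering of generic points by images of the alcove\<close>

definition generic :: "real^'n \<Rightarrow> bool" where
  "generic \<xi> \<longleftrightarrow> (\<forall>\<alpha>\<in>R. \<forall>k::int. \<alpha> \<bullet> \<xi> \<noteq> 2 * pi * of_int k)"

lemma AE_generic: "AE \<xi> in lborel. generic (\<xi> + c)"
proof -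
  have "AE \<xi> in lborel. \<alpha> \<bullet> (\<xi> + c) \<noteq> 2 * pi * of_int k" if "\<alpha> \<in> R" for \<alpha> and k :: int
  proof -
    have "negligible {\<xi>. \<alpha> \<bullet> \<xi> = 2 * pi * of_int k - \<alpha> \<bullet> c}"
      using R_nz[OF that] by (intro negligible_hyperplane) auto
    then have "AE \<xi> in lebesgue. \<not> (\<alpha> \<bullet> \<xi> = 2 * pi * of_int k - \<alpha> \<bullet> c)"
      by (intro AE_not_in[of "{\<xi>. \<alpha> \<bullet> \<xi> = 2 * pi * of_int k - \<alpha> \<bullet> c}", simplified]) (simp add: negligible_iff_null_sets)
    then show ?thesis by (simp add: AE_completion_iff inner_add eq_diff_eq)
  qed
  then show ?thesis unfolding generic_def by (intro AE_finite_allI AE_all_countable[THEN iffD2] allI finite_R)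
qed

lemma generic_affine: "generic \<xi> \<Longrightarrow> w \<in> W \<Longrightarrow> t \<in> lattice \<Longrightarrow> generic (w (\<xi> + t))"
  unfolding generic_def
proof (intro ballI allI notI)
  fix \<alpha> and k :: int
  assume g: "\<forall>\<alpha>\<in>R. \<forall>k::int. \<alpha> \<bullet> \<xi> \<noteq> 2 * pi * of_int k" and w: "w \<in> W" "t \<in> lattice" "\<alpha> \<in> R"
    and e: "\<alpha> \<bullet> w (\<xi> + t) = 2 * pi * of_int k"
  have a: "inv w \<alpha> \<in> R" using W_R W_inv w by blast
  obtain l :: int where l: "inv w \<alpha> \<bullet> t = 2 * pi * of_int l" using lattice_weight[OF weight_R[OF a]] w by blast
  have "inv w \<alpha> \<bullet> \<xi> = 2 * pi * of_int (k - l)"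
    using e l by (simp add: W_inner_inv[OF w(1)] inner_add algebra_simps)
  then show False using g a by blast
qed

text \<open>Every generic point is moved into the alcove by the affine Weyl group: a point of its orbit
  nearest to a fixed point of the alcove is separated from it by no reflection hyperplane.\<close>

lemma alcove_covers:
  assumes "generic \<xi>" shows "\<exists>w\<in>W. \<exists>t\<in>lattice. w (\<xi> + t) \<in> alcove Rp"
proof -
  obtain a where a: "a \<in> alcove Rp" using alcove_nonempty by blast
  \<comment> \<open>Only orbit points no farther from \<open>a\<close> than \<open>\<xi>\<close>
    compete for being nearest; there are finitely many of them, so the minimum is attained.\<close>
  define S where "S = {(w, t). w \<in> W \<and> t \<in> lattice \<and> norm (w (\<xi> + t) - a) \<le> norm (\<xi> - a)}"
  have "S \<subseteq> W \<times> {t\<in>lattice. norm t \<le> norm (\<xi> - a) + norm a + norm \<xi>}"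
  proof (clarsimp simp: S_def)
    fix w t assume w: "w \<in> W" and le: "norm (w (\<xi> + t) - a) \<le> norm (\<xi> - a)"
    have "norm t \<le> norm (\<xi> + t) + norm \<xi>" by (metis add_diff_cancel_left' norm_triangle_ineq4)
    also have "norm (\<xi> + t) = norm (w (\<xi> + t))" using W_norm[OF w] by simp
    also have "\<dots> \<le> norm (w (\<xi> + t) - a) + norm a" by (metis diff_add_cancel norm_triangle_ineq)
    finally show "norm t \<le> norm (\<xi> - a) + norm a + norm \<xi>" using le by linarith
  qed
  then have fS: "finite S" using finite_W finite_lattice_ball by (meson finite_SigmaI finite_subset)
  have "(id, 0) \<in> S" using weyl_group.wg_id lattice_0 by (auto simp: S_def)
  then have neS: "S \<noteq> {}" by blast
  let ?f = "\<lambda>(w, t). norm (w (\<xi> + t) - a)"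
  define wt where "wt = arg_min_on ?f S"
  obtain w t where wt': "wt = (w, t)" by (cases wt)
  have inS: "(w, t) \<in> S" and min: "\<And>u s. (u, s) \<in> S \<Longrightarrow> norm (w (\<xi> + t) - a) \<le> norm (u (\<xi> + s) - a)"
    using arg_min_if_finite[OF fS neS, of ?f] wt' unfolding wt_def[symmetric] by (auto simp: not_less)
  have w: "w \<in> W" "t \<in> lattice" using inS by (auto simp: S_def)
  define x where "x = w (\<xi> + t)"
  have min': "norm (x - a) \<le> norm (u (\<xi> + s) - a)" if "u \<in> W" "s \<in> lattice" for u s
    using min[of u s] inS that unfolding x_def S_def by (cases "norm (u (\<xi> + s) - a) \<le> norm (\<xi> - a)") auto
  have gx: "generic x" unfolding x_def using generic_affine assms w by blast
  have "0 < x \<bullet> \<alpha> \<and> x \<bullet> \<alpha> < 2 * pi" if al: "\<alpha> \<in> Rp" for \<alpha>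
  proof -
    have aR: "\<alpha> \<in> R" using al Rp_R by blast
    have aa: "\<alpha> \<bullet> \<alpha> > 0" using R_nz[OF aR] by simp
    have a\<alpha>: "0 < a \<bullet> \<alpha>" "a \<bullet> \<alpha> < 2 * pi" using a al by (auto simp: alcove_def)
    have ne: "x \<bullet> \<alpha> \<noteq> 0" "x \<bullet> \<alpha> \<noteq> 2 * pi"
      using gx[unfolded generic_def, rule_format, OF aR, of 0] gx[unfolded generic_def, rule_format, OF aR, of 1]
      by (auto simp: inner_commute)
    define c where "c = 2 / (\<alpha> \<bullet> \<alpha>)"
    have c: "c > 0" "c * (\<alpha> \<bullet> \<alpha>) = 2" using aa by (auto simp: c_def)
    \<comment> \<open>Squared distances to \<open>a\<close> are compared before and after a
      displacement along \<alpha>. The value \<open>p = x \<bullet> \<alpha>\<close> is the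
      reflection in the wall through 0, and \<open>p = x \<bullet> \<alpha> - 2 * pi\<close> the one
      in the parallel wall.\<close>
    have key: "p * (p - (x \<bullet> \<alpha> - a \<bullet> \<alpha>)) \<ge> 0" if y: "norm (x - a) \<le> norm (x - (p * c) *\<^sub>R \<alpha> - a)" for p
    proof -
      have "(x - a) \<bullet> (x - a) \<le> (x - (p * c) *\<^sub>R \<alpha> - a) \<bullet> (x - (p * c) *\<^sub>R \<alpha> - a)"
        using y by (simp add: norm_le)
      also have "\<dots> = (x - a) \<bullet> (x - a) - 2 * (p * c) * (x \<bullet> \<alpha> - a \<bullet> \<alpha>) + (p * c) * p * (c * (\<alpha> \<bullet> \<alpha>))"
        by (simp add: inner_diff inner_commute algebra_simps)
      finally have "(2 * c) * (p * (p - (x \<bullet> \<alpha> - a \<bullet> \<alpha>))) \<ge> 0"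
        unfolding c(2) by (simp add: algebra_simps)
      then show ?thesis using c(1) by (simp add: zero_le_mult_iff)
    qed
    have "x \<bullet> \<alpha> > 0"
    proof (rule ccontr)
      assume "\<not> ?thesis"
      then have neg: "x \<bullet> \<alpha> < 0" using ne by simp
      have "norm (x - a) \<le> norm ((rrefl \<alpha> \<circ> w) (\<xi> + t) - a)"
        by (intro min' w weyl_group.wg_step aR)
      also have "(rrefl \<alpha> \<circ> w) (\<xi> + t) = x - ((x \<bullet> \<alpha>) * c) *\<^sub>R \<alpha>"
        by (simp add: x_def[symmetric] rrefl_def coroot_def c_def mult.commute)
      finally have "(x \<bullet> \<alpha>) * (a \<bullet> \<alpha>) \<ge> 0" using key[of "x \<bullet> \<alpha>"] by simp
      then show False using neg a\<alpha> by (simp add: zero_le_mult_iff)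
    qed
    moreover have "x \<bullet> \<alpha> < 2 * pi"
    proof (rule ccontr)
      assume "\<not> ?thesis"
      then have gt: "x \<bullet> \<alpha> > 2 * pi" using ne by simp
      define u where "u = rrefl \<alpha> \<circ> w"
      have u: "u \<in> W" unfolding u_def by (intro w weyl_group.wg_step aR)
      \<comment> \<open>Chosen so that \<open>u (\<xi> + s)\<close> is the reflection of
        \<open>x\<close> in the wall at \<open>2 * pi\<close>: the translation is pulled back
        through \<open>u\<close> because it acts before the linear part.\<close>
      define s where "s = t + inv u ((2 * pi) *\<^sub>R coroot \<alpha>)"
      have s: "s \<in> lattice" unfolding s_def using w lattice_add lattice_W[OF W_inv[OF u]] lattice_coroot[OF aR] by blast
      have "norm (x - a) \<le> norm (u (\<xi> + s) - a)" by (intro min' u s)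
      also have "u (\<xi> + s) = u (\<xi> + t) + (2 * pi) *\<^sub>R coroot \<alpha>"
        unfolding s_def add.assoc[symmetric] using linear_add[OF W_linear[OF u]] u by simp
      also have "u (\<xi> + t) = rrefl \<alpha> x" by (simp add: u_def x_def)
      also have "rrefl \<alpha> x + (2 * pi) *\<^sub>R coroot \<alpha> = x - ((x \<bullet> \<alpha> - 2 * pi) * c) *\<^sub>R \<alpha>"
        by (simp add: rrefl_def coroot_def c_def algebra_simps)
      finally have "(x \<bullet> \<alpha> - 2 * pi) * (a \<bullet> \<alpha> - 2 * pi) \<ge> 0"
        using key[of "x \<bullet> \<alpha> - 2 * pi"] by (simp add: algebra_simps)
      then show False using gt a\<alpha> by (simp add: zero_le_mult_iff)
    qed
    ultimately show ?thesis by blast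
  qed
  then have "x \<in> alcove Rp" by (simp add: alcove_def)
  then show ?thesis using w x_def by blast
qed

text \<open>The pair \<open>(w, t)\<close> encodes the affine map sending \<open>\<eta>\<close> to
  \<open>w (\<eta> + t)\<close>; the translation is applied before the linear part.\<close>

definition hits :: "real^'n \<Rightarrow> ((real^'n \<Rightarrow> real^'n) \<times> (real^'n)) set" where
  "hits \<xi> = {(w, t). w \<in> W \<and> t \<in> lattice \<and> w (\<xi> + t) \<in> alcove Rp}"

lemma finite_hits: "finite (hits \<xi>)"
proof -
  obtain r where r: "\<And>\<xi>. \<xi> \<in> alcove Rp \<Longrightarrow> norm \<xi> \<le> r" using alcove_bounded by blast
  have "hits \<xi> \<subseteq> W \<times> {t\<in>lattice. norm t \<le> r + norm \<xi>}"
  proof (clarsimp simp: hits_def)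
    fix w t assume w: "w \<in> W" "w (\<xi> + t) \<in> alcove Rp"
    have "norm t \<le> norm (\<xi> + t) + norm \<xi>" by (metis add_diff_cancel_left' norm_triangle_ineq4)
    also have "norm (\<xi> + t) = norm (w (\<xi> + t))" using W_norm[OF w(1)] by simp
    finally show "norm t \<le> r + norm \<xi>" using r[OF w(2)] by linarith
  qed
  then show ?thesis using finite_W finite_lattice_ball by (meson finite_SigmaI finite_subset)
qed

text \<open>No reflection hyperplane meets the alcove, so an element of the affine Weyl group maps it
  either into itself or off itself.\<close>

lemma affine_alcove:
  assumes "w \<in> W" "t \<in> lattice" "\<xi> \<in> alcove Rp" "w (\<xi> + t) \<in> alcove Rp" "\<eta> \<in> alcove Rp"
  shows "w (\<eta> + t) \<in> alcove Rp"
  unfolding alcove_def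
proof (intro CollectI ballI)
  fix \<alpha> assume al: "\<alpha> \<in> Rp"
  define \<beta> where "\<beta> = inv w \<alpha>"
  have b: "\<beta> \<in> R" unfolding \<beta>_def using W_R W_inv assms al Rp_R by blast
  obtain k :: int where k: "\<beta> \<bullet> t = 2 * pi * of_int k" using lattice_weight[OF weight_R[OF b]] assms by blast
  have eq: "w (\<zeta> + t) \<bullet> \<alpha> = \<zeta> \<bullet> \<beta> + 2 * pi * of_int k" for \<zeta>
  proof -
    have "w (\<zeta> + t) \<bullet> \<alpha> = \<beta> \<bullet> (\<zeta> + t)" using W_inner_inv[OF assms(1), of \<alpha> "\<zeta> + t"] by (simp add: \<beta>_def inner_commute)
    then show ?thesis using k by (simp add: inner_add inner_commute)
  qed
  have \<xi>: "0 < \<xi> \<bullet> \<beta> + 2 * pi * of_int k" "\<xi> \<bullet> \<beta> + 2 * pi * of_int k < 2 * pi"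
    using assms(4) al unfolding eq[symmetric] by (auto simp: alcove_def)
  have "0 < \<eta> \<bullet> \<beta> + 2 * pi * of_int k \<and> \<eta> \<bullet> \<beta> + 2 * pi * of_int k < 2 * pi"
  proof (cases "\<beta> \<in> Rp")
    case True
    then have r: "0 < \<xi> \<bullet> \<beta>" "\<xi> \<bullet> \<beta> < 2 * pi" "0 < \<eta> \<bullet> \<beta>" "\<eta> \<bullet> \<beta> < 2 * pi" using assms by (auto simp: alcove_def)
    have "2 * pi * of_int k < 2 * pi * 1" "2 * pi * (-1) < 2 * pi * of_int k" using \<xi> r by linarith+
    then have "real_of_int k < 1" "-1 < real_of_int k"
      using mult_less_cancel_left_pos[of "2 * pi"] by (metis mult_pos_pos pi_gt_zero zero_less_numeral)+
    then have "k = 0" by linarith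
    then show ?thesis using r by simp
  next
    case False
    then have "- \<beta> \<in> Rp" using R_cases b by blast
    then have r: "0 > \<xi> \<bullet> \<beta>" "\<xi> \<bullet> \<beta> > - 2 * pi" "0 > \<eta> \<bullet> \<beta>" "\<eta> \<bullet> \<beta> > - 2 * pi" using assms by (force simp: alcove_def)+
    have "2 * pi * of_int k < 2 * pi * 2" "2 * pi * 0 < 2 * pi * of_int k" using \<xi> r by linarith+
    then have "real_of_int k < 2" "0 < real_of_int k"
      using mult_less_cancel_left_pos[of "2 * pi"] by (metis mult_pos_pos pi_gt_zero zero_less_numeral)+
    then have "k = 1" by linarith
    then show ?thesis using r by simp
  qed
  then show "0 < w (\<eta> + t) \<bullet> \<alpha> \<and> w (\<eta> + t) \<bullet> \<alpha> < 2 * pi" unfolding eq .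
qed

lemma hits_alcove: "\<xi> \<in> alcove Rp \<Longrightarrow> \<eta> \<in> alcove Rp \<Longrightarrow> hits \<xi> = hits \<eta>"
  unfolding hits_def using affine_alcove by blast

text \<open>Composing on the right with the affine map that moves the point is a bijection between
  the two sets; \<open>s + inv u t\<close> is the translation part of the composite.\<close>

lemma card_hits_affine:
  assumes u: "u \<in> W" and s: "s \<in> lattice" shows "card (hits (u (\<xi> + s))) = card (hits \<xi>)"
proof (rule bij_betw_same_card)
  have eq: "w (u (\<xi> + s) + t) = (w \<circ> u) (\<xi> + (s + inv u t))" for w t
    using linear_add[OF W_linear[OF u], of "\<xi> + s" "inv u t"] u by (simp add: add.assoc)
  have eq2: "(w \<circ> inv u) (u (\<xi> + s) + u (t - s)) = w (\<xi> + t)" for w t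
    using linear_add[OF W_linear[OF u], of "\<xi> + s" "t - s", symmetric] u by simp
  show "bij_betw (\<lambda>(w, t). (w \<circ> u, s + inv u t)) (hits (u (\<xi> + s))) (hits \<xi>)"
  proof (rule bij_betw_byWitness[where f' = "\<lambda>(w, t). (w \<circ> inv u, u (t - s))"])
    show "(\<lambda>(w, t). (w \<circ> u, s + inv u t)) ` hits (u (\<xi> + s)) \<subseteq> hits \<xi>"
      using lattice_add[OF s] lattice_W[OF W_inv[OF u]] W_comp[OF _ u] by (auto simp: hits_def eq)
    show "(\<lambda>(w, t). (w \<circ> inv u, u (t - s))) ` hits \<xi> \<subseteq> hits (u (\<xi> + s))"
    proof clarify
      fix w t assume "(w, t) \<in> hits \<xi>"
      then have h: "w \<in> W" "t \<in> lattice" "w (\<xi> + t) \<in> alcove Rp" by (auto simp: hits_def)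
      have "u (t - s) \<in> lattice" using lattice_W[OF u] lattice_add[OF h(2) lattice_minus[OF s]] by simp
      then show "(w \<circ> inv u, u (t - s)) \<in> hits (u (\<xi> + s))"
        unfolding hits_def using W_comp[OF h(1) W_inv[OF u]] h(3) eq2[of w t] by auto
    qed
  qed (use u in \<open>auto simp: fun_eq_iff\<close>)
qed

text \<open>The count at any alcove point is the count at every generic point. Its constancy is what
  makes the lattice translates of \<open>star\<close> cover evenly, and its positivity allows
  cancelling it.\<close>

definition multiplicity_alcove :: nat where
  "multiplicity_alcove = card (hits (SOME a. a \<in> alcove Rp))"

lemma card_hits: "generic \<xi> \<Longrightarrow> card (hits \<xi>) = multiplicity_alcove"
  using alcove_covers[of \<xi>] hits_alcove someI_ex[OF alcove_nonempty] card_hits_affine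
  unfolding multiplicity_alcove_def by metis

lemma multiplicity_alcove_pos: "multiplicity_alcove > 0"
proof -
  have "(id, 0) \<in> hits (SOME a. a \<in> alcove Rp)"
    using weyl_group.wg_id lattice_0 someI_ex[OF alcove_nonempty] by (auto simp: hits_def)
  then show ?thesis unfolding multiplicity_alcove_def using finite_hits by (auto simp: card_gt_0_iff)
qed

text \<open>The alcove unfolded by the Weyl group: an integral over the alcove of a Weyl group sum
  turns into an integral against this weight over the whole space.\<close>

definition star :: "real^'n \<Rightarrow> real" where
  "star \<xi> = (\<Sum>w\<in>W. indicator (alcove Rp) (w \<xi>))"

lemma star_measurable [measurable]: "star \<in> borel_measurable borel"
proof -
  have [measurable]: "alcove Rp \<in> sets borel" using open_alcove by simp
  show ?thesis unfolding star_def
    by (intro borel_measurable_sum) (use W_measurable in \<open>measurable\<close>)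
qed

lemma star_bound: "0 \<le> star \<xi>" "star \<xi> \<le> card W"
  unfolding star_def by (auto intro!: sum_nonneg sum_bounded_above[of W _ 1, simplified] simp: indicator_def)

lemma star_radius: "\<exists>r. \<forall>\<xi>. star \<xi> \<noteq> 0 \<longrightarrow> norm \<xi> \<le> r"
proof -
  obtain r where r: "\<And>\<xi>. \<xi> \<in> alcove Rp \<Longrightarrow> norm \<xi> \<le> r" using alcove_bounded by blast
  have "norm \<xi> \<le> r" if "star \<xi> \<noteq> 0" for \<xi>
  proof -
    obtain w where "w \<in> W" "w \<xi> \<in> alcove Rp"
      using \<open>star \<xi> \<noteq> 0\<close> unfolding star_def by (metis (mono_tags, lifting) indicator_simps(2) sum.neutral)
    then show ?thesis using r W_norm by metis
  qed
  then show ?thesis by blast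
qed

lemma sum_star:
  assumes "generic \<xi>" "finite T" "T \<subseteq> lattice" "\<And>t. t \<in> lattice \<Longrightarrow> star (\<xi> + t) \<noteq> 0 \<Longrightarrow> t \<in> T"
  shows "(\<Sum>t\<in>T. star (\<xi> + t)) = multiplicity_alcove"
proof -
  have sub: "hits \<xi> \<subseteq> W \<times> T"
  proof (clarsimp simp: hits_def)
    fix w t assume w: "w \<in> W" "t \<in> lattice" "w (\<xi> + t) \<in> alcove Rp"
    have "star (\<xi> + t) \<ge> indicator (alcove Rp) (w (\<xi> + t))"
      unfolding star_def by (rule member_le_sum) (use w finite_W in auto)
    then show "t \<in> T" using assms(4)[OF w(2)] w(3) by auto
  qed
  have "(\<Sum>t\<in>T. star (\<xi> + t)) = (\<Sum>w\<in>W. \<Sum>t\<in>T. indicator (alcove Rp) (w (\<xi> + t)))"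
    unfolding star_def by (rule sum.swap)
  also have "\<dots> = (\<Sum>(w, t)\<in>W \<times> T. indicator (hits \<xi>) (w, t))"
    unfolding sum.cartesian_product using assms(3) by (intro sum.cong) (auto simp: hits_def indicator_def)
  also have "\<dots> = (\<Sum>x\<in>hits \<xi>. 1)"
    using sub assms(2) finite_W by (intro sum.mono_neutral_cong_right) (auto simp: indicator_def)
  finally show ?thesis using card_hits[OF assms(1)] by simp
qed

lemma integrable_star:
  assumes [measurable]: "h \<in> borel_measurable borel" and "\<And>x. norm (h x) \<le> C"
  shows "integrable lborel (\<lambda>x. h x * complex_of_real (star x))"
proof -
  obtain r where r: "\<And>\<xi>. star \<xi> \<noteq> 0 \<Longrightarrow> norm \<xi> \<le> r" using star_radius by blast
  have C: "C \<ge> 0" using assms(2) norm_ge_zero order_trans by blast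
  show ?thesis
  proof (rule integrable_lborel_bounded_support[of _ "C * card W" r])
    show "norm (h x * complex_of_real (star x)) \<le> C * card W" for x
      using mult_mono[OF assms(2)[of x] star_bound(2)[of x]] C star_bound(1)[of x] by (simp add: norm_mult)
    show "h x * complex_of_real (star x) = 0" if "norm x > r" for x
      using r[of x] that by force
  qed measurable
qed

text \<open>Translating by \<open>y\<close> multiplies the integral by the value of the character at \<open>y\<close>, and also
  leaves it unchanged because the translates of the star by the lattice cover evenly.\<close>

lemma integral_chr_star:
  assumes \<kappa>: "weight \<kappa>" "\<kappa> \<noteq> 0"
  shows "(\<integral>\<xi>. chr \<kappa> \<xi> * complex_of_real (star \<xi>) \<partial>lborel) = 0"
proof -
  \<comment> \<open>Scaled so that \<open>\<kappa> \<bullet> y = pi\<close>; the character takes the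
    value -1 there.\<close>
  define y where "y = (pi / (\<kappa> \<bullet> \<kappa>)) *\<^sub>R \<kappa>"
  let ?S = "\<integral>\<xi>. chr \<kappa> \<xi> * complex_of_real (star \<xi>) \<partial>lborel"
  let ?m = "multiplicity_alcove"
  have [measurable]: "chr \<kappa> \<in> borel_measurable borel"
    by (rule borel_measurable_continuous_onI) (intro continuous_intros)
  obtain r where r: "\<And>\<xi>. star \<xi> \<noteq> 0 \<Longrightarrow> norm \<xi> \<le> r" using star_radius by blast
  \<comment> \<open>If two stars whose arguments differ by \<open>t + y\<close> or by
    \<open>t - y\<close> are both nonzero, then \<open>t\<close> has norm at most two radii plus
    \<open>norm y\<close>.\<close>
  define T where "T = {t\<in>lattice. norm t \<le> r + r + norm y}"
  have fT: "finite T" and Tl: "T \<subseteq> lattice" unfolding T_def using finite_lattice_ball by auto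
  have Tm: "bij_betw uminus T T"
    by (rule bij_betw_byWitness[where f' = uminus]) (auto simp: T_def lattice_minus)
  have per: "chr \<kappa> (\<xi> + t) = chr \<kappa> \<xi>" if "t \<in> T" for \<xi> t
    using chr_lattice[OF \<kappa>(1), of t] that Tl by (auto simp: chr_add_right)
  have int: "integrable lborel (\<lambda>\<xi>. chr \<kappa> \<xi> * complex_of_real (star (\<xi> + c)) * complex_of_real (star \<xi>))" for c
    by (rule integrable_star[where C = "card W"]) (use star_bound in \<open>simp_all add: norm_mult\<close>)
  have int': "integrable lborel (\<lambda>\<xi>. chr \<kappa> \<xi> * complex_of_real (star (\<xi> - y)) * complex_of_real (star (\<xi> + t)))" if t: "t \<in> T" for t
  proof (rule integrable_lborel_bounded_support[of _ "card W * card W" "norm t + r"])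
    show "norm (chr \<kappa> x * complex_of_real (star (x - y)) * complex_of_real (star (x + t))) \<le> card W * card W" for x
      using mult_mono[OF star_bound(2)[of "x - y"] star_bound(2)[of "x + t"]] star_bound(1) by (simp add: norm_mult)
    show "chr \<kappa> x * complex_of_real (star (x - y)) * complex_of_real (star (x + t)) = 0" if "norm x > norm t + r" for x
    proof -
      have "norm x \<le> norm (x + t) + norm t" by (metis add_diff_cancel norm_triangle_ineq4)
      then show ?thesis using r[of "x + t"] that by force
    qed
  qed measurable
  \<comment> \<open>The constant \<open>?m\<close> is spread out as a sum of translates of a second
    star. Translating term by term, under which the character is periodic, shifts the sum onto the
    first star, where it collapses to \<open>?m\<close> again.\<close>
  have "?m * (\<integral>\<xi>. chr \<kappa> \<xi> * complex_of_real (star (\<xi> - y)) \<partial>lborel)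
      = (\<integral>\<xi>. of_nat ?m * (chr \<kappa> \<xi> * complex_of_real (star (\<xi> - y))) \<partial>lborel)" by simp
  also have "\<dots> = (\<integral>\<xi>. (\<Sum>t\<in>T. chr \<kappa> \<xi> * complex_of_real (star (\<xi> - y)) * complex_of_real (star (\<xi> + t))) \<partial>lborel)"
  proof (rule integral_cong_AE)
    show "AE \<xi> in lborel. of_nat ?m * (chr \<kappa> \<xi> * complex_of_real (star (\<xi> - y)))
        = (\<Sum>t\<in>T. chr \<kappa> \<xi> * complex_of_real (star (\<xi> - y)) * complex_of_real (star (\<xi> + t)))"
      using AE_generic[of 0]
    proof eventually_elim
      case (elim \<xi>)
      show ?case
      proof (cases "star (\<xi> - y) = 0")
        case False
        have "(\<Sum>t\<in>T. star (\<xi> + t)) = ?m"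
        proof (rule sum_star[OF _ fT Tl])
          fix t assume t: "t \<in> lattice" "star (\<xi> + t) \<noteq> 0"
          have "t = (\<xi> + t) - (\<xi> - y) - y" by simp
          then have "norm t \<le> norm (\<xi> + t) + norm (\<xi> - y) + norm y"
            by (metis add_right_mono norm_triangle_ineq4 order_trans)
          then show "t \<in> T" using r[OF False] r[OF t(2)] t(1) by (simp add: T_def)
        qed (use elim in simp)
        then show ?thesis by (simp flip: sum_distrib_left of_real_sum)
      qed simp
    qed
  qed measurable
  also have "\<dots> = (\<Sum>t\<in>T. \<integral>\<xi>. chr \<kappa> \<xi> * complex_of_real (star (\<xi> - y)) * complex_of_real (star (\<xi> + t)) \<partial>lborel)"
    by (rule Bochner_Integration.integral_sum) (rule int')
  also have "\<dots> = (\<Sum>t\<in>T. \<integral>\<xi>. chr \<kappa> \<xi> * complex_of_real (star (\<xi> - y + - t)) * complex_of_real (star \<xi>) \<partial>lborel)"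
  proof (rule sum.cong)
    fix t assume t: "t \<in> T"
    have "(\<integral>\<xi>. chr \<kappa> \<xi> * complex_of_real (star (\<xi> - y + - t)) * complex_of_real (star \<xi>) \<partial>lborel)
        = (\<integral>\<xi>. chr \<kappa> (\<xi> + t) * complex_of_real (star ((\<xi> + t) - y + - t)) * complex_of_real (star (\<xi> + t)) \<partial>lborel)"
      by (rule integral_lborel_translate[symmetric]) measurable
    then show "(\<integral>\<xi>. chr \<kappa> \<xi> * complex_of_real (star (\<xi> - y)) * complex_of_real (star (\<xi> + t)) \<partial>lborel)
        = (\<integral>\<xi>. chr \<kappa> \<xi> * complex_of_real (star (\<xi> - y + - t)) * complex_of_real (star \<xi>) \<partial>lborel)"
      using per[OF t] by simp
  qed simp
  also have "\<dots> = (\<Sum>t\<in>T. \<integral>\<xi>. chr \<kappa> \<xi> * complex_of_real (star (\<xi> + (t - y))) * complex_of_real (star \<xi>) \<partial>lborel)"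
    by (subst sum.reindex_bij_betw[OF Tm, symmetric]) (simp add: algebra_simps)
  also have "\<dots> = (\<integral>\<xi>. (\<Sum>t\<in>T. chr \<kappa> \<xi> * complex_of_real (star (\<xi> + (t - y))) * complex_of_real (star \<xi>)) \<partial>lborel)"
    by (rule Bochner_Integration.integral_sum[symmetric]) (rule int)
  also have "\<dots> = (\<integral>\<xi>. of_nat ?m * (chr \<kappa> \<xi> * complex_of_real (star \<xi>)) \<partial>lborel)"
  proof (rule integral_cong_AE)
    show "AE \<xi> in lborel. (\<Sum>t\<in>T. chr \<kappa> \<xi> * complex_of_real (star (\<xi> + (t - y))) * complex_of_real (star \<xi>))
        = of_nat ?m * (chr \<kappa> \<xi> * complex_of_real (star \<xi>))"
      using AE_generic[of "- y"]
    proof eventually_elim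
      case (elim \<xi>)
      show ?case
      proof (cases "star \<xi> = 0")
        case False
        have "(\<Sum>t\<in>T. star (\<xi> - y + t)) = ?m"
        proof (rule sum_star[OF _ fT Tl])
          fix t assume t: "t \<in> lattice" "star (\<xi> - y + t) \<noteq> 0"
          have "t = (\<xi> - y + t) - \<xi> - - y" by simp
          then have "norm t \<le> norm (\<xi> - y + t) + norm \<xi> + norm (- y)"
            by (metis add_right_mono norm_triangle_ineq4 order_trans)
          then show "t \<in> T" using r[OF False] r[OF t(2)] t(1) by (simp add: T_def)
        qed (use elim in simp)
        moreover have eq: "\<xi> + (t - y) = \<xi> - y + t" for t by simp
        ultimately have "(\<Sum>t\<in>T. star (\<xi> + (t - y))) = ?m" unfolding eq by blast
        then have s: "complex_of_real (\<Sum>t\<in>T. star (\<xi> + (t - y))) = of_nat ?m" by simp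
        have "(\<Sum>t\<in>T. chr \<kappa> \<xi> * complex_of_real (star (\<xi> + (t - y))) * complex_of_real (star \<xi>))
            = chr \<kappa> \<xi> * complex_of_real (\<Sum>t\<in>T. star (\<xi> + (t - y))) * complex_of_real (star \<xi>)"
          unfolding of_real_sum sum_distrib_left sum_distrib_right ..
        then show ?thesis unfolding s by (simp only: mult.left_commute mult.assoc)
      qed simp
    qed
  qed measurable
  also have "\<dots> = of_nat ?m * ?S" by simp
  finally have 1: "(\<integral>\<xi>. chr \<kappa> \<xi> * complex_of_real (star (\<xi> - y)) \<partial>lborel) = ?S"
    using multiplicity_alcove_pos by simp
  have "(\<integral>\<xi>. chr \<kappa> \<xi> * complex_of_real (star (\<xi> - y)) \<partial>lborel)
      = (\<integral>\<xi>. chr \<kappa> (\<xi> + y) * complex_of_real (star ((\<xi> + y) - y)) \<partial>lborel)"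
    by (rule integral_lborel_translate[symmetric]) measurable
  also have "\<dots> = (\<integral>\<xi>. chr \<kappa> y * (chr \<kappa> \<xi> * complex_of_real (star \<xi>)) \<partial>lborel)"
    by (simp add: chr_add_right mult_ac)
  also have "\<dots> = chr \<kappa> y * ?S" by simp
  also have "chr \<kappa> y = -1"
    using \<kappa>(2) by (simp add: chr_def y_def exp_pi_i' mult.commute)
  finally show ?thesis using 1 by simp
qed

section \<open>Integration over the alcove\<close>

abbreviation "AV \<equiv> alcove Rp"

lemma alcove_sets [measurable]: "AV \<in> sets borel"
  using open_alcove by simp

lemma set_integrable_alcove:
  assumes "continuous_on UNIV (f :: real^'n \<Rightarrow> 'b::{banach, second_countable_topology})"
  shows "set_integrable lborel AV f"
proof -
  obtain r where r: "\<And>\<xi>. \<xi> \<in> AV \<Longrightarrow> norm \<xi> \<le> r" using alcove_bounded by blast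
  have "set_integrable lborel (cball 0 r) f"
    unfolding set_integrable_def by (rule borel_integrable_compact) (use assms continuous_on_subset in auto)
  then show ?thesis by (rule set_integrable_subset) (use r in auto)
qed

lemma set_integral_lebesgue_alcove:
  assumes "continuous_on UNIV (f :: real^'n \<Rightarrow> 'b::{banach, second_countable_topology})"
  shows "(LINT \<xi>:AV|lebesgue. f \<xi>) = (LINT \<xi>:AV|lborel. f \<xi>)"
proof -
  have "f \<in> borel_measurable borel" using assms by (rule borel_measurable_continuous_onI)
  then have "(\<lambda>x. indicator AV x *\<^sub>R f x) \<in> borel_measurable lborel" by measurable
  then show ?thesis unfolding set_lebesgue_integral_def by (rule integral_completion)
qed

lemma alcove_volume: "measure lebesgue AV > 0" "measure lebesgue AV = measure lborel AV"
proof -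
  show eq: "measure lebesgue AV = measure lborel AV" by (simp add: measure_completion)
  obtain r where "\<And>\<xi>. \<xi> \<in> AV \<Longrightarrow> norm \<xi> \<le> r" using alcove_bounded by blast
  then have "bounded AV" by (auto simp: bounded_iff)
  then have "emeasure lborel AV \<noteq> \<infinity>" using emeasure_bounded_finite by (metis less_irrefl)
  moreover have "emeasure lborel AV \<noteq> 0"
    using open_not_negligible[OF open_alcove] alcove_nonempty by (auto simp: negligible_iff_null_sets null_sets_def)
  ultimately show "measure lebesgue AV > 0" unfolding eq measure_def
    by (simp add: enn2real_positive_iff less_top zero_less_iff_neq_zero)
qed

text \<open>Orthogonal invariance transfers each Weyl element from the character to the indicator of
  the alcove, and the indicators add up to \<open>star\<close>.\<close>

lemma fourier_alcove:
  assumes \<kappa>: "weight \<kappa>"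
  shows "(LINT \<xi>:AV|lborel. (\<Sum>w\<in>W. chr \<kappa> (w \<xi>))) = (if \<kappa> = 0 then of_real (card W * measure lebesgue AV) else 0)"
proof (cases "\<kappa> = 0")
  case True
  then show ?thesis by (simp add: set_lebesgue_integral_def alcove_volume(2) scaleR_conv_of_real)
next
  case False
  have [measurable]: "chr \<kappa> \<in> borel_measurable borel"
    by (rule borel_measurable_continuous_onI) (intro continuous_intros)
  have i: "set_integrable lborel AV (\<lambda>\<xi>. chr \<kappa> (w \<xi>))" if "w \<in> W" for w
    by (rule set_integrable_alcove) (intro continuous_intros W_continuous that)
  have "(LINT \<xi>:AV|lborel. (\<Sum>w\<in>W. chr \<kappa> (w \<xi>))) = (\<Sum>w\<in>W. LINT \<xi>:AV|lborel. chr \<kappa> (w \<xi>))"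
    using i by (simp add: set_lebesgue_integral_def set_integrable_def scaleR_sum_right)
  also have "\<dots> = (\<Sum>w\<in>W. \<integral>\<xi>. indicator AV (inv w \<xi>) *\<^sub>R chr \<kappa> \<xi> \<partial>lborel)"
  proof (rule sum.cong)
    fix w assume w: "w \<in> W"
    have [measurable]: "inv w \<in> borel_measurable borel" using W_measurable[OF W_inv[OF w]] .
    show "(LINT \<xi>:AV|lborel. chr \<kappa> (w \<xi>)) = (\<integral>\<xi>. indicator AV (inv w \<xi>) *\<^sub>R chr \<kappa> \<xi> \<partial>lborel)"
      using integral_lborel_orthogonal[OF W_orthogonal[OF w], of "\<lambda>\<xi>. indicator AV (inv w \<xi>) *\<^sub>R chr \<kappa> \<xi>"] w
      by (simp add: set_lebesgue_integral_def)
  qed simp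
  also have "\<dots> = (\<Sum>w\<in>W. \<integral>\<xi>. indicator AV (w \<xi>) *\<^sub>R chr \<kappa> \<xi> \<partial>lborel)"
    by (rule sum_W_inv[of "\<lambda>w. \<integral>\<xi>. indicator AV (w \<xi>) *\<^sub>R chr \<kappa> \<xi> \<partial>lborel"])
  also have "\<dots> = (\<integral>\<xi>. (\<Sum>w\<in>W. indicator AV (w \<xi>) *\<^sub>R chr \<kappa> \<xi>) \<partial>lborel)"
  proof (rule Bochner_Integration.integral_sum[symmetric])
    fix w assume w: "w \<in> W"
    have [measurable]: "w \<in> borel_measurable borel" using W_measurable[OF w] .
    obtain r where r: "\<And>\<xi>. \<xi> \<in> AV \<Longrightarrow> norm \<xi> \<le> r" using alcove_bounded by blast
    show "integrable lborel (\<lambda>\<xi>. indicator AV (w \<xi>) *\<^sub>R chr \<kappa> \<xi>)"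
      by (rule integrable_lborel_bounded_support[of _ 1 r]) (use r W_norm[OF w] in \<open>force simp: indicator_def\<close>)+
  qed
  also have "\<dots> = (\<integral>\<xi>. chr \<kappa> \<xi> * complex_of_real (star \<xi>) \<partial>lborel)"
    by (rule Bochner_Integration.integral_cong)
       (auto simp: star_def scaleR_conv_of_real sum_distrib_left mult.commute)
  finally show ?thesis using integral_chr_star[OF \<kappa> False] False by simp
qed

end

section \<open>Weyl characters by triangularity\<close>

text \<open>The complex span of a possibly infinite family, grown by one term \<open>k * b\<close>
  at a time, so that linear facts become inductions whose only step is of the form
  \<open>f + k * b\<close>.\<close>

inductive_set cspan :: "(real^'n \<Rightarrow> complex) set \<Rightarrow> (real^'n \<Rightarrow> complex) set" for B where
  cspan_0: "(\<lambda>_. 0) \<in> cspan B"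
| cspan_step: "f \<in> cspan B \<Longrightarrow> b \<in> B \<Longrightarrow> (\<lambda>\<xi>. f \<xi> + k * b \<xi>) \<in> cspan B"

lemma cspan_linear_image:
  assumes f: "f \<in> cspan B"
    and 0: "\<Lambda> (\<lambda>_. 0) = (\<lambda>_. 0)"
    and lin: "\<And>f k b. \<Lambda> (\<lambda>\<xi>. f \<xi> + k * b \<xi>) = (\<lambda>\<xi>. \<Lambda> f \<xi> + k * \<Lambda> b \<xi>)"
  shows "\<Lambda> f \<in> cspan (\<Lambda> ` B)"
  using f
proof (induction rule: cspan.induct)
  case cspan_0 show ?case unfolding 0 by (rule cspan.cspan_0)
next
  case (cspan_step f b k)
  then show ?case unfolding lin by (intro cspan.cspan_step imageI)
qed

lemma cspan_add:
  assumes f: "f \<in> cspan B" and g: "g \<in> cspan B" shows "(\<lambda>\<xi>. f \<xi> + g \<xi>) \<in> cspan B"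
  using g
proof (induction rule: cspan.induct)
  case cspan_0 then show ?case using f by simp
next
  case (cspan_step g b k)
  then have "(\<lambda>\<xi>. (f \<xi> + g \<xi>) + k * b \<xi>) \<in> cspan B" by (intro cspan.cspan_step)
  then show ?case by (simp add: add.assoc)
qed

lemma cspan_cmult:
  assumes f: "f \<in> cspan B" shows "(\<lambda>\<xi>. c * f \<xi>) \<in> cspan B"
  using f
proof (induction rule: cspan.induct)
  case cspan_0 then show ?case using cspan.cspan_0 by simp
next
  case (cspan_step g b k)
  then have "(\<lambda>\<xi>. c * g \<xi> + (c * k) * b \<xi>) \<in> cspan B" by (intro cspan.cspan_step)
  then show ?case by (simp add: distrib_left mult.assoc)
qed

lemma cspan_base: "b \<in> B \<Longrightarrow> b \<in> cspan B"
  using cspan_step[OF cspan_0, of b B 1] by simp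

lemma cspan_sum:
  assumes "\<And>i. i \<in> I \<Longrightarrow> f i \<in> cspan B" shows "(\<lambda>\<xi>. \<Sum>i\<in>I. f i \<xi>) \<in> cspan B"
  using assms
proof (induction I rule: infinite_finite_induct)
  case (insert i I)
  then have "(\<lambda>\<xi>. f i \<xi> + (\<Sum>i\<in>I. f i \<xi>)) \<in> cspan B" by (intro cspan_add) auto
  then show ?case using insert(1,2) by simp
qed (use cspan_0 in auto)

lemma cspan_trans:
  assumes f: "f \<in> cspan B" and "\<And>b. b \<in> B \<Longrightarrow> b \<in> cspan C" shows "f \<in> cspan C"
  using f
proof (induction rule: cspan.induct)
  case cspan_0 show ?case by (rule cspan.cspan_0)
next
  case (cspan_step g b k)
  then show ?case using cspan_add[OF cspan_step(3) cspan_cmult[OF assms(2)[OF cspan_step(2)]]] by simp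
qed

lemma cspan_mono: "f \<in> cspan B \<Longrightarrow> B \<subseteq> C \<Longrightarrow> f \<in> cspan C"
  by (erule cspan_trans) (blast intro: cspan_base)

lemma cspan_mult:
  assumes f: "f \<in> cspan B" and g: "g \<in> cspan C"
    and m: "\<And>b c. b \<in> B \<Longrightarrow> c \<in> C \<Longrightarrow> (\<lambda>\<xi>. b \<xi> * c \<xi>) \<in> cspan D"
  shows "(\<lambda>\<xi>. f \<xi> * g \<xi>) \<in> cspan D"
proof -
  have 1: "(\<lambda>\<xi>. f \<xi> * g \<xi>) \<in> cspan ((\<lambda>b \<xi>. b \<xi> * g \<xi>) ` B)"
    using cspan_linear_image[OF f, of "\<lambda>b \<xi>. b \<xi> * g \<xi>"] by (simp add: distrib_right mult.assoc)
  have "(\<lambda>\<xi>. b \<xi> * g \<xi>) \<in> cspan D" if b: "b \<in> B" for b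
  proof (rule cspan_trans)
    show "(\<lambda>\<xi>. b \<xi> * g \<xi>) \<in> cspan ((\<lambda>c \<xi>. b \<xi> * c \<xi>) ` C)"
      using cspan_linear_image[OF g, of "\<lambda>c \<xi>. b \<xi> * c \<xi>"] by (simp add: distrib_left mult.left_commute)
  qed (use m b in auto)
  then show ?thesis using cspan_trans[OF 1] by blast
qed

lemma cspan_insert:
  assumes "f \<in> cspan (insert b B)" shows "\<exists>k. (\<lambda>\<xi>. f \<xi> - k * b \<xi>) \<in> cspan B"
  using assms
proof (induction rule: cspan.induct)
  case cspan_0 then show ?case using cspan.cspan_0 by (intro exI[of _ 0]) simp
next
  case (cspan_step f b' l)
  then obtain k where k: "(\<lambda>\<xi>. f \<xi> - k * b \<xi>) \<in> cspan B" by blast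
  show ?case
  proof (cases "b' = b")
    case True
    then show ?thesis using k by (intro exI[of _ "k + l"]) (simp add: algebra_simps)
  next
    case False
    then have "(\<lambda>\<xi>. (f \<xi> - k * b \<xi>) + l * b' \<xi>) \<in> cspan B" using k cspan_step by (intro cspan.cspan_step) auto
    then show ?thesis by (intro exI[of _ k]) (simp add: algebra_simps)
  qed
qed

lemma continuous_cspan:
  assumes "f \<in> cspan B" "\<And>b. b \<in> B \<Longrightarrow> continuous_on UNIV b" shows "continuous_on UNIV f"
  using assms(1)
proof (induction rule: cspan.induct)
  case (cspan_step f b k)
  then have "continuous_on UNIV b" by (intro assms(2))
  then show ?case using cspan_step(3) by (intro continuous_intros)
qed simp

lemma continuous_chr': "continuous_on S (chr a)"
  by (intro continuous_intros)

section \<open>Leading exponents and Fourier coefficients\<close>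

context root_system
begin

lemma sum_W_comp_left:
  assumes "u \<in> W" shows "(\<Sum>w\<in>W. f (u \<circ> w)) = (\<Sum>w\<in>W. f w)"
proof (rule sum.reindex_bij_witness[of _ "\<lambda>w. inv u \<circ> w" "\<lambda>w. u \<circ> w"])
  fix a assume "a \<in> W"
  show "inv u \<circ> (u \<circ> a) = a" "u \<circ> (inv u \<circ> a) = a" using W_inv_apply[OF assms] by (auto simp: fun_eq_iff)
  show "u \<circ> a \<in> W" "inv u \<circ> a \<in> W" using W_comp assms W_inv \<open>a \<in> W\<close> by blast+
qed simp

text \<open>\<open>d\<close> bounds the drop below \<kappa> in each coroot direction. This is the
  quantity that is later compared with \<open>mmin\<close> to keep exponents dominant.\<close>

definition low :: "real \<Rightarrow> real^'n \<Rightarrow> (real^'n \<Rightarrow> complex) set" where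
  "low d \<kappa> = {chr \<theta> | \<theta>. \<kappa> - \<theta> \<in> poscone Rp \<and> \<theta> \<noteq> \<kappa> \<and> (\<forall>\<beta>\<in>Rp. \<bar>(\<kappa> - \<theta>) \<bullet> coroot \<beta>\<bar> \<le> d)}"

text \<open>\<open>f\<close> has leading term \<open>q\<close> times the character at \<open>\<kappa>\<close>, the remaining exponents being
  strictly dominated by \<open>\<kappa>\<close> and within distance \<open>d\<close> of it when measured by coroots.\<close>

definition lead :: "real \<Rightarrow> real^'n \<Rightarrow> (real^'n \<Rightarrow> complex) \<Rightarrow> complex \<Rightarrow> bool" where
  "lead d \<kappa> f q \<longleftrightarrow> (\<lambda>\<xi>. f \<xi> - q * chr \<kappa> \<xi>) \<in> cspan (low d \<kappa>)"

lemma poscone_strict_add: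
  assumes "x \<in> poscone Rp" "y \<in> poscone Rp" "x \<noteq> 0" shows "x + y \<noteq> 0"
proof
  assume "x + y = 0"
  then have "x \<bullet> v + y \<bullet> v = 0" by (metis inner_add_left inner_zero_left)
  then show False using poscone_nonneg[OF assms(2)] poscone_eq_0[OF assms(1)] assms(3) by linarith
qed

lemma lead_chr: "lead d \<kappa> (chr \<kappa>) 1"
  unfolding lead_def using cspan_0 by simp

text \<open>By antisymmetry of dominance a product of two exponents reaches
  \<open>\<kappa> + \<mu>\<close> only when both are leading. The drops in the coroot directions add
  up.\<close>

lemma lead_mult:
  assumes f: "lead d \<kappa> f q" and g: "lead e \<mu> g r" and de: "d \<ge> 0" "e \<ge> 0"
  shows "lead (d + e) (\<kappa> + \<mu>) (\<lambda>\<xi>. f \<xi> * g \<xi>) (q * r)"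
proof -
  define f0 where "f0 \<xi> = f \<xi> - q * chr \<kappa> \<xi>" for \<xi>
  define g0 where "g0 \<xi> = g \<xi> - r * chr \<mu> \<xi>" for \<xi>
  have f0: "f0 \<in> cspan (low d \<kappa>)" and g0: "g0 \<in> cspan (low e \<mu>)"
    using f g unfolding lead_def f0_def g0_def .
  let ?C = "low (d + e) (\<kappa> + \<mu>)"
  have prod: "(\<lambda>\<xi>. chr a \<xi> * chr b \<xi>) \<in> cspan ?C"
    if "\<kappa> - a \<in> poscone Rp" "\<mu> - b \<in> poscone Rp" "a \<noteq> \<kappa> \<or> b \<noteq> \<mu>"
      "\<forall>\<beta>\<in>Rp. \<bar>(\<kappa> - a) \<bullet> coroot \<beta>\<bar> \<le> d" "\<forall>\<beta>\<in>Rp. \<bar>(\<mu> - b) \<bullet> coroot \<beta>\<bar> \<le> e" for a b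
  proof -
    have eq: "(\<kappa> + \<mu>) - (a + b) = (\<kappa> - a) + (\<mu> - b)" by simp
    have "(\<kappa> - a) + (\<mu> - b) \<noteq> 0"
      using poscone_strict_add[OF that(1,2)] poscone_strict_add[OF that(2,1)] that(3) by (auto simp: add.commute)
    then have ne: "a + b \<noteq> \<kappa> + \<mu>" unfolding eq[symmetric] by auto
    have "\<bar>((\<kappa> - a) + (\<mu> - b)) \<bullet> coroot \<beta>\<bar> \<le> d + e" if "\<beta> \<in> Rp" for \<beta>
      using that \<open>\<forall>\<beta>\<in>Rp. \<bar>(\<kappa> - a) \<bullet> coroot \<beta>\<bar> \<le> d\<close> \<open>\<forall>\<beta>\<in>Rp. \<bar>(\<mu> - b) \<bullet> coroot \<beta>\<bar> \<le> e\<close>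
      unfolding inner_add_left by (meson abs_triangle_ineq add_mono order_trans)
    then have "chr (a + b) \<in> ?C"
      unfolding low_def using ne poscone_add[OF that(1,2)] by (auto simp only: eq)
    moreover have "(\<lambda>\<xi>. chr a \<xi> * chr b \<xi>) = chr (a + b)" by (simp add: fun_eq_iff chr_add)
    ultimately show ?thesis using cspan_base by metis
  qed
  have 1: "(\<lambda>\<xi>. chr \<kappa> \<xi> * g0 \<xi>) \<in> cspan ?C"
  proof (rule cspan_mult[OF cspan_base[of "chr \<kappa>" "{chr \<kappa>}"] g0])
    fix b c assume "b \<in> {chr \<kappa>}" "c \<in> low e \<mu>"
    then show "(\<lambda>\<xi>. b \<xi> * c \<xi>) \<in> cspan ?C"
      unfolding low_def[of e] using prod[of \<kappa>] de by auto
  qed simp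
  have 2: "(\<lambda>\<xi>. f0 \<xi> * chr \<mu> \<xi>) \<in> cspan ?C"
  proof (rule cspan_mult[OF f0 cspan_base[of "chr \<mu>" "{chr \<mu>}"]])
    fix b c assume "b \<in> low d \<kappa>" "c \<in> {chr \<mu>}"
    then show "(\<lambda>\<xi>. b \<xi> * c \<xi>) \<in> cspan ?C"
      unfolding low_def[of d] using prod[of _ \<mu>] de by auto
  qed simp
  have 3: "(\<lambda>\<xi>. f0 \<xi> * g0 \<xi>) \<in> cspan ?C"
  proof (rule cspan_mult[OF f0 g0])
    fix b c assume "b \<in> low d \<kappa>" "c \<in> low e \<mu>"
    then show "(\<lambda>\<xi>. b \<xi> * c \<xi>) \<in> cspan ?C"
      unfolding low_def[of d] low_def[of e] using prod by auto
  qed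
  have "(\<lambda>\<xi>. (q * (chr \<kappa> \<xi> * g0 \<xi>) + r * (f0 \<xi> * chr \<mu> \<xi>)) + f0 \<xi> * g0 \<xi>) \<in> cspan ?C"
    by (intro cspan_add cspan_cmult 1 2 3)
  moreover have "(q * (chr \<kappa> \<xi> * g0 \<xi>) + r * (f0 \<xi> * chr \<mu> \<xi>)) + f0 \<xi> * g0 \<xi> = f \<xi> * g \<xi> - q * r * chr (\<kappa> + \<mu>) \<xi>" for \<xi>
    by (simp add: f0_def g0_def chr_add algebra_simps)
  ultimately show ?thesis unfolding lead_def by simp
qed

lemma lead_prod:
  assumes "finite I" "\<And>i. i \<in> I \<Longrightarrow> lead (d i) (\<kappa> i) (f i) (q i)" "\<And>i. i \<in> I \<Longrightarrow> d i \<ge> 0"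
  shows "lead (\<Sum>i\<in>I. d i) (\<Sum>i\<in>I. \<kappa> i) (\<lambda>\<xi>. \<Prod>i\<in>I. f i \<xi>) (\<Prod>i\<in>I. q i)"
  using assms
proof (induction I rule: finite_induct)
  case empty
  then show ?case unfolding lead_def using cspan_0 by simp
next
  case (insert i I)
  have "lead (d i + (\<Sum>i\<in>I. d i)) (\<kappa> i + (\<Sum>i\<in>I. \<kappa> i)) (\<lambda>\<xi>. f i \<xi> * (\<Prod>i\<in>I. f i \<xi>)) (q i * (\<Prod>i\<in>I. q i))"
    by (intro lead_mult insert sum_nonneg) (auto intro: insert)
  then show ?case using insert(1,2) by simp
qed

lemma lead_sum_chr:
  assumes "finite I" "J \<subseteq> I" "\<And>i. i \<in> J \<Longrightarrow> \<theta> i = \<kappa>"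
    "\<And>i. i \<in> I - J \<Longrightarrow> \<kappa> - \<theta> i \<in> poscone Rp \<and> \<theta> i \<noteq> \<kappa> \<and> (\<forall>\<beta>\<in>Rp. \<bar>(\<kappa> - \<theta> i) \<bullet> coroot \<beta>\<bar> \<le> d)"
  shows "lead d \<kappa> (\<lambda>\<xi>. \<Sum>i\<in>I. a i * chr (\<theta> i) \<xi>) (\<Sum>i\<in>J. a i)"
proof -
  have "(\<lambda>\<xi>. \<Sum>i\<in>I - J. a i * chr (\<theta> i) \<xi>) \<in> cspan (low d \<kappa>)"
    by (intro cspan_sum cspan_cmult cspan_base) (use assms(4) in \<open>auto simp: low_def\<close>)
  moreover have "(\<Sum>i\<in>I. a i * chr (\<theta> i) \<xi>) - (\<Sum>i\<in>J. a i) * chr \<kappa> \<xi> = (\<Sum>i\<in>I - J. a i * chr (\<theta> i) \<xi>)" for \<xi>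
    using sum.subset_diff[OF assms(2,1), of "\<lambda>i. a i * chr (\<theta> i) \<xi>"] assms(3) by (simp add: sum_distrib_right)
  ultimately show ?thesis unfolding lead_def by simp
qed

lemma lead_continuous: "lead d \<kappa> f q \<Longrightarrow> continuous_on UNIV f"
proof -
  assume "lead d \<kappa> f q"
  then have "continuous_on UNIV (\<lambda>\<xi>. f \<xi> - q * chr \<kappa> \<xi>)"
    unfolding lead_def by (rule continuous_cspan) (auto simp: low_def continuous_chr')
  then have "continuous_on UNIV (\<lambda>\<xi>. (f \<xi> - q * chr \<kappa> \<xi>) + q * chr \<kappa> \<xi>)"
    by (rule continuous_on_add) (intro continuous_intros)
  then show ?thesis by simp
qed

text \<open>For functions with weight exponents this is the constant Fourier coefficient, that is
  the mean over the torus modulo \<open>lattice\<close>, computed by symmetrizing over the Weyl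
  group and integrating over the alcove.\<close>

definition torus_mean :: "(real^'n \<Rightarrow> complex) \<Rightarrow> complex" where
  "torus_mean f = (LINT \<xi>:AV|lborel. (\<Sum>w\<in>W. f (w \<xi>))) / of_real (card W * measure lebesgue AV)"

lemma continuous_sum_W: "continuous_on UNIV (f :: real^'n \<Rightarrow> complex) \<Longrightarrow> continuous_on UNIV (\<lambda>\<xi>. \<Sum>w\<in>W. f (w \<xi>))"
  by (rule continuous_on_sum, rule continuous_on_compose2[of UNIV f], assumption, rule W_continuous, assumption, simp)

lemma torus_mean_add_cmult:
  assumes "continuous_on UNIV f" "continuous_on UNIV b"
  shows "torus_mean (\<lambda>\<xi>. f \<xi> + k * b \<xi>) = torus_mean f + k * torus_mean b"
proof -
  have i: "set_integrable lborel AV (\<lambda>\<xi>. \<Sum>w\<in>W. f (w \<xi>))" "set_integrable lborel AV (\<lambda>\<xi>. \<Sum>w\<in>W. b (w \<xi>))"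
    by (intro set_integrable_alcove continuous_sum_W assms)+
  have "(LINT \<xi>:AV|lborel. (\<Sum>w\<in>W. f (w \<xi>) + k * b (w \<xi>)))
      = (LINT \<xi>:AV|lborel. (\<Sum>w\<in>W. f (w \<xi>)) + k * (\<Sum>w\<in>W. b (w \<xi>)))"
    by (simp add: sum.distrib sum_distrib_left)
  also have "\<dots> = (LINT \<xi>:AV|lborel. (\<Sum>w\<in>W. f (w \<xi>))) + k * (LINT \<xi>:AV|lborel. (\<Sum>w\<in>W. b (w \<xi>)))"
    using i by (subst set_integral_add) auto
  finally show ?thesis by (simp add: torus_mean_def add_divide_distrib)
qed

lemma torus_mean_0: "torus_mean (\<lambda>_. 0) = 0"
  by (simp add: torus_mean_def)

lemma torus_mean_chr: "weight \<kappa> \<Longrightarrow> torus_mean (chr \<kappa>) = (if \<kappa> = 0 then 1 else 0)"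
  using alcove_volume W_nonempty by (simp add: torus_mean_def fourier_alcove)

lemma torus_mean_cspan:
  assumes "f \<in> cspan B" "\<And>b. b \<in> B \<Longrightarrow> continuous_on UNIV b" "\<And>b. b \<in> B \<Longrightarrow> torus_mean b = 0"
  shows "torus_mean f = 0"
  using assms(1)
proof (induction rule: cspan.induct)
  case cspan_0 show ?case by (rule torus_mean_0)
next
  case (cspan_step f b k)
  have "torus_mean (\<lambda>\<xi>. f \<xi> + k * b \<xi>) = torus_mean f + k * torus_mean b"
    by (rule torus_mean_add_cmult) (use continuous_cspan assms cspan_step in blast)+
  then show ?case using cspan_step assms by simp
qed

text \<open>An exponent 0 among the strictly lower terms would make \<kappa> a nonzero element of
  the cone. Both alternatives in the last hypothesis exclude this, so only the leading term can
  contribute.\<close>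

lemma torus_mean_lead:
  assumes l: "lead d \<kappa> f q" and w: "weight \<kappa>" and z: "\<kappa> = 0 \<or> \<kappa> \<notin> poscone Rp"
  shows "torus_mean f = (if \<kappa> = 0 then q else 0)"
proof -
  have c: "continuous_on UNIV (\<lambda>\<xi>. f \<xi> - q * chr \<kappa> \<xi>)"
    using l unfolding lead_def by (rule continuous_cspan) (auto simp: low_def continuous_chr')
  have "torus_mean (\<lambda>\<xi>. f \<xi> - q * chr \<kappa> \<xi>) = 0"
    using l unfolding lead_def
  proof (rule torus_mean_cspan)
    fix b assume "b \<in> low d \<kappa>"
    then obtain \<theta> where t: "b = chr \<theta>" "\<kappa> - \<theta> \<in> poscone Rp" "\<theta> \<noteq> \<kappa>" by (auto simp: low_def)
    have "weight \<theta>" using weight_diff[OF w weight_poscone[OF t(2)]] by simp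
    moreover have "\<theta> \<noteq> 0" using t z by auto
    ultimately show "torus_mean b = 0" by (simp add: t torus_mean_chr)
  qed (auto simp: low_def continuous_chr')
  moreover have "torus_mean (\<lambda>\<xi>. (f \<xi> - q * chr \<kappa> \<xi>) + q * chr \<kappa> \<xi>) = torus_mean (\<lambda>\<xi>. f \<xi> - q * chr \<kappa> \<xi>) + q * torus_mean (chr \<kappa>)"
    by (rule torus_mean_add_cmult[OF c continuous_chr'])
  ultimately show ?thesis using torus_mean_chr[OF w] by simp
qed

section \<open>Leading terms of \<open>delta\<close> and of the monomial symmetric functions\<close>

lemma delta_factor: "exp (\<i> * complex_of_real (\<alpha> \<bullet> \<xi>) / 2) - exp (- \<i> * complex_of_real (\<alpha> \<bullet> \<xi>) / 2)
    = chr ((1/2) *\<^sub>R \<alpha>) \<xi> - chr (- ((1/2) *\<^sub>R \<alpha>)) \<xi>"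
  by (simp add: chr_def)

lemma delta_chr: "delta R Rp \<xi> = (\<Prod>\<alpha>\<in>roots0 R \<inter> Rp. chr ((1/2) *\<^sub>R \<alpha>) \<xi> - chr (- ((1/2) *\<^sub>R \<alpha>)) \<xi>)"
  unfolding delta_def delta_factor ..

definition cobound :: real where
  "cobound = (\<Sum>\<alpha>\<in>Rp. \<Sum>\<beta>\<in>Rp. \<bar>\<alpha> \<bullet> coroot \<beta>\<bar>)"

lemma cobound: "\<alpha> \<in> Rp \<Longrightarrow> \<beta> \<in> Rp \<Longrightarrow> \<bar>\<alpha> \<bullet> coroot \<beta>\<bar> \<le> cobound"
proof -
  assume "\<alpha> \<in> Rp" "\<beta> \<in> Rp"
  then have "\<bar>\<alpha> \<bullet> coroot \<beta>\<bar> \<le> (\<Sum>\<beta>\<in>Rp. \<bar>\<alpha> \<bullet> coroot \<beta>\<bar>)" by (intro member_le_sum) auto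
  also have "\<dots> \<le> cobound"
    unfolding cobound_def using \<open>\<alpha> \<in> Rp\<close> by (intro member_le_sum) (auto intro: sum_nonneg)
  finally show ?thesis .
qed

lemma cobound_nonneg: "cobound \<ge> 0"
  unfolding cobound_def by (intro sum_nonneg) auto

text \<open>In each factor the second exponent lies below the first by the root itself, and the
  first exponents add up to \<rho>.\<close>

lemma lead_delta: "\<exists>d\<ge>0. lead d (rho R Rp) (delta R Rp) 1"
proof -
  have "lead cobound ((1/2) *\<^sub>R \<alpha>) (\<lambda>\<xi>. chr ((1/2) *\<^sub>R \<alpha>) \<xi> - chr (- ((1/2) *\<^sub>R \<alpha>)) \<xi>) 1"
    if a: "\<alpha> \<in> roots0 R \<inter> Rp" for \<alpha>
  proof -
    have e: "(1/2) *\<^sub>R \<alpha> - - ((1/2) *\<^sub>R \<alpha>) = \<alpha>" by (simp flip: scaleR_left_distrib)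
    then have "chr (- ((1/2) *\<^sub>R \<alpha>)) \<in> low cobound ((1/2) *\<^sub>R \<alpha>)"
      unfolding low_def using a R_nz Rp_R by (auto intro!: exI[of _ "- ((1/2) *\<^sub>R \<alpha>)"] poscone_base cobound simp: e)
    then have "(\<lambda>\<xi>. -1 * chr (- ((1/2) *\<^sub>R \<alpha>)) \<xi>) \<in> cspan (low cobound ((1/2) *\<^sub>R \<alpha>))"
      by (intro cspan_cmult cspan_base)
    then show ?thesis unfolding lead_def by simp
  qed
  then have "lead (\<Sum>\<alpha>\<in>roots0 R \<inter> Rp. cobound) (\<Sum>\<alpha>\<in>roots0 R \<inter> Rp. (1/2) *\<^sub>R \<alpha>) (delta R Rp) (\<Prod>\<alpha>\<in>roots0 R \<inter> Rp. 1)"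
    unfolding delta_chr[abs_def] by (intro lead_prod) (auto simp: cobound_nonneg)
  then show ?thesis using cobound_nonneg
    by (auto simp: rho_def scaleR_sum_right intro!: exI[of _ "\<Sum>\<alpha>\<in>roots0 R \<inter> Rp. cobound"])
qed

lemma msym_chr: "msym R \<mu> \<xi> = (\<Sum>w\<in>W. (1 / of_nat (card (stabilizer R \<mu>))) * chr (w \<mu>) \<xi>)"
proof -
  have "(\<Sum>w\<in>W. chr \<mu> (w \<xi>)) = (\<Sum>w\<in>W. chr (inv w \<mu>) \<xi>)"
    by (intro sum.cong) (simp_all add: chr_W)
  also have "\<dots> = (\<Sum>w\<in>W. chr (w \<mu>) \<xi>)" by (rule sum_W_inv[of "\<lambda>w. chr (w \<mu>) \<xi>"])
  finally show ?thesis by (simp add: msym_def chr_def sum_distrib_left)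
qed

lemma dominant_dominance_W: "\<mu> \<in> dominant_weights Rp \<Longrightarrow> w \<in> W \<Longrightarrow> \<mu> - w \<mu> \<in> poscone Rp"
  by (rule dominance_W) (auto intro: dominant_weights_D simple_Rp)

lemma orbit_bound:
  assumes "w \<in> W" "\<beta> \<in> Rp"
  shows "\<bar>(\<mu> - w \<mu>) \<bullet> coroot \<beta>\<bar> \<le> (\<Sum>w\<in>W. \<Sum>\<beta>\<in>Rp. \<bar>(\<mu> - w \<mu>) \<bullet> coroot \<beta>\<bar>)"
proof -
  have "\<bar>(\<mu> - w \<mu>) \<bullet> coroot \<beta>\<bar> \<le> (\<Sum>\<beta>\<in>Rp. \<bar>(\<mu> - w \<mu>) \<bullet> coroot \<beta>\<bar>)" using assms by (intro member_le_sum) auto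
  also have "\<dots> \<le> (\<Sum>w\<in>W. \<Sum>\<beta>\<in>Rp. \<bar>(\<mu> - w \<mu>) \<bullet> coroot \<beta>\<bar>)"
    using assms finite_W by (intro member_le_sum[of w W "\<lambda>w. \<Sum>\<beta>\<in>Rp. \<bar>(\<mu> - w \<mu>) \<bullet> coroot \<beta>\<bar>"]) (auto intro: sum_nonneg)
  finally show ?thesis .
qed

text \<open>The exponent \<mu> arises once for each element of the stabilizer, and the normalization
  divides by their number.\<close>

lemma lead_msym:
  assumes \<mu>: "\<mu> \<in> dominant_weights Rp" shows "\<exists>d\<ge>0. lead d \<mu> (msym R \<mu>) 1"
proof -
  let ?d = "\<Sum>w\<in>W. \<Sum>\<beta>\<in>Rp. \<bar>(\<mu> - w \<mu>) \<bullet> coroot \<beta>\<bar>"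
  have sub: "stabilizer R \<mu> \<subseteq> W" by (auto simp: stabilizer_def)
  have "id \<in> stabilizer R \<mu>" unfolding stabilizer_def using weyl_group.wg_id by (metis (mono_tags, lifting) CollectI id_apply)
  then have nz: "card (stabilizer R \<mu>) \<noteq> 0" using finite_subset[OF sub finite_W] by (metis card_0_eq empty_iff)
  have "lead ?d \<mu> (\<lambda>\<xi>. \<Sum>w\<in>W. (1 / of_nat (card (stabilizer R \<mu>))) * chr (w \<mu>) \<xi>)
      (\<Sum>w\<in>stabilizer R \<mu>. 1 / of_nat (card (stabilizer R \<mu>)))"
    by (rule lead_sum_chr)
       (use finite_W sub dominant_dominance_W[OF \<mu>] orbit_bound in \<open>auto simp: stabilizer_def\<close>)
  moreover have "(\<Sum>w\<in>stabilizer R \<mu>. 1 / of_nat (card (stabilizer R \<mu>))) = (1 :: complex)" using nz by simp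
  moreover have "?d \<ge> 0" by (intro sum_nonneg) auto
  ultimately show ?thesis unfolding msym_chr[abs_def] by metis
qed

section \<open>Antisymmetrization\<close>

lemma msym_W: "w \<in> W \<Longrightarrow> msym R \<mu> (w \<xi>) = msym R \<mu> \<xi>"
  unfolding msym_def using sum_W_comp_right[of w "\<lambda>u. exp (\<i> * complex_of_real (\<mu> \<bullet> u \<xi>))"]
  by (simp add: o_def)

text \<open>Left unnormalized: on an antisymmetric function it is multiplication by
  \<open>card W\<close>.\<close>

definition alternant :: "(real^'n \<Rightarrow> complex) \<Rightarrow> real^'n \<Rightarrow> complex" where
  "alternant f \<xi> = (\<Sum>w\<in>W. complex_of_real (wsign w) * f (w \<xi>))"

lemma alternant_0: "alternant (\<lambda>_. 0) = (\<lambda>_. 0)"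
  by (simp add: alternant_def fun_eq_iff)

lemma alternant_lin: "alternant (\<lambda>\<xi>. f \<xi> + k * b \<xi>) = (\<lambda>\<xi>. alternant f \<xi> + k * alternant b \<xi>)"
  by (simp add: alternant_def fun_eq_iff sum.distrib sum_distrib_left algebra_simps)

lemma alternant_cspan: "f \<in> cspan B \<Longrightarrow> alternant f \<in> cspan (alternant ` B)"
  by (rule cspan_linear_image[OF _ alternant_0 alternant_lin])

lemma continuous_alternant: "continuous_on UNIV f \<Longrightarrow> continuous_on UNIV (alternant f)"
  unfolding alternant_def[abs_def]
  by (rule continuous_on_sum, rule continuous_on_mult_left, rule continuous_on_compose2[of UNIV f])
     (auto intro: W_continuous)

lemma alternant_chr_W:
  assumes u: "u \<in> W" shows "alternant (chr (u \<theta>)) = (\<lambda>\<xi>. complex_of_real (wsign u) * alternant (chr \<theta>) \<xi>)"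
proof
  fix \<xi>
  have "alternant (chr (u \<theta>)) \<xi> = (\<Sum>w\<in>W. complex_of_real (wsign (u \<circ> w)) * chr (u \<theta>) ((u \<circ> w) \<xi>))"
    unfolding alternant_def by (rule sum_W_comp_left[OF u, symmetric])
  also have "\<dots> = (\<Sum>w\<in>W. complex_of_real (wsign u) * (complex_of_real (wsign w) * chr \<theta> (w \<xi>)))"
  proof (rule sum.cong)
    fix w assume w: "w \<in> W"
    have "chr (u \<theta>) ((u \<circ> w) \<xi>) = chr \<theta> (w \<xi>)" using W_inner[OF u] by (simp add: chr_def)
    then show "complex_of_real (wsign (u \<circ> w)) * chr (u \<theta>) ((u \<circ> w) \<xi>) = complex_of_real (wsign u) * (complex_of_real (wsign w) * chr \<theta> (w \<xi>))"
      using wsign_comp[OF u w] by (metis (no_types, lifting) mult.assoc of_real_mult)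
  qed simp
  finally show "alternant (chr (u \<theta>)) \<xi> = complex_of_real (wsign u) * alternant (chr \<theta>) \<xi>"
    by (simp add: alternant_def sum_distrib_left)
qed

text \<open>The reflection in \<alpha> fixes \<theta> and has sign -1, so the alternating sum equals
  its own negative.\<close>

lemma alternant_chr_singular:
  assumes "\<alpha> \<in> R" "\<theta> \<bullet> coroot \<alpha> = 0" shows "alternant (chr \<theta>) = (\<lambda>_. 0)"
proof -
  have "rrefl \<alpha> \<theta> = \<theta>" using assms by (simp add: rrefl_def)
  then have "alternant (chr \<theta>) = (\<lambda>\<xi>. complex_of_real (wsign (rrefl \<alpha>)) * alternant (chr \<theta>) \<xi>)"
    using alternant_chr_W[OF W_rrefl[OF assms(1)], of \<theta>] by simp
  then have "alternant (chr \<theta>) \<xi> = - alternant (chr \<theta>) \<xi>" for \<xi>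
    using wsign_rrefl[OF R_nz[OF assms(1)]] by (metis (no_types, lifting) mult_minus1 of_real_1 of_real_minus)
  then show ?thesis by (simp add: fun_eq_iff)
qed

lemma delta_simple:
  assumes g: "simple \<gamma>" shows "delta R Rp (rrefl \<gamma> \<xi>) = - delta R Rp \<xi>"
proof -
  let ?X = "roots0 R \<inter> Rp"
  define h where "h \<alpha> = chr ((1/2) *\<^sub>R \<alpha>) \<xi> - chr (- ((1/2) *\<^sub>R \<alpha>)) \<xi>" for \<alpha>
  have s: "srep \<gamma> \<in> ?X" using srep_roots0[OF g] .
  have hh: "chr ((1/2) *\<^sub>R \<alpha>) (rrefl \<gamma> \<xi>) - chr (- ((1/2) *\<^sub>R \<alpha>)) (rrefl \<gamma> \<xi>) = h (rrefl \<gamma> \<alpha>)" for \<alpha>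
    unfolding h_def chr_def inner_rrefl_swap[symmetric] linear_neg[OF linear_rrefl] linear_cmul[OF linear_rrefl] ..
  have neg: "rrefl \<gamma> (srep \<gamma>) = - srep \<gamma>"
    using srep_multiple[of \<gamma>] rrefl_self[OF R_nz[OF simple_R[OF g]]] by (auto simp: linear_cmul[OF linear_rrefl])
  have "delta R Rp (rrefl \<gamma> \<xi>) = (\<Prod>\<alpha>\<in>?X. h (rrefl \<gamma> \<alpha>))" unfolding delta_chr hh ..
  also have "\<dots> = h (rrefl \<gamma> (srep \<gamma>)) * (\<Prod>\<alpha>\<in>?X - {srep \<gamma>}. h (rrefl \<gamma> \<alpha>))"
    by (rule prod.remove) (use s in auto)
  also have "(\<Prod>\<alpha>\<in>?X - {srep \<gamma>}. h (rrefl \<gamma> \<alpha>)) = (\<Prod>\<alpha>\<in>?X - {srep \<gamma>}. h \<alpha>)"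
    by (rule prod.reindex_bij_betw[OF simple_permutes_roots0[OF g]])
  also have "h (rrefl \<gamma> (srep \<gamma>)) = - h (srep \<gamma>)" unfolding neg by (simp add: h_def)
  also have "- h (srep \<gamma>) * (\<Prod>\<alpha>\<in>?X - {srep \<gamma>}. h \<alpha>) = - (\<Prod>\<alpha>\<in>?X. h \<alpha>)"
    using prod.remove[of ?X "srep \<gamma>" h] s by simp
  finally show ?thesis unfolding delta_chr h_def .
qed

lemma delta_W: "w \<in> W \<Longrightarrow> delta R Rp (w \<xi>) = complex_of_real (wsign w) * delta R Rp \<xi>"
proof (induction arbitrary: \<xi> rule: W_simple_induct)
  case id show ?case by (metis id_apply mult_1 of_real_1 wsign_id)
next
  case (step w \<gamma>)
  have "wsign (w \<circ> rrefl \<gamma>) = - wsign w"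
    using wsign_comp[OF step(1) W_rrefl[OF simple_R[OF step(2)]]] wsign_rrefl[OF R_nz[OF simple_R[OF step(2)]]]
    by (metis mult_minus1_right)
  then show ?case using step.IH delta_simple[OF step(2)]
    by (metis (no_types, lifting) comp_apply minus_mult_commute of_real_minus)
qed

section \<open>Weyl orbits of the exponents of \<open>delta\<close>\<close>

lemma half_diff: "(1/2) *\<^sub>R (s - x + - x) = (1/2) *\<^sub>R s - (x :: real^'n)"
  by (simp add: vec_eq_iff field_simps)

lemma half_sum_diff: "- ((1/2) *\<^sub>R x) + (1/2) *\<^sub>R (s - x) = (1/2) *\<^sub>R s - (x :: real^'n)"
  by (simp add: vec_eq_iff field_simps)

text \<open>\<open>N\<close> picks one root from each opposite pair. Half of its sum falls short of
  \<rho> by the sum of the positive roots that were passed over.\<close>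

lemma rho_minus_choice:
  assumes N: "N \<subseteq> roots0 R" "\<And>\<alpha>. \<alpha> \<in> roots0 R \<Longrightarrow> \<alpha> \<in> N \<longleftrightarrow> - \<alpha> \<notin> N"
  shows "rho R Rp - (1/2) *\<^sub>R \<Sum>N \<in> poscone Rp"
proof -
  let ?X = "roots0 R \<inter> Rp"
  have fN: "finite N" using N(1) roots_finite(1) by (rule finite_subset)
  have mR: "- \<alpha> \<in> roots0 R" if "\<alpha> \<in> roots0 R" for \<alpha>
    using that minus_R minus_R[of "- (2 *\<^sub>R \<alpha>)"] by (auto simp: roots0_def)
  have "bij_betw uminus (N - Rp) (?X - N)"
  proof (rule bij_betw_byWitness[where f' = uminus])
    show "uminus ` (N - Rp) \<subseteq> ?X - N"
      using N mR R_cases by (fastforce simp: roots0_def)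
    show "uminus ` (?X - N) \<subseteq> N - Rp"
      using N mR Rp_not_minus by auto
  qed auto
  then have "\<Sum>(N - Rp) = (\<Sum>\<alpha>\<in>?X - N. - \<alpha>)"
    using sum.reindex_bij_betw[of uminus "N - Rp" "?X - N" uminus] by simp
  moreover have "\<Sum>N = \<Sum>(?X \<inter> N) + \<Sum>(N - Rp)"
  proof -
    have "?X \<inter> N = N \<inter> Rp" using N(1) by blast
    then show ?thesis using sum.Int_Diff[OF fN, of "\<lambda>x. x" Rp] by simp
  qed
  moreover have "\<Sum>?X = \<Sum>(?X \<inter> N) + \<Sum>(?X - N)" using sum.Int_Diff[of ?X "\<lambda>x. x" N] by simp
  ultimately have "\<Sum>?X - \<Sum>N = 2 *\<^sub>R \<Sum>(?X - N)" by (simp add: sum_negf scaleR_2)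
  then have "rho R Rp - (1/2) *\<^sub>R \<Sum>N = \<Sum>(?X - N)"
    unfolding rho_def by (simp flip: scaleR_diff_right)
  also have "\<dots> \<in> poscone Rp" by (intro poscone_sum poscone_base) auto
  finally show ?thesis .
qed

text \<open>Subtracting the roots of \<open>X\<close> from \<rho> flips their signs in the half sum,
  which is thus taken over a choice of one root from each opposite pair. The Weyl group maps such
  choices to such choices.\<close>

lemma rho_minus_sum_W:
  assumes X: "X \<subseteq> roots0 R \<inter> Rp" and w: "w \<in> W"
  shows "rho R Rp - w (rho R Rp - \<Sum>X) \<in> poscone Rp"
proof -
  let ?X = "roots0 R \<inter> Rp"
  define N where "N = (?X - X) \<union> uminus ` X"
  have fX: "finite X" using X roots_finite(1) by (meson finite_Int finite_subset)
  have mR: "- \<alpha> \<in> roots0 R" if "\<alpha> \<in> roots0 R" for \<alpha>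
    using that minus_R minus_R[of "- (2 *\<^sub>R \<alpha>)"] by (auto simp: roots0_def)
  have N0: "N \<subseteq> roots0 R" unfolding N_def using X mR by auto
  have iff: "\<alpha> \<in> N \<longleftrightarrow> - \<alpha> \<notin> N" if "\<alpha> \<in> roots0 R" for \<alpha>
  proof -
    have "\<alpha> \<in> Rp \<or> - \<alpha> \<in> Rp" using R_cases that by (auto simp: roots0_def)
    moreover have "\<alpha> \<in> N \<longleftrightarrow> \<alpha> \<notin> X" if "\<alpha> \<in> Rp" "\<alpha> \<in> roots0 R" for \<alpha>
      using that X Rp_not_minus by (force simp: N_def)
    moreover have "- \<alpha> \<in> N \<longleftrightarrow> \<alpha> \<in> X" if "\<alpha> \<in> Rp" for \<alpha>
      using that X Rp_not_minus by (force simp: N_def)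
    ultimately show ?thesis using mR[OF that] that by (metis minus_minus)
  qed
  have "\<Sum>N = \<Sum>(?X - X) + \<Sum>(uminus ` X)"
    unfolding N_def using X fX Rp_not_minus by (intro sum.union_disjoint) auto
  also have "\<Sum>(uminus ` X) = - \<Sum>X" by (subst sum.reindex) (auto simp: sum_negf)
  also have "\<Sum>(?X - X) = \<Sum>?X - \<Sum>X" using X by (simp add: sum_diff)
  finally have "rho R Rp - \<Sum>X = (1/2) *\<^sub>R \<Sum>N"
    unfolding rho_def using half_diff by metis
  then have "w (rho R Rp - \<Sum>X) = (1/2) *\<^sub>R (\<Sum>\<alpha>\<in>N. w \<alpha>)"
    using W_linear[OF w] by (simp add: linear_cmul linear_sum)
  also have "(\<Sum>\<alpha>\<in>N. w \<alpha>) = \<Sum>(w ` N)" using W_inj[OF w] by (subst sum.reindex) (auto intro: inj_on_subset)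
  finally have eq: "w (rho R Rp - \<Sum>X) = (1/2) *\<^sub>R \<Sum>(w ` N)" .
  show ?thesis unfolding eq
  proof (rule rho_minus_choice)
    show "w ` N \<subseteq> roots0 R" using N0 W_roots0[OF w] by auto
    fix \<alpha> assume a: "\<alpha> \<in> roots0 R"
    have mem: "\<beta> \<in> w ` N \<longleftrightarrow> inv w \<beta> \<in> N" for \<beta> using W_inv_apply[OF w] by (metis imageE imageI)
    have "inv w (- \<alpha>) = - inv w \<alpha>" using linear_neg[OF W_linear[OF W_inv[OF w]]] .
    then show "\<alpha> \<in> w ` N \<longleftrightarrow> - \<alpha> \<notin> w ` N" unfolding mem using iff[OF W_roots0[OF W_inv[OF w] a]] by simp
  qed
qed

text \<open>Bounding the whole orbit takes the place of the convex hull of the orbit of \<kappa>.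
  The condition is additive, hence passes to products, and it bounds in particular the dominant
  point of the orbit.\<close>

definition saturated :: "real^'n \<Rightarrow> (real^'n \<Rightarrow> complex) set" where
  "saturated \<kappa> = {chr \<theta> | \<theta>. \<forall>w\<in>W. \<kappa> - w \<theta> \<in> poscone Rp}"

lemma delta_saturated: "delta R Rp \<in> cspan (saturated (rho R Rp))"
proof -
  let ?X = "roots0 R \<inter> Rp"
  have "delta R Rp \<xi> = (\<Sum>Y\<in>Pow ?X. (-1) ^ card Y * chr (rho R Rp - \<Sum>Y) \<xi>)" for \<xi>
  proof -
    have pr: "(\<Prod>\<alpha>\<in>Y. chr (f \<alpha>) \<xi>) = chr (\<Sum>\<alpha>\<in>Y. f \<alpha>) \<xi>" if "finite Y" for Y and f :: "real^'n \<Rightarrow> real^'n"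
      using that by (induction Y rule: finite_induct) (simp_all add: chr_add)
    have "delta R Rp \<xi> = (\<Sum>Y\<in>Pow ?X. (-1) ^ card Y * (\<Prod>\<alpha>\<in>Y. chr (- ((1/2) *\<^sub>R \<alpha>)) \<xi>) * (\<Prod>\<alpha>\<in>?X - Y. chr ((1/2) *\<^sub>R \<alpha>) \<xi>))"
      unfolding delta_chr by (rule prod_diff_conv_sum) simp
    also have "\<dots> = (\<Sum>Y\<in>Pow ?X. (-1) ^ card Y * chr (rho R Rp - \<Sum>Y) \<xi>)"
    proof (rule sum.cong)
      fix Y assume Y: "Y \<in> Pow ?X"
      then have fY: "finite Y" "finite (?X - Y)" using roots_finite(1) by (meson PowD finite_Int finite_subset finite_Diff)+
      have "(\<Sum>\<alpha>\<in>?X - Y. (1/2) *\<^sub>R \<alpha>) = (1/2) *\<^sub>R (\<Sum>?X - \<Sum>Y)"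
        using Y by (simp add: scaleR_sum_right[symmetric] sum_diff)
      then have "(\<Sum>\<alpha>\<in>Y. - ((1/2) *\<^sub>R \<alpha>)) + (\<Sum>\<alpha>\<in>?X - Y. (1/2) *\<^sub>R \<alpha>) = rho R Rp - \<Sum>Y"
        unfolding rho_def sum_negf scaleR_sum_right[symmetric] half_sum_diff by (metis half_sum_diff)
      then show "(-1) ^ card Y * (\<Prod>\<alpha>\<in>Y. chr (- ((1/2) *\<^sub>R \<alpha>)) \<xi>) * (\<Prod>\<alpha>\<in>?X - Y. chr ((1/2) *\<^sub>R \<alpha>) \<xi>)
          = (-1) ^ card Y * chr (rho R Rp - \<Sum>Y) \<xi>"
        by (simp add: pr[OF fY(1)] pr[OF fY(2)] mult.assoc flip: chr_add)
    qed simp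
    finally show ?thesis .
  qed
  then have "delta R Rp = (\<lambda>\<xi>. \<Sum>Y\<in>Pow ?X. (-1) ^ card Y * chr (rho R Rp - \<Sum>Y) \<xi>)" by blast
  also have "\<dots> \<in> cspan (saturated (rho R Rp))"
    by (intro cspan_sum cspan_cmult cspan_base) (auto simp: saturated_def intro!: rho_minus_sum_W)
  finally show ?thesis .
qed

lemma msym_saturated:
  assumes "\<kappa> \<in> dominant_weights Rp" shows "msym R \<kappa> \<in> cspan (saturated \<kappa>)"
proof -
  have "chr (w \<kappa>) \<in> saturated \<kappa>" if "w \<in> W" for w
    unfolding saturated_def using dominant_dominance_W[OF assms W_comp[OF _ that]] by auto
  then show ?thesis unfolding msym_chr[abs_def] by (intro cspan_sum cspan_cmult cspan_base)
qed

lemma delta_msym_saturated: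
  assumes "\<kappa> \<in> dominant_weights Rp"
  shows "(\<lambda>\<xi>. delta R Rp \<xi> * msym R \<kappa> \<xi>) \<in> cspan (saturated (rho R Rp + \<kappa>))"
proof (rule cspan_mult[OF delta_saturated msym_saturated[OF assms]])
  fix b c assume "b \<in> saturated (rho R Rp)" "c \<in> saturated \<kappa>"
  then obtain x y where x: "b = chr x" "\<And>w. w \<in> W \<Longrightarrow> rho R Rp - w x \<in> poscone Rp"
    and y: "c = chr y" "\<And>w. w \<in> W \<Longrightarrow> \<kappa> - w y \<in> poscone Rp" by (auto simp: saturated_def)
  have "(rho R Rp + \<kappa>) - w (x + y) \<in> poscone Rp" if w: "w \<in> W" for w
    using poscone_add[OF x(2)[OF w] y(2)[OF w]] by (simp add: linear_add[OF W_linear[OF w]] algebra_simps)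
  then have "chr (x + y) \<in> saturated (rho R Rp + \<kappa>)" by (auto simp: saturated_def)
  then show "(\<lambda>\<xi>. b \<xi> * c \<xi>) \<in> cspan (saturated (rho R Rp + \<kappa>))"
    using cspan_base by (simp add: x(1) y(1) chr_add[symmetric])
qed

text \<open>Up to sign the exponent may be moved to the dominant point of its orbit. On a wall the
  alternating sum vanishes; off the walls the exponent is regular, so removing \<rho> leaves a
  dominant weight, below \<kappa> by saturation.\<close>

lemma alternant_saturated:
  assumes \<kappa>: "\<kappa> \<in> dominant_weights Rp" and b: "b \<in> saturated (rho R Rp + \<kappa>)"
  shows "alternant b \<in> cspan {alternant (chr (rho R Rp + \<mu>)) | \<mu>. \<mu> \<in> dominant_weights Rp \<and> \<kappa> - \<mu> \<in> poscone Rp}"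
proof -
  obtain \<theta> where t: "b = chr \<theta>" "\<And>w. w \<in> W \<Longrightarrow> rho R Rp + \<kappa> - w \<theta> \<in> poscone Rp" using b by (auto simp: saturated_def)
  obtain w where w: "w \<in> W" "\<And>\<alpha>. \<alpha> \<in> Rp \<Longrightarrow> w \<theta> \<bullet> coroot \<alpha> \<ge> 0" using exists_dominant by blast
  have "alternant (chr \<theta>) = alternant (chr (inv w (w \<theta>)))" using w by simp
  also have "\<dots> = (\<lambda>\<xi>. complex_of_real (wsign (inv w)) * alternant (chr (w \<theta>)) \<xi>)"
    by (rule alternant_chr_W[OF W_inv[OF w(1)]])
  finally have eq: "alternant b = (\<lambda>\<xi>. complex_of_real (wsign (inv w)) * alternant (chr (w \<theta>)) \<xi>)" unfolding t(1) .
  have wt: "weight (w \<theta>)"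
    using weight_diff[OF weight_add[OF weight_rho dominant_weight[OF \<kappa>]] weight_poscone[OF t(2)[OF w(1)]]] by simp
  show ?thesis
  proof (cases "regular_dominant (w \<theta>)")
    case True
    define \<mu> where "\<mu> = w \<theta> - rho R Rp"
    have "\<mu> \<in> dominant_weights Rp" unfolding \<mu>_def by (rule regular_dominant_diff_rho[OF wt True])
    moreover have "\<kappa> - \<mu> \<in> poscone Rp" using t(2)[OF w(1)] by (simp add: \<mu>_def algebra_simps)
    moreover have "w \<theta> = rho R Rp + \<mu>" by (simp add: \<mu>_def)
    ultimately show ?thesis unfolding eq by (intro cspan_cmult cspan_base) auto
  next
    case False
    then obtain \<alpha> where "\<alpha> \<in> Rp" "w \<theta> \<bullet> coroot \<alpha> = 0" using w(2) by (force simp: regular_dominant_def)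
    then have "alternant (chr (w \<theta>)) = (\<lambda>_. 0)" using alternant_chr_singular Rp_R by blast
    then show ?thesis unfolding eq using cspan_0 by simp
  qed
qed

text \<open>A regular weight has trivial stabilizer, so the exponent \<open>\<rho> + \<mu>\<close>
  occurs only once, at the identity.\<close>

lemma lead_alternant:
  assumes "\<mu> \<in> dominant_weights Rp"
  shows "\<exists>d\<ge>0. lead d (rho R Rp + \<mu>) (alternant (chr (rho R Rp + \<mu>))) 1"
proof -
  define \<theta> where "\<theta> = rho R Rp + \<mu>"
  have t: "\<theta> \<in> dominant_weights Rp" "regular_dominant \<theta>" unfolding \<theta>_def using dominant_add_rho[OF assms] by auto
  let ?d = "\<Sum>w\<in>W. \<Sum>\<beta>\<in>Rp. \<bar>(\<theta> - w \<theta>) \<bullet> coroot \<beta>\<bar>"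
  have eq: "alternant (chr \<theta>) = (\<lambda>\<xi>. \<Sum>w\<in>W. complex_of_real (wsign w) * chr (w \<theta>) \<xi>)"
  proof
    fix \<xi>
    have "alternant (chr \<theta>) \<xi> = (\<Sum>w\<in>W. complex_of_real (wsign (inv w)) * chr (inv w \<theta>) \<xi>)"
      unfolding alternant_def by (intro sum.cong) (simp_all add: chr_W wsign_inv)
    also have "\<dots> = (\<Sum>w\<in>W. complex_of_real (wsign w) * chr (w \<theta>) \<xi>)"
      by (rule sum_W_inv[of "\<lambda>w. complex_of_real (wsign w) * chr (w \<theta>) \<xi>"])
    finally show "alternant (chr \<theta>) \<xi> = (\<Sum>w\<in>W. complex_of_real (wsign w) * chr (w \<theta>) \<xi>)" .
  qed
  have l: "lead ?d \<theta> (\<lambda>\<xi>. \<Sum>w\<in>W. complex_of_real (wsign w) * chr (w \<theta>) \<xi>) (\<Sum>w\<in>{id :: real^'n \<Rightarrow> real^'n}. complex_of_real (wsign w))"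
  proof (rule lead_sum_chr[where \<theta> = "\<lambda>w. w \<theta>"])
    fix w assume w: "w \<in> W - {id}"
    have "w \<theta> \<noteq> \<theta>" using regular_stabilizer[of w \<theta>] w t dominant_weights_D[OF t(1)] simple_Rp by blast
    then show "\<theta> - w \<theta> \<in> poscone Rp \<and> w \<theta> \<noteq> \<theta> \<and> (\<forall>\<beta>\<in>Rp. \<bar>(\<theta> - w \<theta>) \<bullet> coroot \<beta>\<bar> \<le> ?d)"
      using dominant_dominance_W[OF t(1)] orbit_bound w by blast
  next
    show "{id :: real^'n \<Rightarrow> real^'n} \<subseteq> W" using weyl_group.wg_id by (metis empty_subsetI insert_subset)
    show "\<And>i. i \<in> {id :: real^'n \<Rightarrow> real^'n} \<Longrightarrow> i \<theta> = \<theta>" by (metis id_apply singletonD)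
  qed (rule finite_W)
  have s: "(\<Sum>w\<in>{id :: real^'n \<Rightarrow> real^'n}. complex_of_real (wsign w)) = 1"
  proof -
    have "complex_of_real (wsign (id :: real^'n \<Rightarrow> real^'n)) = 1" by (metis wsign_id of_real_1)
    then show ?thesis by simp
  qed
  have "lead ?d \<theta> (alternant (chr \<theta>)) 1" using l unfolding s eq .
  moreover have "?d \<ge> 0" by (intro sum_nonneg) auto
  ultimately show ?thesis unfolding \<theta>_def by blast
qed

abbreviation below :: "real^'n \<Rightarrow> (real^'n) set" where
  "below \<kappa> \<equiv> {\<mu> \<in> dominant_weights Rp. \<kappa> - \<mu> \<in> poscone Rp \<and> \<mu> \<noteq> \<kappa>}"

lemma below_trans: "\<mu> \<in> below \<kappa> \<Longrightarrow> \<nu> \<in> below \<mu> \<Longrightarrow> \<nu> \<in> below \<kappa>"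
  using poscone_add[of "\<kappa> - \<mu>" Rp "\<mu> - \<nu>"] poscone_strict_add[of "\<kappa> - \<mu>" "\<mu> - \<nu>"] by auto

text \<open>Explicit quotients known for the generators are combined linearly, so zeros of
  \<open>delta\<close> cause no trouble. Transitivity of strict dominance keeps the lower terms of
  all these quotients below \<kappa>.\<close>

lemma delta_quotient:
  assumes G: "G \<in> cspan ((\<lambda>\<mu>. alternant (chr (rho R Rp + \<mu>))) ` below \<kappa>)"
    and J: "\<And>\<mu>. \<mu> \<in> below \<kappa> \<Longrightarrow> \<exists>h\<in>cspan (msym R ` below \<mu>).
      \<forall>\<xi>. alternant (chr (rho R Rp + \<mu>)) \<xi> = delta R Rp \<xi> * (msym R \<mu> \<xi> + h \<xi>)"
  shows "\<exists>g\<in>cspan (msym R ` below \<kappa>). \<forall>\<xi>. G \<xi> = delta R Rp \<xi> * g \<xi>"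
  using G
proof (induction rule: cspan.induct)
  case cspan_0 show ?case using cspan.cspan_0 by (intro bexI[of _ "\<lambda>_. 0"]) auto
next
  case (cspan_step f b l)
  then obtain g where g: "g \<in> cspan (msym R ` below \<kappa>)" "\<And>\<xi>. f \<xi> = delta R Rp \<xi> * g \<xi>" by blast
  obtain \<mu> where mu: "\<mu> \<in> below \<kappa>" "b = alternant (chr (rho R Rp + \<mu>))" using cspan_step by blast
  obtain h where h: "h \<in> cspan (msym R ` below \<mu>)"
    "\<And>\<xi>. alternant (chr (rho R Rp + \<mu>)) \<xi> = delta R Rp \<xi> * (msym R \<mu> \<xi> + h \<xi>)"
    using J[OF mu(1)] by blast
  have "below \<mu> \<subseteq> below \<kappa>" using below_trans[OF mu(1)] by blast
  then have h': "h \<in> cspan (msym R ` below \<kappa>)" using cspan_mono[OF h(1) image_mono] by blast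
  have "(\<lambda>\<xi>. g \<xi> + l * (msym R \<mu> \<xi> + h \<xi>)) \<in> cspan (msym R ` below \<kappa>)"
    by (intro cspan_add cspan_cmult g h' cspan_base imageI mu)
  moreover have "f \<xi> + l * b \<xi> = delta R Rp \<xi> * (g \<xi> + l * (msym R \<mu> \<xi> + h \<xi>))" for \<xi>
    unfolding g(2) mu(2) h(2) by (simp add: algebra_simps)
  ultimately show ?case
    by (intro bexI[where x = "\<lambda>\<xi>. g \<xi> + l * (msym R \<mu> \<xi> + h \<xi>)"]) (rule allI)
qed

text \<open>Multiplication by \<open>\<delta>\<close> sends the monomial symmetric functions unitriangularly to the
  antisymmetrized characters; inverting the triangular system exhibits the Weyl characters without
  any divisibility argument. The diagonal entries are read off by the Fourier coefficient at
  \<open>\<rho> + \<kappa>\<close>.\<close>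

lemma weyl_character:
  assumes "\<kappa> \<in> dominant_weights Rp" "finite (below \<kappa>)"
  shows "\<exists>g\<in>cspan (msym R ` below \<kappa>). \<forall>\<xi>. alternant (chr (rho R Rp + \<kappa>)) \<xi> = delta R Rp \<xi> * (msym R \<kappa> \<xi> + g \<xi>)"
  using assms
proof (induction "card (below \<kappa>)" arbitrary: \<kappa> rule: less_induct)
  case less
  note \<kappa> = less.prems(1)
  define F where "F \<xi> = delta R Rp \<xi> * msym R \<kappa> \<xi>" for \<xi>
  let ?J = "\<lambda>\<mu>. alternant (chr (rho R Rp + \<mu>))"
  have Fsat: "F \<in> cspan (saturated (rho R Rp + \<kappa>))"
    unfolding F_def[abs_def] by (rule delta_msym_saturated[OF \<kappa>])
  \<comment> \<open>\<open>F\<close> is antisymmetric, so alternating it only multiplies it by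
    \<open>card W\<close>. Hence alternating its exponential expansion expresses \<open>F\<close>
    itself through alternants.\<close>
  have aF: "alternant F \<xi> = of_nat (card W) * F \<xi>" for \<xi>
  proof -
    have "complex_of_real (wsign w) * F (w \<xi>) = F \<xi>" if w: "w \<in> W" for w
      using wsign_square[OF w] by (simp add: F_def delta_W[OF w] msym_W[OF w] mult.assoc[symmetric] flip: of_real_mult)
    then show ?thesis by (simp add: alternant_def)
  qed
  have "alternant F \<in> cspan (?J ` insert \<kappa> (below \<kappa>))"
  proof (rule cspan_trans[OF alternant_cspan[OF Fsat]])
    fix b assume "b \<in> alternant ` saturated (rho R Rp + \<kappa>)"
    then have "b \<in> cspan {?J \<mu> | \<mu>. \<mu> \<in> dominant_weights Rp \<and> \<kappa> - \<mu> \<in> poscone Rp}"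
      using alternant_saturated[OF \<kappa>] by blast
    then show "b \<in> cspan (?J ` insert \<kappa> (below \<kappa>))" by (rule cspan_mono) auto
  qed
  then have "(\<lambda>\<xi>. (1 / of_nat (card W)) * alternant F \<xi>) \<in> cspan (?J ` insert \<kappa> (below \<kappa>))" by (rule cspan_cmult)
  then have "F \<in> cspan (insert (?J \<kappa>) (?J ` below \<kappa>))" using W_nonempty by (simp add: aF)
  then obtain k where k: "(\<lambda>\<xi>. F \<xi> - k * ?J \<kappa> \<xi>) \<in> cspan (?J ` below \<kappa>)" using cspan_insert by blast
  define G where "G \<xi> = F \<xi> - k * ?J \<kappa> \<xi>" for \<xi>
  have G: "G \<in> cspan (?J ` below \<kappa>)" unfolding G_def[abs_def] by (rule k)
  have cJ: "continuous_on UNIV (?J \<mu>)" for \<mu> by (intro continuous_alternant continuous_chr')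
  let ?n = "- (rho R Rp + \<kappa>)"
  have "k = 1"
  proof -
    obtain d1 where d1: "d1 \<ge> 0" "lead d1 (rho R Rp) (delta R Rp) 1" using lead_delta by blast
    obtain d2 where d2: "d2 \<ge> 0" "lead d2 \<kappa> (msym R \<kappa>) 1" using lead_msym[OF \<kappa>] by blast
    have lF: "lead (d1 + d2) (rho R Rp + \<kappa>) F 1"
      using lead_mult[OF d1(2) d2(2) d1(1) d2(1)] by (simp add: F_def[abs_def])
    \<comment> \<open>Multiplying by the character at \<open>?n\<close> shifts the exponent
      \<open>\<rho> + \<kappa>\<close> to 0. For \<mu> strictly below \<kappa> the shifted leading
      exponent \<open>\<mu> - \<kappa>\<close> is outside the cone.\<close>
    have tm: "torus_mean (\<lambda>\<xi>. f \<xi> * chr ?n \<xi>) = (if \<mu> = \<kappa> then 1 else 0)"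
      if l: "lead d (rho R Rp + \<mu>) f 1" and d: "d \<ge> 0" and mu: "\<mu> = \<kappa> \<or> \<mu> \<in> below \<kappa>" for f d \<mu>
    proof -
      have "lead (d + 0) ((rho R Rp + \<mu>) + ?n) (\<lambda>\<xi>. f \<xi> * chr ?n \<xi>) (1 * 1)"
        by (rule lead_mult[OF l lead_chr d]) simp
      then have l': "lead d (\<mu> - \<kappa>) (\<lambda>\<xi>. f \<xi> * chr ?n \<xi>) 1" by (simp add: algebra_simps)
      have "weight (\<mu> - \<kappa>)" using mu \<kappa> dominant_weight by (auto intro!: weight_diff)
      moreover have "\<mu> - \<kappa> = 0 \<or> \<mu> - \<kappa> \<notin> poscone Rp"
        using mu poscone_strict_add[of "\<kappa> - \<mu>" "\<mu> - \<kappa>"] by auto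
      ultimately show ?thesis using torus_mean_lead[OF l'] by simp
    qed
    have tJ: "torus_mean (\<lambda>\<xi>. ?J \<mu> \<xi> * chr ?n \<xi>) = (if \<mu> = \<kappa> then 1 else 0)" if "\<mu> = \<kappa> \<or> \<mu> \<in> below \<kappa>" for \<mu>
    proof -
      have "\<mu> \<in> dominant_weights Rp" using that \<kappa> by auto
      then show ?thesis using lead_alternant[of \<mu>] tm[OF _ _ that] by blast
    qed
    have cG: "continuous_on UNIV G" by (rule continuous_cspan[OF G]) (use cJ in auto)
    have "(\<lambda>\<xi>. G \<xi> * chr ?n \<xi>) \<in> cspan ((\<lambda>f \<xi>. f \<xi> * chr ?n \<xi>) ` (?J ` below \<kappa>))"
      using cspan_linear_image[OF G, of "\<lambda>f \<xi>. f \<xi> * chr ?n \<xi>"] by (simp add: distrib_right mult.assoc)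
    then have "torus_mean (\<lambda>\<xi>. G \<xi> * chr ?n \<xi>) = 0"
      by (rule torus_mean_cspan) (use tJ in \<open>auto intro!: continuous_intros cJ continuous_chr'\<close>)
    moreover have "torus_mean (\<lambda>\<xi>. G \<xi> * chr ?n \<xi> + k * (?J \<kappa> \<xi> * chr ?n \<xi>))
        = torus_mean (\<lambda>\<xi>. G \<xi> * chr ?n \<xi>) + k * torus_mean (\<lambda>\<xi>. ?J \<kappa> \<xi> * chr ?n \<xi>)"
      by (rule torus_mean_add_cmult) (intro continuous_intros cG cJ continuous_chr')+
    moreover have "G \<xi> * chr ?n \<xi> + k * (?J \<kappa> \<xi> * chr ?n \<xi>) = F \<xi> * chr ?n \<xi>" for \<xi>
      by (simp add: G_def algebra_simps)
    moreover have "torus_mean (\<lambda>\<xi>. F \<xi> * chr ?n \<xi>) = 1" using tm[OF lF] d1 d2 by simp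
    ultimately show ?thesis using tJ[of \<kappa>] by simp
  qed
  have "\<exists>g\<in>cspan (msym R ` below \<kappa>). \<forall>\<xi>. G \<xi> = delta R Rp \<xi> * g \<xi>"
  proof (rule delta_quotient[OF G])
    fix \<mu> assume mu: "\<mu> \<in> below \<kappa>"
    have sub: "below \<mu> \<subset> below \<kappa>" using below_trans[OF mu] mu by blast
    have "card (below \<mu>) < card (below \<kappa>)" "finite (below \<mu>)"
      using sub less.prems(2) psubset_card_mono finite_subset by blast+
    then show "\<exists>h\<in>cspan (msym R ` below \<mu>). \<forall>\<xi>. ?J \<mu> \<xi> = delta R Rp \<xi> * (msym R \<mu> \<xi> + h \<xi>)"
      using less.hyps[of \<mu>] mu by blast
  qed
  then obtain g where g: "g \<in> cspan (msym R ` below \<kappa>)" "\<And>\<xi>. G \<xi> = delta R Rp \<xi> * g \<xi>" by blast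
  have "?J \<kappa> \<xi> = delta R Rp \<xi> * (msym R \<kappa> \<xi> + (- 1) * g \<xi>)" for \<xi>
  proof -
    have "?J \<kappa> \<xi> = F \<xi> - G \<xi>" by (simp add: G_def \<open>k = 1\<close>)
    then show ?thesis by (simp add: g(2) F_def algebra_simps)
  qed
  then show ?case
    by (intro bexI[OF _ cspan_cmult[OF g(1), of "-1"]]) (rule allI)
qed

end

section \<open>Truncation and the asymptotic estimate\<close>

text \<open>The series converges at a radius \<open>q\<close> strictly between 1 and
  \<open>r\<close>, so the coefficients are at most a constant times \<open>(1 / q) ^ n\<close>, and
  the tail on the unit circle is geometric.\<close>

lemma power_series_truncation:
  fixes f :: "complex \<Rightarrow> complex"
  assumes f: "f analytic_on cball 0 r" and r: "r > 1"
  shows "\<exists>a K s. 0 < s \<and> s < 1 \<and> a 0 = f 0 \<and>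
    (\<forall>N z. norm z = 1 \<longrightarrow> norm (f z - (\<Sum>k<N. a k * z ^ k)) \<le> K * s ^ N)"
proof -
  have hol: "f holomorphic_on ball 0 r"
    using f analytic_imp_holomorphic holomorphic_on_subset ball_subset_cball by blast
  define a where "a n = (deriv ^^ n) f 0 / fact n" for n
  have ser: "(\<lambda>n. a n * z ^ n) sums f z" if "norm z < r" for z
    using holomorphic_power_series[OF hol, of z] that by (simp add: a_def)
  define q where "q = (1 + r) / 2"
  have q: "1 < q" "q < r" using r by (auto simp: q_def)
  define s where "s = 1 / q"
  have s: "0 < s" "s < 1" using q by (auto simp: s_def)
  have "(\<lambda>n. a n * complex_of_real q ^ n) \<longlonglongrightarrow> 0"
    using ser[of "complex_of_real q"] q by (intro summable_LIMSEQ_zero sums_summable) auto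
  then have "Bseq (\<lambda>n. a n * complex_of_real q ^ n)" by (intro convergent_imp_Bseq convergentI)
  then obtain B where B: "B > 0" "\<And>n. norm (a n * complex_of_real q ^ n) \<le> B" by (auto simp: Bseq_def)
  have an: "norm (a n) \<le> B * s ^ n" for n
    using B(2)[of n] q by (simp add: norm_mult norm_power s_def power_one_over field_simps)
  have "norm (f z - (\<Sum>k<N. a k * z ^ k)) \<le> (B / (1 - s)) * s ^ N" if z: "norm z = 1" for N z
  proof -
    have "(\<lambda>n. a (n + N) * z ^ (n + N)) sums (f z - (\<Sum>k<N. a k * z ^ k))"
      by (rule sums_split_initial_segment, rule ser) (use z r in simp)
    moreover have "(\<lambda>n. (B * s ^ N) * s ^ n) sums ((B * s ^ N) * (1 / (1 - s)))"
      using s by (intro sums_mult geometric_sums) auto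
    moreover have "norm (a (n + N) * z ^ (n + N)) \<le> (B * s ^ N) * s ^ n" for n
      using an[of "n + N"] z by (simp add: norm_mult norm_power power_add mult_ac)
    ultimately have "norm (f z - (\<Sum>k<N. a k * z ^ k)) \<le> (B * s ^ N) * (1 / (1 - s))"
      by (rule norm_sums_le)
    then show ?thesis by (simp add: mult_ac)
  qed
  moreover have "a 0 = f 0" by (simp add: a_def)
  ultimately show ?thesis using s by blast
qed

text \<open>Telescoping, one factor at a time. The common rate is the maximum of the rates, and the
  bound on the exact product is carried along to control the approximating product in the next
  step.\<close>

lemma prod_approximation:
  fixes x :: "'i \<Rightarrow> 'b \<Rightarrow> complex" and y :: "'i \<Rightarrow> nat \<Rightarrow> 'b \<Rightarrow> complex"
  assumes "finite I"
    and "\<And>i. i \<in> I \<Longrightarrow> \<exists>K s. 0 < s \<and> s < 1 \<and> (\<forall>N \<xi>. norm (x i \<xi> - y i N \<xi>) \<le> K * s ^ N)"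
    and "\<And>i. i \<in> I \<Longrightarrow> \<exists>B. \<forall>\<xi>. norm (x i \<xi>) \<le> B"
  shows "\<exists>K s B. 0 < s \<and> s < 1 \<and> (\<forall>N \<xi>. norm ((\<Prod>i\<in>I. x i \<xi>) - (\<Prod>i\<in>I. y i N \<xi>)) \<le> K * s ^ N)
    \<and> (\<forall>\<xi>. norm (\<Prod>i\<in>I. x i \<xi>) \<le> B)"
  using assms
proof (induction I rule: finite_induct)
  case empty
  show ?case by (intro exI[of _ 0] exI[of _ "1/2"] exI[of _ 1]) auto
next
  case (insert i I)
  obtain K s B where 1: "0 < s" "s < 1" "\<And>N \<xi>. norm ((\<Prod>i\<in>I. x i \<xi>) - (\<Prod>i\<in>I. y i N \<xi>)) \<le> K * s ^ N"
      "\<And>\<xi>. norm (\<Prod>i\<in>I. x i \<xi>) \<le> B"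
    using insert.IH insert.prems by blast
  obtain L t where 2: "0 < t" "t < 1" "\<And>N \<xi>. norm (x i \<xi> - y i N \<xi>) \<le> L * t ^ N"
    using insert.prems(1)[of i] by blast
  obtain C where 3: "\<And>\<xi>. norm (x i \<xi>) \<le> C" using insert.prems(2)[of i] by blast
  define u where "u = max s t"
  have u: "0 < u" "u < 1" "s \<le> u" "t \<le> u" using 1 2 by (auto simp: u_def)
  have nn: "0 \<le> B" "0 \<le> C" "0 \<le> K" "0 \<le> L"
  proof -
    show "0 \<le> B" "0 \<le> C" using 1(4) 3 norm_ge_zero order_trans by blast+
    show "0 \<le> K" "0 \<le> L" using 1(3)[of undefined 0] 2(3)[of undefined 0] norm_ge_zero order_trans
      by (metis power_0 mult_1_right)+
  qed
  have "norm (x i \<xi> * (\<Prod>i\<in>I. x i \<xi>) - y i N \<xi> * (\<Prod>i\<in>I. y i N \<xi>)) \<le> (C * K + L * (B + K)) * u ^ N" for N \<xi>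
  proof -
    let ?X = "\<Prod>i\<in>I. x i \<xi>" and ?Y = "\<Prod>i\<in>I. y i N \<xi>"
    have sK: "K * s ^ N \<le> K * u ^ N" "L * t ^ N \<le> L * u ^ N"
      using 1 2 u nn by (auto intro!: mult_left_mono power_mono)
    have "K * s ^ N \<le> K * 1" using 1 nn by (intro mult_left_mono power_le_one) auto
    then have Y: "norm ?Y \<le> B + K"
      using 1(3)[of \<xi> N] 1(4)[of \<xi>] norm_triangle_ineq4[of ?X "?X - ?Y"] by simp
    have "x i \<xi> * ?X - y i N \<xi> * ?Y = x i \<xi> * (?X - ?Y) + (x i \<xi> - y i N \<xi>) * ?Y" by (simp add: algebra_simps)
    also have "norm \<dots> \<le> norm (x i \<xi>) * norm (?X - ?Y) + norm (x i \<xi> - y i N \<xi>) * norm ?Y"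
      by (rule order_trans[OF norm_triangle_ineq]) (simp add: norm_mult)
    also have "\<dots> \<le> C * (K * u ^ N) + (L * u ^ N) * (B + K)"
      using order_trans[OF 1(3) sK(1)] order_trans[OF 2(3) sK(2)] 3 Y nn u
      by (intro add_mono mult_mono) auto
    finally show ?thesis by (simp add: algebra_simps)
  qed
  moreover have "norm (x i \<xi> * (\<Prod>i\<in>I. x i \<xi>)) \<le> C * B" for \<xi>
    unfolding norm_mult using 1(4) 3 nn by (intro mult_mono) auto
  ultimately show ?case using u(1,2) insert(1,2)
    by (intro exI[of _ "C * K + L * (B + K)"] exI[of _ u] exI[of _ "C * B"]) simp
qed

text \<open>Schwarz reflection: \<open>f\<close> and its conjugate by \<open>cnj\<close> are
  holomorphic and agree on the interval from 0 to 1, which accumulates at 0.\<close>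

lemma analytic_cnj:
  fixes f :: "complex \<Rightarrow> complex"
  assumes f: "f analytic_on cball 0 r" and r: "r > 1" and re: "\<And>x::real. f (complex_of_real x) \<in> \<real>"
    and z: "norm z \<le> 1"
  shows "f (cnj z) = cnj (f z)"
proof -
  have hol: "f holomorphic_on ball 0 r"
    using f analytic_imp_holomorphic holomorphic_on_subset ball_subset_cball by blast
  have im: "cnj ` ball 0 r = ball 0 r"
    by (auto simp: image_iff intro!: bexI[of _ "cnj _"])
  have "(cnj \<circ> f \<circ> cnj) holomorphic_on ball 0 r"
    by (rule holomorphic_on_compose_cnj_cnj) (use hol im in auto)
  then have h: "(\<lambda>z. f z - (cnj \<circ> f \<circ> cnj) z) holomorphic_on ball 0 r"
    using hol by (intro holomorphic_intros)
  have lim: "0 islimpt (complex_of_real ` {0<..<1})"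
    unfolding islimpt_approachable
  proof (intro allI impI)
    fix e :: real assume "e > 0"
    then obtain x where "0 < x" "x < 1" "x < e" using field_lbound_gt_zero[of 1 e] by auto
    then show "\<exists>x'\<in>complex_of_real ` {0<..<1}. x' \<noteq> 0 \<and> dist x' 0 < e"
      by (intro bexI[of _ "complex_of_real x"]) auto
  qed
  have "f (cnj z) - (cnj \<circ> f \<circ> cnj) (cnj z) = 0"
  proof (rule analytic_continuation[OF h open_ball connected_ball _ _ lim])
    show "complex_of_real ` {0<..<1} \<subseteq> ball 0 r" using r by auto
    fix w assume "w \<in> complex_of_real ` {0<..<1}"
    then obtain x where "w = complex_of_real x" by blast
    then show "f w - (cnj \<circ> f \<circ> cnj) w = 0" using re[of x] by (simp add: Reals_cnj_iff)
  qed (use z r in auto)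
  then show ?thesis by simp
qed

section \<open>Truncated products over the roots\<close>

context root_system
begin

abbreviation "X1 \<equiv> roots1 R \<inter> Rp"

text \<open>Drop of the exponents per truncation order: each of the \<open>card X1\<close> factors
  contributes at most \<open>cobound\<close>.\<close>

definition Dbound :: real where
  "Dbound = real (card X1) * cobound"

text \<open>\<open>N \<ge> 1\<close> ensures that the constant term, which is the leading one, is
  retained.\<close>

lemma lead_truncation:
  assumes "\<alpha> \<in> Rp" "N \<ge> 1"
  shows "lead (real N * cobound) 0 (\<lambda>\<xi>. \<Sum>k<N. a k * chr (- \<alpha>) \<xi> ^ k) (a 0)"
proof -
  have "lead (real N * cobound) 0 (\<lambda>\<xi>. \<Sum>k<N. a k * chr (real k *\<^sub>R - \<alpha>) \<xi>) (\<Sum>k\<in>{0}. a k)"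
  proof (rule lead_sum_chr[where \<theta> = "\<lambda>k. real k *\<^sub>R - \<alpha>"])
    fix k assume k: "k \<in> {..<N} - {0::nat}"
    have "\<bar>(0 - real k *\<^sub>R - \<alpha>) \<bullet> coroot \<beta>\<bar> \<le> real N * cobound" if "\<beta> \<in> Rp" for \<beta>
    proof -
      have "real k * \<bar>\<alpha> \<bullet> coroot \<beta>\<bar> \<le> real N * cobound"
        using cobound[OF assms(1) that] k by (intro mult_mono) auto
      then show ?thesis by (simp add: abs_mult)
    qed
    moreover have "0 - real k *\<^sub>R - \<alpha> \<in> poscone Rp"
      using poscone_scale_nat[OF poscone_base[OF finite_Rp assms(1)], of k] by simp
    moreover have "real k *\<^sub>R - \<alpha> \<noteq> 0" using k R_nz[OF Rp_R[OF assms(1)]] by simp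
    ultimately show "0 - real k *\<^sub>R - \<alpha> \<in> poscone Rp \<and> real k *\<^sub>R - \<alpha> \<noteq> 0 \<and>
        (\<forall>\<beta>\<in>Rp. \<bar>(0 - real k *\<^sub>R - \<alpha>) \<bullet> coroot \<beta>\<bar> \<le> real N * cobound)" by blast
  qed (use assms(2) in auto)
  then show ?thesis by (simp add: chr_power)
qed

text \<open>The family \<open>d\<close> is general so as to serve twice: as \<open>c\<close>, to
  truncate \<open>C\<close>, and as \<open>1 / c\<close>, to evaluate pairings with the alternating
  sum.\<close>

lemma product_truncation:
  fixes d :: "real^'n \<Rightarrow> complex \<Rightarrow> complex"
  assumes an: "\<And>\<alpha>. \<alpha> \<in> X1 \<Longrightarrow> d \<alpha> analytic_on cball 0 r" and r: "r > 1"
    and one: "\<And>\<alpha>. \<alpha> \<in> X1 \<Longrightarrow> d \<alpha> 0 = 1"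
  shows "\<exists>T K s B. 0 < s \<and> s < 1 \<and>
    (\<forall>N \<xi>. norm ((\<Prod>\<alpha>\<in>X1. d \<alpha> (chr (- \<alpha>) \<xi>)) - T N \<xi>) \<le> K * s ^ N) \<and>
    (\<forall>\<xi>. norm (\<Prod>\<alpha>\<in>X1. d \<alpha> (chr (- \<alpha>) \<xi>)) \<le> B) \<and>
    (\<forall>N\<ge>1. lead (real N * Dbound) 0 (T N) 1)"
proof -
  have "\<exists>a. \<forall>\<alpha>\<in>X1. \<exists>K s. 0 < s \<and> s < 1 \<and> a \<alpha> 0 = d \<alpha> 0 \<and>
    (\<forall>N z. norm z = 1 \<longrightarrow> norm (d \<alpha> z - (\<Sum>k<N. a \<alpha> k * z ^ k)) \<le> K * s ^ N)"
    using power_series_truncation[OF an r] by (intro bchoice ballI) blast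
  then obtain a where a: "\<And>\<alpha>. \<alpha> \<in> X1 \<Longrightarrow> \<exists>K s. 0 < s \<and> s < 1 \<and> a \<alpha> 0 = d \<alpha> 0 \<and>
    (\<forall>N z. norm z = 1 \<longrightarrow> norm (d \<alpha> z - (\<Sum>k<N. a \<alpha> k * z ^ k)) \<le> K * s ^ N)" by blast
  define T where "T N \<xi> = (\<Prod>\<alpha>\<in>X1. \<Sum>k<N. a \<alpha> k * chr (- \<alpha>) \<xi> ^ k)" for N \<xi>
  have "\<exists>K s B. 0 < s \<and> s < 1 \<and>
    (\<forall>N \<xi>. norm ((\<Prod>\<alpha>\<in>X1. d \<alpha> (chr (- \<alpha>) \<xi>)) - (\<Prod>\<alpha>\<in>X1. \<Sum>k<N. a \<alpha> k * chr (- \<alpha>) \<xi> ^ k)) \<le> K * s ^ N) \<and>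
    (\<forall>\<xi>. norm (\<Prod>\<alpha>\<in>X1. d \<alpha> (chr (- \<alpha>) \<xi>)) \<le> B)"
  proof (rule prod_approximation)
    fix \<alpha> assume al: "\<alpha> \<in> X1"
    obtain K s where K: "0 < s" "s < 1" "\<And>N z. norm z = 1 \<Longrightarrow> norm (d \<alpha> z - (\<Sum>k<N. a \<alpha> k * z ^ k)) \<le> K * s ^ N"
      using a[OF al] by blast
    then show "\<exists>K s. 0 < s \<and> s < 1 \<and> (\<forall>N \<xi>. norm (d \<alpha> (chr (- \<alpha>) \<xi>) - (\<Sum>k<N. a \<alpha> k * chr (- \<alpha>) \<xi> ^ k)) \<le> K * s ^ N)"
      by (intro exI[of _ K] exI[of _ s]) simp
    \<comment> \<open>At \<open>N = 0\<close> the truncation is the empty sum, and the error bound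
      becomes a bound on the function.\<close>
    show "\<exists>B. \<forall>\<xi>. norm (d \<alpha> (chr (- \<alpha>) \<xi>)) \<le> B"
      using K(3)[of _ 0] by (intro exI[of _ K]) simp
  qed simp
  moreover have "lead (real N * Dbound) 0 (T N) 1" if N: "N \<ge> 1" for N
  proof -
    have "lead (\<Sum>\<alpha>\<in>X1. real N * cobound) (\<Sum>\<alpha>\<in>X1. 0) (\<lambda>\<xi>. \<Prod>\<alpha>\<in>X1. \<Sum>k<N. a \<alpha> k * chr (- \<alpha>) \<xi> ^ k) (\<Prod>\<alpha>\<in>X1. a \<alpha> 0)"
      by (intro lead_prod lead_truncation N) (auto simp: cobound_nonneg)
    moreover have "(\<Prod>\<alpha>\<in>X1. a \<alpha> 0) = 1" using a one by (intro prod.neutral) metis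
    ultimately show ?thesis by (simp add: T_def[abs_def] Dbound_def mult_ac)
  qed
  ultimately show ?thesis unfolding T_def[symmetric] by blast
qed

lemma lead_bounded: "lead d \<kappa> f q \<Longrightarrow> \<exists>B. \<forall>\<xi>. norm (f \<xi>) \<le> B"
proof -
  have "\<exists>B. \<forall>\<xi>. norm (g \<xi>) \<le> B" if "g \<in> cspan (low d \<kappa>)" for g
    using that
  proof (induction rule: cspan.induct)
    case cspan_0 show ?case by (intro exI[of _ 0]) simp
  next
    case (cspan_step f b k)
    then obtain B where "\<And>\<xi>. norm (f \<xi>) \<le> B" by blast
    moreover have "norm (b \<xi>) = 1" for \<xi> using cspan_step by (auto simp: low_def)
    ultimately have "norm (f \<xi> + k * b \<xi>) \<le> B + norm k" for \<xi>
      by (metis add_mono mult_1_right norm_mult norm_triangle_ineq order_refl order_trans)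
    then show ?case by blast
  qed
  moreover assume "lead d \<kappa> f q"
  ultimately obtain B where B: "\<And>\<xi>. norm (f \<xi> - q * chr \<kappa> \<xi>) \<le> B" unfolding lead_def by blast
  have "norm (f \<xi>) \<le> B + norm q" for \<xi>
    using norm_triangle_ineq[of "f \<xi> - q * chr \<kappa> \<xi>" "q * chr \<kappa> \<xi>"] B[of \<xi>] by (simp add: norm_mult)
  then show ?thesis by blast
qed

lemma norm_set_integral_le:
  fixes f :: "real^'n \<Rightarrow> complex"
  assumes "continuous_on UNIV f" "continuous_on UNIV g" "\<And>\<xi>. norm (f \<xi>) \<le> g \<xi>"
  shows "norm (LINT \<xi>:AV|lborel. f \<xi>) \<le> (LINT \<xi>:AV|lborel. g \<xi>)"
proof -
  have i: "set_integrable lborel AV f" "set_integrable lborel AV g"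
    using assms by (auto intro: set_integrable_alcove)
  have "norm (LINT \<xi>:AV|lborel. f \<xi>) \<le> (LINT \<xi>:AV|lborel. norm (f \<xi>))"
    using set_integral_norm_bound[OF i(1)] .
  also have "\<dots> \<le> (LINT \<xi>:AV|lborel. g \<xi>)"
    by (rule set_integral_mono[OF set_integrable_norm[OF i(1)] i(2)]) (rule assms)
  finally show ?thesis .
qed

lemma set_integral_const: "(LINT \<xi>:AV|lborel. (k::real)) = k * measure lebesgue AV"
  by (simp add: set_lebesgue_integral_def alcove_volume(2) mult.commute)

lemma torus_mean_bound:
  assumes "continuous_on UNIV f" "\<And>\<xi>. norm (f \<xi>) \<le> B"
  shows "norm (torus_mean f) \<le> B"
proof -
  have "norm (\<Sum>w\<in>W. f (w \<xi>)) \<le> real (card W) * B" for \<xi>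
    using assms(2) by (rule sum_norm_bound)
  then have "norm (LINT \<xi>:AV|lborel. (\<Sum>w\<in>W. f (w \<xi>))) \<le> (LINT \<xi>:AV|lborel. real (card W) * B)"
    by (intro norm_set_integral_le continuous_sum_W assms(1) continuous_on_const)
  then show ?thesis using alcove_volume(1) W_nonempty(2)
    by (simp add: set_integral_const torus_mean_def norm_divide norm_mult divide_le_eq mult_ac)
qed

end

section \<open>The weight function and its pairing\<close>

locale root_system_c = root_system R Rp v for R Rp :: "(real^'n) set" and v :: "real^'n" +
  fixes c :: "real^'n \<Rightarrow> complex \<Rightarrow> complex" and r :: real
  assumes c_orbit: "\<And>\<alpha> \<beta> w. \<alpha> \<in> X1 \<Longrightarrow> \<beta> \<in> X1 \<Longrightarrow> w \<in> W \<Longrightarrow> w \<alpha> = \<beta> \<Longrightarrow> c \<alpha> = c \<beta>"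
    and r: "r > 1"
    and c_analytic: "\<And>\<alpha>. \<alpha> \<in> X1 \<Longrightarrow> c \<alpha> analytic_on cball 0 r"
    and c_nonzero: "\<And>\<alpha> z. \<alpha> \<in> X1 \<Longrightarrow> z \<in> cball 0 r \<Longrightarrow> c \<alpha> z \<noteq> 0"
    and c_zero: "\<And>\<alpha>. \<alpha> \<in> X1 \<Longrightarrow> c \<alpha> 0 = 1"
    and c_real: "\<And>\<alpha> x. \<alpha> \<in> X1 \<Longrightarrow> c \<alpha> (complex_of_real x) \<in> \<real>"
begin

abbreviation "C \<equiv> Chat R Rp c"
abbreviation "Dh \<equiv> Deltahat R Rp c"

lemma C_chr: "C \<xi> = (\<Prod>\<alpha>\<in>X1. c \<alpha> (chr (- \<alpha>) \<xi>))"
  by (simp add: Chat_def chr_def)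

lemma continuous_C: "continuous_on UNIV C"
proof -
  have "continuous_on UNIV (\<lambda>\<xi>. c \<alpha> (chr (- \<alpha>) \<xi>))" if "\<alpha> \<in> X1" for \<alpha>
    by (rule continuous_on_compose2[of "cball 0 r" "c \<alpha>"])
       (use c_analytic[OF that] r in \<open>auto intro!: holomorphic_on_imp_continuous_on analytic_imp_holomorphic continuous_chr'\<close>)
  then show ?thesis unfolding C_chr[abs_def] by (intro continuous_on_prod)
qed

lemma C_nonzero: "C \<xi> \<noteq> 0"
  unfolding C_chr using c_nonzero r by (auto simp: prod_zero_iff)

text \<open>Reversing \<xi> conjugates the unit complex number at which each \<open>c\<close> is
  evaluated, and reality on the real line makes \<open>c\<close> commute with conjugation. Hence
  \<open>Dh\<close> is a positive weight.\<close>

lemma C_minus: "C (- \<xi>) = cnj (C \<xi>)"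
proof -
  have "c \<alpha> (chr (- \<alpha>) (- \<xi>)) = cnj (c \<alpha> (chr (- \<alpha>) \<xi>))" if a: "\<alpha> \<in> X1" for \<alpha>
  proof -
    have "chr (- \<alpha>) (- \<xi>) = cnj (chr (- \<alpha>) \<xi>)" by (simp add: cnj_chr) (simp add: chr_def)
    then show ?thesis using analytic_cnj[OF c_analytic[OF a] r c_real[OF a], of "chr (- \<alpha>) \<xi>"] by simp
  qed
  then show ?thesis unfolding C_chr by simp
qed

lemma Dh_eq: "Dh \<xi> = complex_of_real (1 / (norm (C \<xi>))\<^sup>2)"
  by (simp only: Deltahat_def C_minus complex_norm_square of_real_divide of_real_1)

lemma norm_Dh: "norm (Dh \<xi>) = (norm (1 / C \<xi>))\<^sup>2"
  by (simp add: Dh_eq norm_divide norm_power power_divide)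

text \<open>\<open>C\<close> alone is in general not invariant. In the product with its reversal the
  two factors of \<gamma> are exchanged, while the other roots are permuted within orbits, on which
  \<open>c\<close> is constant.\<close>

lemma CC_simple:
  assumes g: "simple \<gamma>" shows "C (rrefl \<gamma> \<xi>) * C (- rrefl \<gamma> \<xi>) = C \<xi> * C (- \<xi>)"
proof -
  define h where "h \<alpha> \<eta> = c \<alpha> (chr (- \<alpha>) \<eta>) * c \<alpha> (chr \<alpha> \<eta>)" for \<alpha> \<eta>
  have CC: "C \<eta> * C (- \<eta>) = (\<Prod>\<alpha>\<in>X1. h \<alpha> \<eta>)" for \<eta>
  proof -
    have "chr (- \<alpha>) (- \<eta>) = chr \<alpha> \<eta>" for \<alpha> by (simp add: chr_def)
    then show ?thesis by (simp add: C_chr h_def prod.distrib)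
  qed
  have cs: "chr \<alpha> (rrefl \<gamma> \<xi>) = chr (rrefl \<gamma> \<alpha>) \<xi>" for \<alpha> by (simp add: chr_def inner_rrefl_swap)
  have neg: "rrefl \<gamma> (- \<alpha>) = - rrefl \<gamma> \<alpha>" for \<alpha> by (rule linear_neg[OF linear_rrefl])
  have g1: "\<gamma> \<in> X1" using simple_roots1[OF g] .
  have hg: "h \<gamma> (rrefl \<gamma> \<xi>) = h \<gamma> \<xi>"
    by (simp add: h_def cs neg rrefl_self[OF R_nz[OF simple_R[OF g]]] mult.commute)
  have bij: "bij_betw (rrefl \<gamma>) (X1 - {\<gamma>}) (X1 - {\<gamma>})" using simple_permutes_roots1[OF g] .
  have h': "h \<alpha> (rrefl \<gamma> \<xi>) = h (rrefl \<gamma> \<alpha>) \<xi>" if a: "\<alpha> \<in> X1 - {\<gamma>}" for \<alpha>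
  proof -
    have "rrefl \<gamma> \<alpha> \<in> X1" using bij a by (auto simp: bij_betw_def)
    then have "c \<alpha> = c (rrefl \<gamma> \<alpha>)" using c_orbit[of \<alpha> "rrefl \<gamma> \<alpha>" "rrefl \<gamma>"] a W_rrefl[OF simple_R[OF g]] by blast
    then show ?thesis by (simp add: h_def cs neg)
  qed
  have "(\<Prod>\<alpha>\<in>X1. h \<alpha> (rrefl \<gamma> \<xi>)) = h \<gamma> (rrefl \<gamma> \<xi>) * (\<Prod>\<alpha>\<in>X1 - {\<gamma>}. h \<alpha> (rrefl \<gamma> \<xi>))"
    by (rule prod.remove) (use g1 in auto)
  also have "(\<Prod>\<alpha>\<in>X1 - {\<gamma>}. h \<alpha> (rrefl \<gamma> \<xi>)) = (\<Prod>\<alpha>\<in>X1 - {\<gamma>}. h (rrefl \<gamma> \<alpha>) \<xi>)"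
    by (rule prod.cong) (use h' in auto)
  also have "\<dots> = (\<Prod>\<alpha>\<in>X1 - {\<gamma>}. h \<alpha> \<xi>)" by (rule prod.reindex_bij_betw[OF bij])
  also have "h \<gamma> (rrefl \<gamma> \<xi>) * \<dots> = (\<Prod>\<alpha>\<in>X1. h \<alpha> \<xi>)"
    unfolding hg by (rule prod.remove[symmetric]) (use g1 in auto)
  finally show ?thesis unfolding CC .
qed

lemma Dh_W: "w \<in> W \<Longrightarrow> Dh (w \<xi>) = Dh \<xi>"
proof -
  have "w \<in> W \<Longrightarrow> C (w \<xi>) * C (- w \<xi>) = C \<xi> * C (- \<xi>)" for \<xi>
  proof (induction arbitrary: \<xi> rule: W_simple_induct)
    case id show ?case by (metis id_apply)
  next
    case (step w \<gamma>) then show ?case using CC_simple[OF step(2)] by (metis comp_apply)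
  qed
  then show "w \<in> W \<Longrightarrow> Dh (w \<xi>) = Dh \<xi>" by (simp add: Deltahat_def)
qed

lemma continuous_Dh: "continuous_on UNIV Dh"
  unfolding Dh_eq[abs_def] using C_nonzero by (intro continuous_intros continuous_C) auto

text \<open>The squared modulus of \<open>delta\<close> in the original weight is absorbed into the
  two arguments, so that functions not written as multiples of \<open>delta\<close> can be paired as
  well.\<close>

definition ipc :: "(real^'n \<Rightarrow> complex) \<Rightarrow> (real^'n \<Rightarrow> complex) \<Rightarrow> complex" where
  "ipc F G = (LINT \<xi>:AV|lborel. F \<xi> * cnj (G \<xi>) * Dh \<xi>) / of_real (card W * measure lebesgue AV)"

lemma volume_factor: "card W * measure lebesgue AV > 0" "complex_of_real (card W * measure lebesgue AV) \<noteq> 0"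
  using alcove_volume(1) W_nonempty(2) by auto

lemma continuous_ipc:
  "continuous_on UNIV F \<Longrightarrow> continuous_on UNIV G \<Longrightarrow> continuous_on UNIV (\<lambda>\<xi>. F \<xi> * cnj (G \<xi>) * Dh \<xi>)"
  by (intro continuous_intros continuous_Dh)

lemma ipc_lincomb:
  assumes "continuous_on UNIV F" "continuous_on UNIV H" "continuous_on UNIV G"
  shows "ipc (\<lambda>\<xi>. F \<xi> + k * H \<xi>) G = ipc F G + k * ipc H G"
proof -
  have i: "set_integrable lborel AV (\<lambda>\<xi>. F \<xi> * cnj (G \<xi>) * Dh \<xi>)"
    "set_integrable lborel AV (\<lambda>\<xi>. H \<xi> * cnj (G \<xi>) * Dh \<xi>)"
    by (intro set_integrable_alcove continuous_ipc assms)+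
  have "(LINT \<xi>:AV|lborel. (F \<xi> + k * H \<xi>) * cnj (G \<xi>) * Dh \<xi>)
      = (LINT \<xi>:AV|lborel. F \<xi> * cnj (G \<xi>) * Dh \<xi> + k * (H \<xi> * cnj (G \<xi>) * Dh \<xi>))"
    by (simp add: algebra_simps)
  also have "\<dots> = (LINT \<xi>:AV|lborel. F \<xi> * cnj (G \<xi>) * Dh \<xi>) + k * (LINT \<xi>:AV|lborel. H \<xi> * cnj (G \<xi>) * Dh \<xi>)"
    using i by (subst set_integral_add) auto
  finally show ?thesis by (simp add: ipc_def add_divide_distrib)
qed

lemma ipc_cnj: "ipc G F = cnj (ipc F G)"
proof -
  have "(LINT \<xi>:AV|lborel. G \<xi> * cnj (F \<xi>) * Dh \<xi>) = (LINT \<xi>:AV|lborel. cnj (F \<xi> * cnj (G \<xi>) * Dh \<xi>))"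
    by (simp add: Dh_eq mult_ac)
  also have "\<dots> = cnj (LINT \<xi>:AV|lborel. F \<xi> * cnj (G \<xi>) * Dh \<xi>)"
  proof -
    have "(\<lambda>\<xi>. indicator AV \<xi> *\<^sub>R cnj (F \<xi> * cnj (G \<xi>) * Dh \<xi>)) = (\<lambda>\<xi>. cnj (indicator AV \<xi> *\<^sub>R (F \<xi> * cnj (G \<xi>) * Dh \<xi>)))"
      by (rule ext) (simp only: complex_cnj_scaleR)
    then show ?thesis unfolding set_lebesgue_integral_def by (simp only: Bochner_Integration.integral_cnj)
  qed
  finally show ?thesis by (simp add: ipc_def)
qed

lemma ipc_0: "ipc (\<lambda>_. 0) G = 0"
  by (simp add: ipc_def)

lemma ipc_sum:
  assumes "finite I" "\<And>i. i \<in> I \<Longrightarrow> continuous_on UNIV (f i)" "continuous_on UNIV G"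
  shows "ipc (\<lambda>\<xi>. \<Sum>i\<in>I. k i * f i \<xi>) G = (\<Sum>i\<in>I. k i * ipc (f i) G)"
  using assms(1,2)
proof (induction I rule: finite_induct)
  case empty show ?case using ipc_0 by simp
next
  case (insert i I)
  have "ipc (\<lambda>\<xi>. (\<Sum>i\<in>I. k i * f i \<xi>) + k i * f i \<xi>) G = ipc (\<lambda>\<xi>. \<Sum>i\<in>I. k i * f i \<xi>) G + k i * ipc (f i) G"
    by (rule ipc_lincomb) (use insert assms(3) in \<open>auto intro!: continuous_on_sum continuous_on_mult_left\<close>)
  then show ?case using insert by (simp add: add.commute)
qed

lemma ipc_cspan:
  assumes "f \<in> cspan B" "\<And>b. b \<in> B \<Longrightarrow> continuous_on UNIV b" "\<And>b. b \<in> B \<Longrightarrow> ipc b G = 0" "continuous_on UNIV G"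
  shows "ipc f G = 0"
  using assms(1)
proof (induction rule: cspan.induct)
  case cspan_0 show ?case by (rule ipc_0)
next
  case (cspan_step f b k)
  have "ipc (\<lambda>\<xi>. f \<xi> + k * b \<xi>) G = ipc f G + k * ipc b G"
    by (rule ipc_lincomb) (use continuous_cspan assms cspan_step in blast)+
  then show ?case using cspan_step assms by simp
qed

lemma continuous_delta: "continuous_on UNIV (delta R Rp)"
  using lead_delta lead_continuous by blast

lemma continuous_msym: "continuous_on UNIV (msym R \<mu>)"
  unfolding msym_chr[abs_def] by (intro continuous_intros)

lemma ip_Delta_ipc:
  assumes "continuous_on UNIV f" "continuous_on UNIV g"
  shows "ip_Delta R Rp c f g = ipc (\<lambda>\<xi>. delta R Rp \<xi> * f \<xi>) (\<lambda>\<xi>. delta R Rp \<xi> * g \<xi>)"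
proof -
  have eq: "f \<xi> * cnj (g \<xi>) * Dh \<xi> * complex_of_real ((cmod (delta R Rp \<xi>))\<^sup>2)
      = (delta R Rp \<xi> * f \<xi>) * cnj (delta R Rp \<xi> * g \<xi>) * Dh \<xi>" for \<xi>
    unfolding complex_norm_square by (simp add: mult_ac)
  have "(LINT \<xi>:AV|lebesgue. (delta R Rp \<xi> * f \<xi>) * cnj (delta R Rp \<xi> * g \<xi>) * Dh \<xi>)
      = (LINT \<xi>:AV|lborel. (delta R Rp \<xi> * f \<xi>) * cnj (delta R Rp \<xi> * g \<xi>) * Dh \<xi>)"
    by (intro set_integral_lebesgue_alcove continuous_ipc continuous_on_mult continuous_delta assms)
  then show ?thesis unfolding ip_Delta_def eq ipc_def by simp
qed

lemma C_truncation:
  "\<exists>T K s B. 0 < s \<and> s < 1 \<and> (\<forall>N \<xi>. norm (C \<xi> - T N \<xi>) \<le> K * s ^ N) \<and> (\<forall>\<xi>. norm (C \<xi>) \<le> B) \<and>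
    (\<forall>N\<ge>1. lead (real N * Dbound) 0 (T N) 1)"
  unfolding C_chr by (rule product_truncation[OF c_analytic r c_zero])

text \<open>Zero-freeness on the closed disc makes each \<open>1 / c \<alpha>\<close> analytic
  there, again with value 1 at the origin.\<close>

lemma inverse_C_truncation:
  "\<exists>T K s B. 0 < s \<and> s < 1 \<and> (\<forall>N \<xi>. norm (1 / C \<xi> - T N \<xi>) \<le> K * s ^ N) \<and> (\<forall>\<xi>. norm (1 / C \<xi>) \<le> B) \<and>
    (\<forall>N\<ge>1. lead (real N * Dbound) 0 (T N) 1)"
proof -
  have "1 / C \<xi> = (\<Prod>\<alpha>\<in>X1. 1 / c \<alpha> (chr (- \<alpha>) \<xi>))" for \<xi>
    by (simp add: C_chr prod_dividef)
  moreover have "(\<lambda>z. 1 / c \<alpha> z) analytic_on cball 0 r" if "\<alpha> \<in> X1" for \<alpha>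
    using analytic_on_divide[OF analytic_on_const c_analytic[OF that]] c_nonzero[OF that] by blast
  ultimately show ?thesis
    using product_truncation[of "\<lambda>\<alpha> z. 1 / c \<alpha> z", OF _ r] c_zero by simp
qed

text \<open>\<open>Psi_inf\<close> stripped of its factor \<open>csqrt Dh\<close>.\<close>

definition jost :: "real^'n \<Rightarrow> real^'n \<Rightarrow> complex" where
  "jost \<nu> = alternant (\<lambda>\<xi>. C \<xi> * chr (rho R Rp + \<nu>) \<xi>)"

lemma continuous_jost: "continuous_on UNIV (jost \<nu>)"
  unfolding jost_def by (intro continuous_alternant continuous_on_mult continuous_C continuous_chr')

text \<open>On the unit circle \<open>c\<close> is conjugated by inversion, so \<open>\<Delta>\<close> cancels the conjugate of \<open>C\<close> and
  the pairing with the asymptotic function unfolds to a Fourier coefficient of a function with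
  expansion in \<open>1 / C\<close>, whose exponents only decrease.\<close>

lemma ipc_msym_jost:
  assumes \<mu>: "\<mu> \<in> dominant_weights Rp" and \<nu>: "\<nu> \<in> dominant_weights Rp"
    and cmp: "\<mu> = \<nu> \<or> \<mu> - \<nu> \<notin> poscone Rp"
  shows "ipc (\<lambda>\<xi>. delta R Rp \<xi> * msym R \<mu> \<xi>) (jost \<nu>) = (if \<mu> = \<nu> then 1 else 0)"
proof -
  let ?n = "- (rho R Rp + \<nu>)"
  define h where "h \<xi> = (msym R \<mu> \<xi> * delta R Rp \<xi>) * chr ?n \<xi>" for \<xi>
  define f where "f \<xi> = h \<xi> * (1 / C \<xi>)" for \<xi>
  have "delta R Rp \<xi> * msym R \<mu> \<xi> * cnj (jost \<nu> \<xi>) * Dh \<xi> = (\<Sum>w\<in>W. f (w \<xi>))" for \<xi>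
  proof -
    have "delta R Rp \<xi> * msym R \<mu> \<xi> * cnj (complex_of_real (wsign w) * (C (w \<xi>) * chr (rho R Rp + \<nu>) (w \<xi>))) * Dh \<xi> = f (w \<xi>)"
      if w: "w \<in> W" for w
    proof -
      have "Dh \<xi> = 1 / (C (w \<xi>) * cnj (C (w \<xi>)))" using Dh_W[OF w, of \<xi>] by (simp add: Deltahat_def C_minus)
      then have 1: "cnj (C (w \<xi>)) * Dh \<xi> = 1 / C (w \<xi>)" using C_nonzero[of "w \<xi>"] by simp
      have "delta R Rp \<xi> * msym R \<mu> \<xi> * cnj (complex_of_real (wsign w) * (C (w \<xi>) * chr (rho R Rp + \<nu>) (w \<xi>))) * Dh \<xi>
          = (msym R \<mu> \<xi> * (complex_of_real (wsign w) * delta R Rp \<xi>)) * cnj (chr (rho R Rp + \<nu>) (w \<xi>)) * (cnj (C (w \<xi>)) * Dh \<xi>)"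
        by (simp add: mult_ac)
      also have "\<dots> = f (w \<xi>)"
        unfolding 1 f_def h_def cnj_chr delta_W[OF w] msym_W[OF w] ..
      finally show ?thesis .
    qed
    then show ?thesis
      unfolding jost_def alternant_def by (simp add: sum_distrib_left sum_distrib_right cnj_sum)
  qed
  then have ip: "ipc (\<lambda>\<xi>. delta R Rp \<xi> * msym R \<mu> \<xi>) (jost \<nu>) = torus_mean f"
    by (simp add: ipc_def torus_mean_def)
  obtain T K s where T: "0 < s" "s < 1" "\<And>N. N \<ge> 1 \<Longrightarrow> lead (real N * Dbound) 0 (T N) 1"
      and T3: "\<And>N \<xi>. norm (1 / C \<xi> - T N \<xi>) \<le> K * s ^ N"
    using inverse_C_truncation by blast
  obtain d1 where d1: "d1 \<ge> 0" "lead d1 (rho R Rp) (delta R Rp) 1" using lead_delta by blast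
  obtain d2 where d2: "d2 \<ge> 0" "lead d2 \<mu> (msym R \<mu>) 1" using lead_msym[OF \<mu>] by blast
  have "lead ((d2 + d1) + 0) ((\<mu> + rho R Rp) + ?n) h (1 * 1 * 1)"
    unfolding h_def[abs_def] by (intro lead_mult d1 d2 lead_chr) (use d1 d2 in auto)
  then have lh: "lead (d2 + d1) (\<mu> - \<nu>) h 1" by (simp add: algebra_simps)
  obtain M where M: "\<And>\<xi>. norm (h \<xi>) \<le> M" using lead_bounded[OF lh] by blast
  have M0: "M \<ge> 0" using M norm_ge_zero order_trans by blast
  have ch: "continuous_on UNIV h" using lead_continuous[OF lh] .
  have cf: "continuous_on UNIV f"
    unfolding f_def[abs_def] using C_nonzero by (intro continuous_intros ch continuous_C) auto
  define q :: complex where "q = (if \<mu> = \<nu> then 1 else 0)"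
  \<comment> \<open>With \<open>1 / C\<close> replaced by a truncation of any order the coefficient
    is exactly \<open>q\<close>. The expansion of \<open>1 / C\<close> itself is infinite, so its
    coefficient is obtained in the limit.\<close>
  have bound: "norm (torus_mean f - q) \<le> (M * K) * s ^ N" if N: "N \<ge> 1" for N
  proof -
    have lN: "lead ((d2 + d1) + real N * Dbound) (\<mu> - \<nu> + 0) (\<lambda>\<xi>. h \<xi> * T N \<xi>) (1 * 1)"
      by (intro lead_mult lh T N) (use d1 d2 cobound_nonneg in \<open>auto simp: Dbound_def\<close>)
    have "torus_mean (\<lambda>\<xi>. h \<xi> * T N \<xi>) = (if \<mu> - \<nu> = 0 then 1 else 0)"
      using torus_mean_lead[of _ "\<mu> - \<nu>" _ 1] lN cmp weight_diff[OF dominant_weight[OF \<mu>] dominant_weight[OF \<nu>]]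
      by auto
    then have q: "torus_mean (\<lambda>\<xi>. h \<xi> * T N \<xi>) = q" by (simp add: q_def)
    have cN: "continuous_on UNIV (\<lambda>\<xi>. h \<xi> * T N \<xi>)" using lead_continuous[OF lN] .
    have "torus_mean (\<lambda>\<xi>. f \<xi> + (-1) * (h \<xi> * T N \<xi>)) = torus_mean f + (-1) * torus_mean (\<lambda>\<xi>. h \<xi> * T N \<xi>)"
      by (rule torus_mean_add_cmult[OF cf cN])
    then have "torus_mean f - q = torus_mean (\<lambda>\<xi>. f \<xi> + (-1) * (h \<xi> * T N \<xi>))" using q by simp
    also have "norm \<dots> \<le> M * (K * s ^ N)"
    proof (rule torus_mean_bound)
      show "continuous_on UNIV (\<lambda>\<xi>. f \<xi> + (-1) * (h \<xi> * T N \<xi>))" by (intro continuous_on_add continuous_on_mult_left cf cN)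
      fix \<xi>
      have "f \<xi> + (-1) * (h \<xi> * T N \<xi>) = h \<xi> * (1 / C \<xi> - T N \<xi>)" by (simp add: f_def right_diff_distrib)
      then show "norm (f \<xi> + (-1) * (h \<xi> * T N \<xi>)) \<le> M * (K * s ^ N)"
        using mult_mono[OF M[of \<xi>] T3[of \<xi> N]] M0 by (simp add: norm_mult)
    qed
    finally show ?thesis by (simp add: mult.assoc)
  qed
  have "(\<lambda>N. (M * K) * s ^ N) \<longlonglongrightarrow> (M * K) * 0"
    using T by (intro tendsto_mult_left LIMSEQ_realpow_zero) auto
  then have "norm (torus_mean f - q) \<le> 0"
    using bound by (intro LIMSEQ_le_const[where x = "M * K * 0" and X = "\<lambda>N. (M * K) * s ^ N", simplified] exI[of _ 1]) auto
  then show ?thesis using ip by (simp add: q_def)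
qed

section \<open>Estimates and the comparison of \<open>P\<close> with the alternating sum\<close>

lemma ipc_norm_le:
  assumes "continuous_on UNIV F" "continuous_on UNIV G" "continuous_on UNIV g"
    "\<And>\<xi>. norm (F \<xi> * cnj (G \<xi>) * Dh \<xi>) \<le> g \<xi>"
  shows "norm (ipc F G) \<le> (LINT \<xi>:AV|lborel. g \<xi>) / (card W * measure lebesgue AV)"
proof -
  have "norm (LINT \<xi>:AV|lborel. F \<xi> * cnj (G \<xi>) * Dh \<xi>) \<le> (LINT \<xi>:AV|lborel. g \<xi>)"
    by (rule norm_set_integral_le[OF continuous_ipc[OF assms(1,2)] assms(3,4)])
  then show ?thesis unfolding ipc_def norm_divide norm_of_real using volume_factor(1)
    by (simp add: divide_right_mono del: of_nat_mult)
qed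

lemma ipc_bound:
  assumes "continuous_on UNIV F" "continuous_on UNIV G" "\<And>\<xi>. norm (F \<xi> * cnj (G \<xi>) * Dh \<xi>) \<le> M"
  shows "norm (ipc F G) \<le> M"
proof -
  have M: "M \<ge> 0" using assms(3) norm_ge_zero order_trans by blast
  have "norm (ipc F G) \<le> (LINT \<xi>:AV|lborel. M) / (card W * measure lebesgue AV)"
    by (rule ipc_norm_le[OF assms(1,2) continuous_on_const assms(3)])
  also have "\<dots> = M / card W" using alcove_volume(1) by (simp add: set_integral_const)
  also have "\<dots> \<le> M / 1" using M W_nonempty(2) by (intro divide_left_mono) auto
  finally show ?thesis by simp
qed

lemma ipc_self:
  assumes "continuous_on UNIV G"
  shows "ipc G G = complex_of_real ((LINT \<xi>:AV|lborel. (norm (G \<xi>))\<^sup>2 * norm (Dh \<xi>)) / (card W * measure lebesgue AV))"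
proof -
  have "G \<xi> * cnj (G \<xi>) * Dh \<xi> = complex_of_real ((norm (G \<xi>))\<^sup>2 * norm (Dh \<xi>))" for \<xi>
    unfolding of_real_mult complex_norm_square by (simp add: Dh_eq norm_divide norm_power)
  then have "(LINT \<xi>:AV|lborel. G \<xi> * cnj (G \<xi>) * Dh \<xi>) = complex_of_real (LINT \<xi>:AV|lborel. (norm (G \<xi>))\<^sup>2 * norm (Dh \<xi>))"
    unfolding set_lebesgue_integral_def by (simp add: scaleR_conv_of_real flip: of_real_mult)
  then show ?thesis by (simp add: ipc_def)
qed

text \<open>Cauchy-Schwarz in elementary form. With \<open>y = |G| / |C|\<close> the inequality
  \<open>2 * y \<le> 1 + y ^ 2\<close> is integrated: the squares contribute exactly
  \<open>V\<close> by normalization, and the constant 1 contributes the volume of the alcove, which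
  is at most \<open>V\<close>.\<close>

lemma ipc_small:
  assumes "continuous_on UNIV F" "continuous_on UNIV G" "ipc G G = 1"
    and F: "\<And>\<xi>. norm (F \<xi>) \<le> e" and B: "\<And>\<xi>. norm (1 / C \<xi>) \<le> B"
  shows "norm (ipc F G) \<le> e * B"
proof -
  have e0: "e \<ge> 0" "B \<ge> 0" using F B norm_ge_zero order_trans by blast+
  define V where "V = card W * measure lebesgue AV"
  have V: "V > 0" "measure lebesgue AV \<le> V" unfolding V_def
    using volume_factor(1) alcove_volume(1) W_nonempty(2) by auto
  define g where "g \<xi> = (norm (G \<xi>))\<^sup>2 * norm (Dh \<xi>)" for \<xi>
  have cg: "continuous_on UNIV g" unfolding g_def[abs_def] by (intro continuous_intros assms continuous_Dh)
  have "complex_of_real ((LINT \<xi>:AV|lborel. g \<xi>) / V) = complex_of_real 1"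
    using assms(3) unfolding ipc_self[OF assms(2)] g_def V_def by simp
  then have "(LINT \<xi>:AV|lborel. g \<xi>) / V = 1" by (simp only: of_real_eq_iff)
  then have Ig: "(LINT \<xi>:AV|lborel. g \<xi>) = V" using V by simp
  have "norm (ipc F G) \<le> (LINT \<xi>:AV|lborel. (e * B / 2) * (1 + g \<xi>)) / V"
    unfolding V_def
  proof (rule ipc_norm_le[OF assms(1,2)])
    show "continuous_on UNIV (\<lambda>\<xi>. (e * B / 2) * (1 + g \<xi>))" by (intro continuous_intros cg)
    fix \<xi>
    define y where "y = norm (G \<xi>) * norm (1 / C \<xi>)"
    have "2 * y \<le> 1 + y\<^sup>2" using zero_le_power2[of "y - 1"] by (simp add: power2_diff)
    then have y: "y \<le> (1 + g \<xi>) / 2" by (simp add: y_def g_def norm_Dh power_mult_distrib)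
    have "norm (F \<xi> * cnj (G \<xi>) * Dh \<xi>) = (norm (F \<xi>) * norm (1 / C \<xi>)) * y"
      unfolding norm_mult norm_Dh y_def by (simp add: power2_eq_square)
    also have "\<dots> \<le> (e * B) * ((1 + g \<xi>) / 2)"
      using F[of \<xi>] B[of \<xi>] e0 y by (intro mult_mono) (auto simp: y_def)
    finally show "norm (F \<xi> * cnj (G \<xi>) * Dh \<xi>) \<le> (e * B / 2) * (1 + g \<xi>)" by simp
  qed
  also have "(LINT \<xi>:AV|lborel. (e * B / 2) * (1 + g \<xi>)) = (e * B / 2) * ((LINT \<xi>:AV|lborel. 1) + (LINT \<xi>:AV|lborel. g \<xi>))"
    using set_integrable_alcove[OF cg] set_integrable_alcove[OF continuous_on_const, of "1::real"]
    by (simp add: set_integral_add)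
  also have "\<dots> = (e * B / 2) * (measure lebesgue AV + V)"
    unfolding Ig set_integral_const by simp
  also have "\<dots> / V \<le> (e * B / 2) * (V + V) / V"
    using V e0 by (intro divide_right_mono mult_left_mono) auto
  also have "\<dots> = e * B" using V by simp
  finally show ?thesis .
qed

lemma mmin_le: "\<beta> \<in> Rp \<Longrightarrow> mmin Rp \<nu> \<le> \<nu> \<bullet> coroot \<beta>"
  unfolding mmin_def by (rule Min_le) auto

text \<open>Here \<open>mmin\<close> enters. An exponent of the truncated sum is
  \<open>\<rho> + \<kappa>\<close>, where \<open>\<nu> - \<kappa>\<close> pairs to at most
  \<open>d \<le> mmin Rp \<nu>\<close> with each positive coroot. So \<kappa> is dominant, and its
  alternant is \<open>delta\<close> times a Weyl character.\<close>

lemma truncated_jost: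
  assumes \<nu>: "\<nu> \<in> dominant_weights Rp" and fin: "finite (below \<nu>)"
    and l: "lead d 0 T 1" and d: "0 \<le> d" "d \<le> mmin Rp \<nu>"
  shows "\<exists>g\<in>cspan (msym R ` below \<nu>).
    \<forall>\<xi>. alternant (\<lambda>\<xi>. T \<xi> * chr (rho R Rp + \<nu>) \<xi>) \<xi> = delta R Rp \<xi> * (msym R \<nu> \<xi> + g \<xi>)"
proof -
  let ?J = "\<lambda>\<mu>. alternant (chr (rho R Rp + \<mu>))"
  define f where "f \<xi> = T \<xi> * chr (rho R Rp + \<nu>) \<xi>" for \<xi>
  have "lead (d + 0) (0 + (rho R Rp + \<nu>)) f (1 * 1)"
    unfolding f_def[abs_def] by (intro lead_mult l lead_chr d order_refl)
  then have "lead d (rho R Rp + \<nu>) f 1" by simp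
  then have "(\<lambda>\<xi>. f \<xi> - 1 * chr (rho R Rp + \<nu>) \<xi>) \<in> cspan (low d (rho R Rp + \<nu>))" unfolding lead_def .
  \<comment> \<open>The leading character is split off before antisymmetrizing, so that only
    strictly lower exponents remain; the factor -1 matches \<open>alternant_lin\<close>.\<close>
  then have "(\<lambda>\<xi>. f \<xi> + (-1) * chr (rho R Rp + \<nu>) \<xi>) \<in> cspan (low d (rho R Rp + \<nu>))" by simp
  from alternant_cspan[OF this] have G: "(\<lambda>\<xi>. alternant f \<xi> + (-1) * ?J \<nu> \<xi>) \<in> cspan (alternant ` low d (rho R Rp + \<nu>))"
    unfolding alternant_lin .
  have sub: "alternant ` low d (rho R Rp + \<nu>) \<subseteq> ?J ` below \<nu>"
  proof
    fix b assume "b \<in> alternant ` low d (rho R Rp + \<nu>)"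
    then obtain \<theta> where t: "b = alternant (chr \<theta>)" "rho R Rp + \<nu> - \<theta> \<in> poscone Rp" "\<theta> \<noteq> rho R Rp + \<nu>"
      "\<And>\<beta>. \<beta> \<in> Rp \<Longrightarrow> \<bar>(rho R Rp + \<nu> - \<theta>) \<bullet> coroot \<beta>\<bar> \<le> d" by (auto simp: low_def)
    define \<kappa> where "\<kappa> = \<theta> - rho R Rp"
    have eq: "rho R Rp + \<nu> - \<theta> = \<nu> - \<kappa>" "\<theta> = rho R Rp + \<kappa>" by (simp_all add: \<kappa>_def)
    have "weight \<kappa>" using weight_diff[OF dominant_weight[OF \<nu>] weight_poscone[OF t(2)]] by (simp add: eq)
    moreover have "\<kappa> \<bullet> coroot \<beta> \<ge> 0" if "\<beta> \<in> Rp" for \<beta>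
      using t(4)[OF that] mmin_le[OF that, of \<nu>] d unfolding eq(1) inner_diff_left by linarith
    ultimately have "\<kappa> \<in> below \<nu>" using t(2,3) weight_dominant eq by auto
    then show "b \<in> ?J ` below \<nu>" using t(1) eq(2) by blast
  qed
  have "\<exists>h\<in>cspan (msym R ` below \<mu>). \<forall>\<xi>. ?J \<mu> \<xi> = delta R Rp \<xi> * (msym R \<mu> \<xi> + h \<xi>)"
    if "\<mu> \<in> below \<nu>" for \<mu>
    by (rule weyl_character) (use that below_trans[OF that] in \<open>auto intro: finite_subset[OF _ fin]\<close>)
  from delta_quotient[OF cspan_mono[OF G sub] this] obtain g where g: "g \<in> cspan (msym R ` below \<nu>)"
    "\<And>\<xi>. alternant f \<xi> + (-1) * ?J \<nu> \<xi> = delta R Rp \<xi> * g \<xi>" by blast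
  obtain h where h: "h \<in> cspan (msym R ` below \<nu>)" "\<And>\<xi>. ?J \<nu> \<xi> = delta R Rp \<xi> * (msym R \<nu> \<xi> + h \<xi>)"
    using weyl_character[OF \<nu> fin] by blast
  have "alternant f \<xi> = delta R Rp \<xi> * (msym R \<nu> \<xi> + (g \<xi> + h \<xi>))" for \<xi>
  proof -
    have "alternant f \<xi> = delta R Rp \<xi> * g \<xi> + ?J \<nu> \<xi>" using g(2)[of \<xi>] by (simp add: algebra_simps)
    then show ?thesis unfolding h(2) by (simp add: algebra_simps)
  qed
  then show ?thesis unfolding f_def
    by (intro bexI[OF _ cspan_add[OF g(1) h(1)]]) (rule allI)
qed

text \<open>The common factor \<open>csqrt Dh\<close> enters only through its squared modulus, so
  the branch of the root drops out.\<close>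

lemma Hnorm_ipc:
  assumes "continuous_on UNIV P"
    and D_def: "D = (\<lambda>\<xi>. delta R Rp \<xi> * P \<xi> - jost \<nu> \<xi>)"
  shows "Hnorm R Rp (\<lambda>\<xi>. Psi R Rp c P \<xi> - Psi_inf R Rp c \<nu> \<xi>) = sqrt (Re (ipc D D))"
proof -
  have cD: "continuous_on UNIV D"
    unfolding D_def by (intro continuous_on_diff continuous_on_mult continuous_delta assms continuous_jost)
  have "Psi R Rp c P \<xi> - Psi_inf R Rp c \<nu> \<xi> = csqrt (Dh \<xi>) * D \<xi>" for \<xi>
    by (simp add: Psi_def Psi_inf_def D_def jost_def alternant_def chr_def algebra_simps)
  moreover have "(norm (csqrt (Dh \<xi>)))\<^sup>2 = norm (Dh \<xi>)" for \<xi>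
    by (metis norm_power power2_csqrt)
  ultimately have "(norm (Psi R Rp c P \<xi> - Psi_inf R Rp c \<nu> \<xi>))\<^sup>2 = (norm (D \<xi>))\<^sup>2 * norm (Dh \<xi>)" for \<xi>
    by (simp add: norm_mult power_mult_distrib)
  moreover have "(LINT \<xi>:AV|lebesgue. (norm (D \<xi>))\<^sup>2 * norm (Dh \<xi>)) = (LINT \<xi>:AV|lborel. (norm (D \<xi>))\<^sup>2 * norm (Dh \<xi>))"
    by (intro set_integral_lebesgue_alcove continuous_intros cD continuous_Dh)
  ultimately show ?thesis unfolding Hnorm_def ipc_self[OF cD] by simp
qed

lemma ipc_diff:
  assumes "continuous_on UNIV F" "continuous_on UNIV G"
  shows "ipc (\<lambda>\<xi>. F \<xi> - G \<xi>) (\<lambda>\<xi>. F \<xi> - G \<xi>) = ipc F F - ipc F G - ipc G F + ipc G G"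
proof -
  have cD: "continuous_on UNIV (\<lambda>\<xi>. F \<xi> - G \<xi>)" by (intro continuous_on_diff assms)
  have l: "ipc (\<lambda>\<xi>. F \<xi> - G \<xi>) H = ipc F H - ipc G H" if "continuous_on UNIV H" for H
    using ipc_lincomb[OF assms that, of "-1"] by simp
  have "ipc F (\<lambda>\<xi>. F \<xi> - G \<xi>) = cnj (ipc (\<lambda>\<xi>. F \<xi> - G \<xi>) F)" "ipc G (\<lambda>\<xi>. F \<xi> - G \<xi>) = cnj (ipc (\<lambda>\<xi>. F \<xi> - G \<xi>) G)"
    by (rule ipc_cnj)+
  then show ?thesis using l[OF cD] l[OF assms(1)] l[OF assms(2)] ipc_cnj[of F G] ipc_cnj[of F F] ipc_cnj[of G G] by simp
qed

text \<open>A bound for one weight, in which the constant in front of \<open>e\<close> depends only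
  on \<open>card W\<close>, \<open>B\<close> and \<open>B'\<close>; this is what makes it uniform in
  \<nu>.\<close>

lemma asymptotic_estimate:
  fixes a d e B B' :: real
  assumes \<nu>: "\<nu> \<in> dominant_weights Rp" and fin: "finite (below \<nu>)"
    and L: "finite L" "L \<subseteq> dominant_weights Rp" "\<nu> \<in> L" "\<And>\<mu>. \<mu> \<in> L \<Longrightarrow> \<mu> \<noteq> \<nu> \<Longrightarrow> \<mu> - \<nu> \<notin> poscone Rp"
    and P: "P = (\<lambda>\<xi>. \<Sum>\<mu>\<in>L. b \<mu> * msym R \<mu> \<xi>)" and b: "b \<nu> = complex_of_real a" "a > 0"
    and norm1: "ipc (\<lambda>\<xi>. delta R Rp \<xi> * P \<xi>) (\<lambda>\<xi>. delta R Rp \<xi> * P \<xi>) = 1"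
    and orth: "\<And>\<mu>. \<mu> \<in> L \<Longrightarrow> \<mu> \<noteq> \<nu> \<Longrightarrow> ipc (\<lambda>\<xi>. delta R Rp \<xi> * msym R \<mu> \<xi>) (\<lambda>\<xi>. delta R Rp \<xi> * P \<xi>) = 0"
    and sub: "below \<nu> \<subseteq> L"
    and lT: "lead d 0 T 1" and d: "0 \<le> d" "d \<le> mmin Rp \<nu>"
    and TC: "\<And>\<xi>. norm (C \<xi> - T \<xi>) \<le> e" and B: "\<And>\<xi>. norm (1 / C \<xi>) \<le> B" and B': "\<And>\<xi>. norm (C \<xi>) \<le> B'"
  shows "Hnorm R Rp (\<lambda>\<xi>. Psi R Rp c P \<xi> - Psi_inf R Rp c \<nu> \<xi>)
    \<le> sqrt ((2 * card W * B + (card W)\<^sup>2 * B' * B\<^sup>2) * e)"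
proof -
  let ?dm = "\<lambda>\<mu> \<xi>. delta R Rp \<xi> * msym R \<mu> \<xi>"
  define p where "p \<xi> = delta R Rp \<xi> * P \<xi>" for \<xi>
  define j where "j = jost \<nu>"
  have cm: "continuous_on UNIV (?dm \<mu>)" for \<mu> by (intro continuous_on_mult continuous_delta continuous_msym)
  have cP: "continuous_on UNIV P" unfolding P by (intro continuous_on_sum continuous_on_mult_left continuous_msym)
  have cp: "continuous_on UNIV p" unfolding p_def[abs_def] by (intro continuous_on_mult continuous_delta cP)
  have cj: "continuous_on UNIV j" unfolding j_def by (rule continuous_jost)
  have psum: "p = (\<lambda>\<xi>. \<Sum>\<mu>\<in>L. b \<mu> * ?dm \<mu> \<xi>)"
    by (simp add: p_def[abs_def] P sum_distrib_left mult_ac)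
  \<comment> \<open>Only the term of \<nu> survives, as no other weight in \<open>L\<close>
    dominates \<nu>.\<close>
  have pj: "ipc p j = complex_of_real a"
  proof -
    have "ipc p j = (\<Sum>\<mu>\<in>L. b \<mu> * ipc (?dm \<mu>) j)" unfolding psum by (rule ipc_sum[OF L(1) cm cj])
    also have "\<dots> = (\<Sum>\<mu>\<in>L. if \<mu> = \<nu> then b \<nu> else 0)"
    proof (rule sum.cong)
      fix \<mu> assume m: "\<mu> \<in> L"
      then have "ipc (?dm \<mu>) j = (if \<mu> = \<nu> then 1 else 0)"
        unfolding j_def using L by (intro ipc_msym_jost \<nu>) auto
      then show "b \<mu> * ipc (?dm \<mu>) j = (if \<mu> = \<nu> then b \<nu> else 0)" by simp
    qed simp
    finally show ?thesis using L b by simp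
  qed
  have pp: "ipc p p = 1" using norm1 unfolding p_def .
  \<comment> \<open>Expanding the first argument of \<open>ipc p p = 1\<close> leaves
    \<open>a\<close> times this pairing, since \<open>p\<close> is orthogonal to the other
    monomials.\<close>
  have mp: "ipc (?dm \<nu>) p = complex_of_real (1 / a)"
  proof -
    have "ipc p p = (\<Sum>\<mu>\<in>L. b \<mu> * ipc (?dm \<mu>) p)"
      by (subst (1) psum, rule ipc_sum[OF L(1) cm cp])
    also have "\<dots> = (\<Sum>\<mu>\<in>L. if \<mu> = \<nu> then b \<nu> * ipc (?dm \<nu>) p else 0)"
      unfolding p_def[abs_def] by (rule sum.cong) (use orth in auto)
    finally have "complex_of_real a * ipc (?dm \<nu>) p = 1" using pp L b by simp
    then show ?thesis using b(2) by (simp add: field_simps)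
  qed
  obtain g where g: "g \<in> cspan (msym R ` below \<nu>)"
    "\<And>\<xi>. alternant (\<lambda>\<xi>. T \<xi> * chr (rho R Rp + \<nu>) \<xi>) \<xi> = delta R Rp \<xi> * (msym R \<nu> \<xi> + g \<xi>)"
    using truncated_jost[OF \<nu> fin lT d] by blast
  \<comment> \<open>By the choice of \<open>g\<close> this is the truncated alternating sum; the
    factor 1 gives it the shape of \<open>ipc_lincomb\<close>.\<close>
  define q where "q \<xi> = ?dm \<nu> \<xi> + 1 * (delta R Rp \<xi> * g \<xi>)" for \<xi>
  have dg: "(\<lambda>\<xi>. delta R Rp \<xi> * g \<xi>) \<in> cspan ((\<lambda>f \<xi>. delta R Rp \<xi> * f \<xi>) ` (msym R ` below \<nu>))"
    using cspan_linear_image[OF g(1), of "\<lambda>f \<xi>. delta R Rp \<xi> * f \<xi>"] by (simp add: distrib_left mult.left_commute)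
  have cdg: "continuous_on UNIV (\<lambda>\<xi>. delta R Rp \<xi> * g \<xi>)"
    by (rule continuous_cspan[OF dg]) (use cm in auto)
  have cq: "continuous_on UNIV q" unfolding q_def[abs_def] by (intro continuous_on_add continuous_on_mult_left cm cdg)
  have qj: "ipc q j = 1"
  proof -
    have "ipc (\<lambda>\<xi>. delta R Rp \<xi> * g \<xi>) j = 0"
    proof (rule ipc_cspan[OF dg _ _ cj])
      fix f assume "f \<in> (\<lambda>f \<xi>. delta R Rp \<xi> * f \<xi>) ` (msym R ` below \<nu>)"
      then obtain \<mu> where m: "\<mu> \<in> below \<nu>" "f = ?dm \<mu>" by blast
      then show "ipc f j = 0"
        using ipc_msym_jost[of \<mu> \<nu>] \<nu> L sub unfolding j_def by auto
    qed (use cm in auto)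
    moreover have "ipc (?dm \<nu>) j = 1" unfolding j_def using ipc_msym_jost[OF \<nu> \<nu>] by simp
    ultimately show ?thesis unfolding q_def[abs_def] ipc_lincomb[OF cm cdg cj] by simp
  qed
  have qp: "ipc q p = complex_of_real (1 / a)"
  proof -
    have "ipc (\<lambda>\<xi>. delta R Rp \<xi> * g \<xi>) p = 0"
    proof (rule ipc_cspan[OF dg _ _ cp])
      fix f assume "f \<in> (\<lambda>f \<xi>. delta R Rp \<xi> * f \<xi>) ` (msym R ` below \<nu>)"
      then obtain \<mu> where m: "\<mu> \<in> below \<nu>" "f = ?dm \<mu>" by blast
      then show "ipc f p = 0" using orth[of \<mu>] sub unfolding p_def[abs_def] by auto
    qed (use cm in auto)
    then show ?thesis unfolding q_def[abs_def] ipc_lincomb[OF cm cdg cp] mp by simp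
  qed
  define E where "E \<xi> = j \<xi> - q \<xi>" for \<xi>
  have cE: "continuous_on UNIV E" unfolding E_def[abs_def] by (intro continuous_on_diff cj cq)
  have split: "ipc j H = ipc q H + ipc E H" if "continuous_on UNIV H" for H
    using ipc_lincomb[OF cq cE that, of 1] by (simp add: E_def)
  have e0: "e \<ge> 0" "B \<ge> 0" "B' \<ge> 0" using TC B B' norm_ge_zero order_trans by blast+
  have sg: "\<bar>wsign w\<bar> = 1" if "w \<in> W" for w
    using wsign_square[OF that] by (metis real_sqrt_abs2 real_sqrt_one)
  have Eb: "norm (E \<xi>) \<le> card W * e" for \<xi>
  proof -
    have "E \<xi> = j \<xi> - alternant (\<lambda>\<xi>. T \<xi> * chr (rho R Rp + \<nu>) \<xi>) \<xi>"
      unfolding E_def q_def g(2) by (simp add: algebra_simps)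
    also have "\<dots> = (\<Sum>w\<in>W. complex_of_real (wsign w) * ((C (w \<xi>) - T (w \<xi>)) * chr (rho R Rp + \<nu>) (w \<xi>)))"
      by (simp add: j_def jost_def alternant_def sum_subtractf[symmetric] algebra_simps)
    also have "norm \<dots> \<le> card W * e"
      by (rule sum_norm_bound) (simp add: norm_mult sg TC)
    finally show ?thesis .
  qed
  have jb: "norm (j \<xi>) \<le> card W * B'" for \<xi>
    unfolding j_def jost_def alternant_def by (rule sum_norm_bound) (simp add: norm_mult sg B')
  define x where "x = ipc E p"
  define y where "y = ipc E j"
  \<comment> \<open>The uniform bound \<open>Eb\<close> is combined with the normalization of
    \<open>p\<close> here, and with the uniform bound \<open>jb\<close> for
    \<open>y\<close>.\<close>
  have xb: "norm x \<le> (card W * e) * B"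
    unfolding x_def by (rule ipc_small[OF cE cp pp Eb B])
  have yb: "norm y \<le> (card W * e) * (card W * B') * B\<^sup>2"
    unfolding y_def
  proof (rule ipc_bound[OF cE cj])
    fix \<xi>
    show "norm (E \<xi> * cnj (j \<xi>) * Dh \<xi>) \<le> (card W * e) * (card W * B') * B\<^sup>2"
      unfolding norm_mult norm_Dh complex_mod_cnj
      using Eb jb B e0 by (intro mult_mono power_mono) auto
  qed
  have "ipc j p = cnj (ipc p j)" by (rule ipc_cnj)
  then have jp: "ipc j p = complex_of_real a" using pj by simp
  have "complex_of_real a = complex_of_real (1 / a) + x" using split[OF cp] jp qp by (simp add: x_def)
  then have "x = complex_of_real (a - 1 / a)" unfolding of_real_diff by (simp only: add_diff_cancel_left')
  then have "norm x = \<bar>a - 1 / a\<bar>" by (simp only: norm_of_real)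
  \<comment> \<open>The second factor is at least 1, so \<open>|a - 1|\<close> is at most
    \<open>norm x\<close>.\<close>
  also have "a - 1 / a = (a - 1) * ((a + 1) / a)" using b(2) by (simp add: field_simps)
  also have "\<bar>\<dots>\<bar> = \<bar>a - 1\<bar> * ((a + 1) / a)" using b(2) by (simp add: abs_mult)
  finally have "\<bar>a - 1\<bar> * 1 \<le> norm x" using b(2) by (simp only:, intro mult_left_mono) (auto simp: field_simps)
  then have a1: "1 - a \<le> norm x" using abs_ge_minus_self[of "a - 1"] by simp
  have jj: "ipc j j = 1 + y" using split[OF cj] qj by (simp add: y_def)
  have "ipc (\<lambda>\<xi>. p \<xi> - j \<xi>) (\<lambda>\<xi>. p \<xi> - j \<xi>) = 2 * (1 - complex_of_real a) + y"
    unfolding ipc_diff[OF cp cj] pp pj jp jj by simp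
  then have "Re (ipc (\<lambda>\<xi>. p \<xi> - j \<xi>) (\<lambda>\<xi>. p \<xi> - j \<xi>)) = 2 * (1 - a) + Re y" by simp
  also have "\<dots> \<le> 2 * ((card W * e) * B) + (card W * e) * (card W * B') * B\<^sup>2"
    by (intro add_mono mult_left_mono order_trans[OF a1 xb] order_trans[OF complex_Re_le_cmod yb]) simp
  also have "\<dots> = (2 * card W * B + (card W)\<^sup>2 * B' * B\<^sup>2) * e" by (simp add: algebra_simps power2_eq_square)
  finally have "Re (ipc (\<lambda>\<xi>. p \<xi> - j \<xi>) (\<lambda>\<xi>. p \<xi> - j \<xi>)) \<le> (2 * card W * B + (card W)\<^sup>2 * B' * B\<^sup>2) * e" .
  then show ?thesis unfolding Hnorm_ipc[OF cP refl] by (simp add: p_def j_def)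
qed

end

text \<open>Rounding down costs at most one power of \<open>s\<close>, which accounts for the factor
  \<open>1 / s\<close>.\<close>

lemma power_floor_bound:
  fixes s D m :: real
  assumes "0 < s" "s < 1" "D > 0" "m \<ge> 0"
  shows "s ^ nat \<lfloor>m / D\<rfloor> \<le> (1 / s) * exp (- (ln (1 / s) / D) * m)"
proof -
  have "m / D - 1 \<le> real (nat \<lfloor>m / D\<rfloor>)" using assms by (simp add: of_nat_nat)
  then have "s powr (nat \<lfloor>m / D\<rfloor>) \<le> s powr (m / D - 1)" using assms by (intro powr_mono') auto
  also have "\<dots> = (1 / s) * exp (- (ln (1 / s) / D) * m)"
  proof -
    have "s powr (m / D) = exp (- (ln (1 / s) / D) * m)" using assms by (simp add: powr_def ln_div mult.commute)
    then show ?thesis using assms by (simp add: powr_diff)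
  qed
  finally show ?thesis unfolding powr_realpow[OF assms(1)] .
qed

theorem theorem4p1:
  fixes R Rp :: "(real^'n::finite) set"
    and c :: "real^'n \<Rightarrow> complex \<Rightarrow> complex"
    and ord :: "real^'n \<Rightarrow> real^'n \<Rightarrow> bool"
    and a :: "real^'n \<Rightarrow> real^'n \<Rightarrow> complex"
    and P :: "real^'n \<Rightarrow> real^'n \<Rightarrow> complex"
  assumes rs: "crystallographic_root_system R"
    and irr: "irreducible_root_system R"
    and pos: "positive_system R Rp"
    and c_orbit: "\<forall>\<alpha>\<in>roots1 R \<inter> Rp. \<forall>\<beta>\<in>roots1 R \<inter> Rp. \<forall>w\<in>weyl_group R.
                    w \<alpha> = \<beta> \<longrightarrow> c \<alpha> = c \<beta>"
    and c_disc: "\<exists>r::real>1. \<forall>\<alpha>\<in>roots1 R \<inter> Rp.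
                    c \<alpha> analytic_on cball 0 r \<and> (\<forall>z\<in>cball 0 r. c \<alpha> z \<noteq> 0)"
    and c_zero: "\<forall>\<alpha>\<in>roots1 R \<inter> Rp. c \<alpha> 0 = 1"
    and c_real: "\<forall>\<alpha>\<in>roots1 R \<inter> Rp. \<forall>x::real. c \<alpha> (complex_of_real x) \<in> \<real>"
    and ord_refl: "\<forall>lam\<in>dominant_weights Rp. ord lam lam"
    and ord_antisym: "\<forall>lam\<in>dominant_weights Rp. \<forall>\<mu>\<in>dominant_weights Rp.
                        ord lam \<mu> \<longrightarrow> ord \<mu> lam \<longrightarrow> lam = \<mu>"
    and ord_trans: "\<forall>lam\<in>dominant_weights Rp. \<forall>\<mu>\<in>dominant_weights Rp. \<forall>\<nu>\<in>dominant_weights Rp.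
                        ord lam \<mu> \<longrightarrow> ord \<mu> \<nu> \<longrightarrow> ord lam \<nu>"
    and ord_refines: "\<forall>lam\<in>dominant_weights Rp. \<forall>\<mu>\<in>dominant_weights Rp.
                        dominance Rp lam \<mu> \<longrightarrow> ord lam \<mu>"
    and ord_finite: "\<forall>lam\<in>dominant_weights Rp. finite {\<mu>\<in>dominant_weights Rp. ord lam \<mu>}"
    and P_def: "\<forall>lam\<in>dominant_weights Rp.
                  P lam = (\<lambda>\<xi>. \<Sum>\<mu>\<in>{\<mu>\<in>dominant_weights Rp. ord lam \<mu>}. a lam \<mu> * msym R \<mu> \<xi>)"
    and a_diag: "\<forall>lam\<in>dominant_weights Rp. Im (a lam lam) = 0 \<and> Re (a lam lam) > 0"
    and P_orthonormal: "\<forall>lam\<in>dominant_weights Rp. \<forall>\<mu>\<in>dominant_weights Rp.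
                          ip_Delta R Rp c (P lam) (P \<mu>) = (if lam = \<mu> then 1 else 0)"
  shows "\<exists>\<epsilon>>0. \<exists>K M. \<forall>lam\<in>dominant_weights Rp. mmin Rp lam \<ge> M \<longrightarrow>
           Hnorm R Rp (\<lambda>\<xi>. Psi R Rp c (P lam) \<xi> - Psi_inf R Rp c lam \<xi>)
             \<le> K * exp (- \<epsilon> * mmin Rp lam)"
proof -
  obtain v where v: "\<And>\<alpha>. \<alpha> \<in> R \<Longrightarrow> \<alpha> \<bullet> v \<noteq> 0" "Rp = {\<alpha>\<in>R. \<alpha> \<bullet> v > 0}"
    using pos unfolding positive_system_def by blast
  obtain r :: real where r: "r > 1"
    "\<And>\<alpha>. \<alpha> \<in> roots1 R \<inter> Rp \<Longrightarrow> c \<alpha> analytic_on cball 0 r"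
    "\<And>\<alpha> z. \<alpha> \<in> roots1 R \<inter> Rp \<Longrightarrow> z \<in> cball 0 r \<Longrightarrow> c \<alpha> z \<noteq> 0"
    using c_disc by blast
  interpret root_system R Rp v
    by unfold_locales (use rs v in auto)
  interpret root_system_c R Rp v c r
    by unfold_locales (use c_orbit r c_zero c_real in auto)
  let ?DW = "dominant_weights Rp"
  define L where "L \<nu> = {\<mu>\<in>?DW. ord \<nu> \<mu>}" for \<nu>
  have L: "finite (L \<nu>)" "\<nu> \<in> L \<nu>" if "\<nu> \<in> ?DW" for \<nu>
    using that ord_finite ord_refl by (auto simp: L_def)
  have PL: "P \<nu> = (\<lambda>\<xi>. \<Sum>\<mu>\<in>L \<nu>. a \<nu> \<mu> * msym R \<mu> \<xi>)" if "\<nu> \<in> ?DW" for \<nu>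
    using P_def that by (simp add: L_def)
  have cP: "continuous_on UNIV (P \<nu>)" if "\<nu> \<in> ?DW" for \<nu>
    unfolding PL[OF that] by (intro continuous_on_sum continuous_on_mult_left continuous_msym)
  define p where "p \<nu> = (\<lambda>\<xi>. delta R Rp \<xi> * P \<nu> \<xi>)" for \<nu>
  let ?dm = "\<lambda>\<mu> \<xi>. delta R Rp \<xi> * msym R \<mu> \<xi>"
  have cm: "continuous_on UNIV (?dm \<mu>)" for \<mu> by (intro continuous_on_mult continuous_delta continuous_msym)
  have cp: "continuous_on UNIV (p \<nu>)" if "\<nu> \<in> ?DW" for \<nu>
    unfolding p_def by (intro continuous_on_mult continuous_delta cP that)
  have pp: "ipc (p \<mu>) (p \<nu>) = (if \<mu> = \<nu> then 1 else 0)" if "\<mu> \<in> ?DW" "\<nu> \<in> ?DW" for \<mu> \<nu>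
    unfolding p_def ip_Delta_ipc[OF cP[OF that(1)] cP[OF that(2)], symmetric] using P_orthonormal that by blast
  \<comment> \<open>The triangular definition of \<open>P\<close> is inverted by induction on the
    size of the lower set of \<mu>: in \<open>ipc (p \<mu>) (p \<nu>) = 0\<close> the lower
    monomials contribute nothing by induction, and the diagonal coefficient is nonzero.\<close>
  have orth: "ipc (?dm \<mu>) (p \<nu>) = 0" if "\<mu> \<in> ?DW" "\<nu> \<in> ?DW" "ord \<nu> \<mu>" "\<mu> \<noteq> \<nu>" for \<mu> \<nu>
    using that
  proof (induction "card (L \<mu>)" arbitrary: \<mu> rule: less_induct)
    case less
    have "ipc (?dm \<kappa>) (p \<nu>) = 0" if k: "\<kappa> \<in> L \<mu> - {\<mu>}" for \<kappa>
    proof (rule less.hyps)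
      have k': "\<kappa> \<in> ?DW" "ord \<mu> \<kappa>" "\<kappa> \<noteq> \<mu>" using k by (auto simp: L_def)
      have "L \<kappa> \<subseteq> L \<mu>" unfolding L_def using k' less.prems(1) ord_trans by blast
      moreover have "\<mu> \<notin> L \<kappa>" unfolding L_def using k' less.prems(1) ord_antisym by blast
      ultimately show "card (L \<kappa>) < card (L \<mu>)"
        using L[OF less.prems(1)] by (intro psubset_card_mono) auto
      show "\<kappa> \<in> ?DW" "\<nu> \<in> ?DW" by fact+
      show "ord \<nu> \<kappa>" using ord_trans less.prems k' by blast
      show "\<kappa> \<noteq> \<nu>" using ord_antisym less.prems k' by blast
    qed
    then have z: "(\<Sum>\<kappa>\<in>L \<mu> - {\<mu>}. a \<mu> \<kappa> * ipc (?dm \<kappa>) (p \<nu>)) = 0" by simp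
    have pm: "p \<mu> = (\<lambda>\<xi>. \<Sum>\<kappa>\<in>L \<mu>. a \<mu> \<kappa> * ?dm \<kappa> \<xi>)"
      unfolding p_def PL[OF less.prems(1)] by (simp add: sum_distrib_left mult_ac)
    have "0 = ipc (p \<mu>) (p \<nu>)" using pp less.prems by simp
    also have "\<dots> = (\<Sum>\<kappa>\<in>L \<mu>. a \<mu> \<kappa> * ipc (?dm \<kappa>) (p \<nu>))"
      unfolding pm by (rule ipc_sum[OF L(1)[OF less.prems(1)] cm cp[OF less.prems(2)]])
    also have "\<dots> = a \<mu> \<mu> * ipc (?dm \<mu>) (p \<nu>)"
      using sum.remove[OF L[OF less.prems(1)], of "\<lambda>\<kappa>. a \<mu> \<kappa> * ipc (?dm \<kappa>) (p \<nu>)"] z by simp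
    finally show ?case using a_diag less.prems(1) by (metis less_irrefl mult_eq_0_iff zero_complex.sel(1))
  qed
  obtain T K s B' where T: "0 < s" "s < 1" "\<And>N \<xi>. norm (C \<xi> - T N \<xi>) \<le> K * s ^ N"
      "\<And>\<xi>. norm (C \<xi>) \<le> B'" "\<And>N. N \<ge> 1 \<Longrightarrow> lead (real N * Dbound) 0 (T N) 1"
    using C_truncation by blast
  obtain B where B: "\<And>\<xi>. norm (1 / C \<xi>) \<le> B" using inverse_C_truncation by blast
  define A where "A = 2 * card W * B + (card W)\<^sup>2 * B' * B\<^sup>2"
  have nn: "B \<ge> 0" "B' \<ge> 0" using B T(4) norm_ge_zero order_trans by blast+
  have K0: "K \<ge> 0" using T(3)[of 0 0] norm_ge_zero order_trans by (metis mult_1_right power_0)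
  have A0: "A \<ge> 0" unfolding A_def using nn by simp
  \<comment> \<open>The added 1 makes \<open>D\<close> positive, so that \<open>mmin\<close> can be
    divided by it.\<close>
  define D where "D = Dbound + 1"
  have D: "D > 0" "Dbound \<ge> 0" unfolding D_def Dbound_def using cobound_nonneg by (auto intro: add_nonneg_pos)
  define e where "e = ln (1 / s) / D"
  have e: "e > 0" unfolding e_def using T D by (simp add: ln_gt_zero)
  have "Hnorm R Rp (\<lambda>\<xi>. Psi R Rp c (P \<nu>) \<xi> - Psi_inf R Rp c \<nu> \<xi>) \<le> sqrt (A * K / s) * exp (- (e / 2) * mmin Rp \<nu>)"
    if \<nu>: "\<nu> \<in> ?DW" and m: "mmin Rp \<nu> \<ge> D" for \<nu>
  proof -
    \<comment> \<open>\<open>mmin Rp \<nu> \<ge> D\<close> gives \<open>N \<ge> 1\<close>, which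
      retains the constant term, and rounding down keeps \<open>N * Dbound\<close> within
      \<open>mmin Rp \<nu>\<close>.\<close>
    define N where "N = nat \<lfloor>mmin Rp \<nu> / D\<rfloor>"
    have "1 \<le> mmin Rp \<nu> / D" using m D by simp
    then have N: "N \<ge> 1" "real N \<le> mmin Rp \<nu> / D" unfolding N_def by (simp_all add: le_nat_iff le_floor_iff of_nat_nat)
    have "real N * Dbound \<le> real N * D" unfolding D_def by (simp add: mult_left_mono)
    also have "\<dots> \<le> mmin Rp \<nu>" using N D by (simp add: field_simps)
    finally have ND: "real N * Dbound \<le> mmin Rp \<nu>" .
    have sub: "below \<nu> \<subseteq> L \<nu>" using ord_refines \<nu> by (auto simp: L_def dominance_iff)
    have "Hnorm R Rp (\<lambda>\<xi>. Psi R Rp c (P \<nu>) \<xi> - Psi_inf R Rp c \<nu> \<xi>) \<le> sqrt (A * (K * s ^ N))"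
      unfolding A_def
    proof (rule asymptotic_estimate[OF \<nu> finite_subset[OF sub L(1)[OF \<nu>]] L(1)[OF \<nu>] _ L(2)[OF \<nu>] _ PL[OF \<nu>] _ _ _ _ sub])
      show "L \<nu> \<subseteq> ?DW" by (auto simp: L_def)
      \<comment> \<open>Otherwise refinement of dominance would give \<open>ord \<mu> \<nu>\<close>,
        against antisymmetry.\<close>
      show "\<mu> - \<nu> \<notin> poscone Rp" if "\<mu> \<in> L \<nu>" "\<mu> \<noteq> \<nu>" for \<mu>
        using that \<nu> ord_refines ord_antisym unfolding dominance_iff L_def by blast
      show "a \<nu> \<nu> = complex_of_real (Re (a \<nu> \<nu>))" "Re (a \<nu> \<nu>) > 0" using a_diag \<nu> by (auto simp: complex_eq_iff)
      show "ipc (\<lambda>\<xi>. delta R Rp \<xi> * P \<nu> \<xi>) (\<lambda>\<xi>. delta R Rp \<xi> * P \<nu> \<xi>) = 1" using pp[OF \<nu> \<nu>] by (simp add: p_def)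
      show "ipc (?dm \<mu>) (\<lambda>\<xi>. delta R Rp \<xi> * P \<nu> \<xi>) = 0" if "\<mu> \<in> L \<nu>" "\<mu> \<noteq> \<nu>" for \<mu>
        using orth[OF _ \<nu>, of \<mu>] that by (simp add: p_def L_def)
      show "lead (real N * Dbound) 0 (T N) 1" by (rule T(5)[OF N(1)])
      show "0 \<le> real N * Dbound" using D by simp
    qed (use ND T B in auto)
    also have "A * (K * s ^ N) \<le> A * (K * ((1 / s) * exp (- e * mmin Rp \<nu>)))"
      unfolding N_def e_def using T D m A0 K0 by (intro mult_left_mono power_floor_bound) auto
    then have "sqrt (A * (K * s ^ N)) \<le> sqrt ((A * K / s) * exp (- e * mmin Rp \<nu>))" by (simp add: mult_ac)
    also have "\<dots> = sqrt (A * K / s) * sqrt (exp (- e * mmin Rp \<nu>))" by (rule real_sqrt_mult)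
    \<comment> \<open>The square root in the norm halves the exponential rate, hence
      \<open>e / 2\<close>.\<close>
    also have "exp (- e * mmin Rp \<nu>) = (exp (- (e / 2) * mmin Rp \<nu>))\<^sup>2" by (simp flip: exp_double)
    also have "sqrt \<dots> = exp (- (e / 2) * mmin Rp \<nu>)" by simp
    finally show ?thesis .
  qed
  then show ?thesis using e by (intro exI[of _ "e / 2"] conjI exI[of _ "sqrt (A * K / s)"] exI[of _ D]) auto
qed

end
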